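(* (I) The point spectrum of the right convolution operator $R_{\widetilde\mu_{\mathrm{bd}}}:F\mapsto F*\widetilde\mu_{\mathrm{bd}}$ on $\ell^2(\mathcal L^{\mathrm{bd}}\rtimes G)$ comprises (that is, contains) the set $$\Lambda^{\mathrm{bd}}=\bigcup\bigl\{\operatorname{spec}(P_A):A\in\mathcal C^{\mathrm{bd}}\bigr\}.$$ For each eigenvalue $\lambda\in\Lambda^{\mathrm{bd}}$, the eigenspace contains infinitely many linearly independent eigenfunctions with finite support. (II) If $\mathsf p=1/|H|$ is such that bond percolation on $X(G,S)$ with parameter $\mathsf p$ satisfies $\theta(\mathsf p)=0$, that is, $$\mathsf{Pr}_{\mathsf p}[C^{\mathrm{bd}}(e)\text{ is finite}]=1,$$ then $\operatorname{spec}(R_{\widetilde\mu_{\mathrm{bd}}})$ is pure point; it is the closure of $\Lambda^{\mathrm{bd}}$. There is a complete orthonormal system in $\ell^2(\mathcal L^{\mathrm{bd}}\rtimes G)$ consisting of finitely supported eigenfunctions associated with the eigenvalues in $\Lambda^{\mathrm{bd}}$.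
   Context: $G$ is a finitely generated group with identity $e$; $H$ is a finite group with identity $o$ and $|H|\ge2$. $\mu$ is a symmetric probability measure on $G$ whose support $S$ is finite and generates $G$; $p(x,y)=\mu(x^{-1}y)$. The Cayley graph $X(G,S)$ has vertex set $G$ and unoriented edge set $E=\{[x,xs]=[xs,x]:x\in G,s\in S\}$. $\mathcal L^{\mathrm{bd}}=\bigoplus_EH$ is the group (under pointwise multiplication) of functions $\eta:E\to H$ with finite support $\operatorname{supp}(\eta)=\{\varepsilon\in E:\eta(\varepsilon)\neq o\}$, with identity $\iota\equiv o$. $G$ acts on $E$ by $g[x,y]=[gx,gy]$ and on $\mathcal L^{\mathrm{bd}}$ by $L_g\eta([x,y])=\eta([g^{-1}x,g^{-1}y])$; $\mathcal L^{\mathrm{bd}}\rtimes G$ has product $(\eta,g)(\eta',g')=(\eta\cdot L_g\eta',gg')$. The symmetric probability measure $\widetilde\mu_{\mathrm{bd}}$ on it is $$\widetilde\mu_{\mathrm{bd}}(\eta,g)=\begin{cases}\mu(g)/|H|,&\text{if }g\in S\text{ and }\operatorname{supp}(\eta)\subset\{[e,g]\},\\0,&\text{otherwise.}\end{cases}$$ The point spectrum of an operator is its set of eigenvalues. $\mathcal C^{\mathrm{bd}}$ is the family of all finite connected subgraphs $A$ of $X(G,S)$ (not necessarily induced: a vertex set and a set of edges $E(A)\subset E$ between these vertices) that contain the vertex $e$. $P_A$ is the matrix, indexed by the vertices of $A$, with entries $p_A(x,y)=p(x,y)$ if $[x,y]\in E(A)$ and $0$ otherwise, and $\operatorname{spec}(P_A)$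 is its spectrum. Bond percolation with parameter $\mathsf p$: each edge in $E$ is independently open with probability $\mathsf p$ and closed otherwise; closed edges are removed, and $C^{\mathrm{bd}}(e)$ is the connected component of $e$ in the remaining graph; $\mathsf{Pr}_{\mathsf p}$ is the corresponding probability and $\theta(\mathsf p)=\mathsf{Pr}_{\mathsf p}[C^{\mathrm{bd}}(e)\text{ is infinite}]$. The spectrum of a self-adjoint operator is called pure point if the Hilbert space has a complete orthonormal system of eigenvectors.
   Formalization: The clause that each eigenspace contains infinitely many linearly independent finitely supported eigenfunctions is stated only for infinite G; for finite G the space ℓ² is finite-dimensional and that clause is false. *)

theory Defs
  imports
    "HOL-Algebra.Product_Groups"
    "HOL-Probability.Probability"
    "HOL-Library.Function_Algebras"
begin

section \<open>The Hilbert space \<open>\<ell>\<^sup>2(X)\<close> and operators on it\<close>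

text \<open>
  Elements of \<open>\<ell>\<^sup>2(X)\<close> are complex functions on the ambient type that vanish off \<open>X\<close>, so that
  equality in \<open>\<ell>\<^sup>2(X)\<close> is equality of functions. Operators are total functions of which only the
  values on \<open>\<ell>\<^sup>2(X)\<close> matter.
\<close>

definition ell2 :: "'a set \<Rightarrow> ('a \<Rightarrow> complex) set" where
  "ell2 X = {F. (\<forall>x. x \<notin> X \<longrightarrow> F x = 0) \<and> (\<lambda>x. (cmod (F x))\<^sup>2) summable_on X}"

definition ell2_inner :: "'a set \<Rightarrow> ('a \<Rightarrow> complex) \<Rightarrow> ('a \<Rightarrow> complex) \<Rightarrow> complex" where
  "ell2_inner X F K = (\<Sum>\<^sub>\<infinity>x\<in>X. F x * cnj (K x))"

definition ell2_norm :: "'a set \<Rightarrow> ('a \<Rightarrow> complex) \<Rightarrow> real" where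
  "ell2_norm X F = sqrt (\<Sum>\<^sub>\<infinity>x\<in>X. (cmod (F x))\<^sup>2)"

definition cscale :: "complex \<Rightarrow> ('a \<Rightarrow> complex) \<Rightarrow> 'a \<Rightarrow> complex" where
  "cscale c F = (\<lambda>x. c * F x)"

interpretation cfun: vector_space "cscale :: complex \<Rightarrow> ('a \<Rightarrow> complex) \<Rightarrow> 'a \<Rightarrow> complex"
  by unfold_locales (auto simp: cscale_def algebra_simps)

definition ell2_bounded_operator ::
  "'a set \<Rightarrow> (('a \<Rightarrow> complex) \<Rightarrow> ('a \<Rightarrow> complex)) \<Rightarrow> bool" where
  "ell2_bounded_operator X T \<longleftrightarrow>
     (\<forall>F\<in>ell2 X. T F \<in> ell2 X) \<and>
     (\<forall>F\<in>ell2 X. \<forall>K\<in>ell2 X. T (F + K) = T F + T K) \<and>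
     (\<forall>c. \<forall>F\<in>ell2 X. T (cscale c F) = cscale c (T F)) \<and>
     (\<exists>C. \<forall>F\<in>ell2 X. ell2_norm X (T F) \<le> C * ell2_norm X F)"

text \<open>Meant for operators \<open>T\<close> that map \<open>\<ell>\<^sup>2(X)\<close> to itself.\<close>

definition ell2_spectrum ::
  "'a set \<Rightarrow> (('a \<Rightarrow> complex) \<Rightarrow> ('a \<Rightarrow> complex)) \<Rightarrow> complex set" where
  "ell2_spectrum X T =
     {c. \<not> (\<exists>B. ell2_bounded_operator X B \<and>
               (\<forall>F\<in>ell2 X. B (T F - cscale c F) = F \<and> T (B F) - cscale c (B F) = F))}"

definition eigenfunction ::
  "'a set \<Rightarrow> (('a \<Rightarrow> complex) \<Rightarrow> ('a \<Rightarrow> complex)) \<Rightarrow> complex \<Rightarrow> ('a \<Rightarrow> complex) \<Rightarrow> bool" where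
  "eigenfunction X T c F \<longleftrightarrow> F \<in> ell2 X \<and> F \<noteq> 0 \<and> T F = cscale c F"

definition point_spectrum ::
  "'a set \<Rightarrow> (('a \<Rightarrow> complex) \<Rightarrow> ('a \<Rightarrow> complex)) \<Rightarrow> complex set" where
  "point_spectrum X T = {c. \<exists>F. eigenfunction X T c F}"

definition complete_orthonormal_system :: "'a set \<Rightarrow> ('a \<Rightarrow> complex) set \<Rightarrow> bool" where
  "complete_orthonormal_system X B \<longleftrightarrow>
     B \<subseteq> ell2 X \<and>
     (\<forall>F\<in>B. \<forall>K\<in>B. ell2_inner X F K = (if F = K then 1 else 0)) \<and>
     (\<forall>F\<in>ell2 X. \<forall>\<epsilon>>0. \<exists>K\<in>cfun.span B. ell2_norm X (F - K) < \<epsilon>)"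

definition pure_point ::
  "'a set \<Rightarrow> (('a \<Rightarrow> complex) \<Rightarrow> ('a \<Rightarrow> complex)) \<Rightarrow> bool" where
  "pure_point X T \<longleftrightarrow>
     (\<exists>B. complete_orthonormal_system X B \<and> (\<forall>F\<in>B. \<exists>c. eigenfunction X T c F))"

definition finite_support :: "('a \<Rightarrow> complex) \<Rightarrow> bool" where
  "finite_support F \<longleftrightarrow> finite {x. F x \<noteq> 0}"

definition right_convolution ::
  "('a, 'm) monoid_scheme \<Rightarrow> ('a \<Rightarrow> real) \<Rightarrow> ('a \<Rightarrow> complex) \<Rightarrow> 'a \<Rightarrow> complex" where
  "right_convolution \<Gamma> \<nu> F =
     (\<lambda>x. if x \<in> carrier \<Gamma>
          then (\<Sum>\<^sub>\<infinity>y\<in>carrier \<Gamma>. F y * complex_of_real (\<nu> (inv\<^bsub>\<Gamma>\<^esub> y \<otimes>\<^bsub>\<Gamma>\<^esub> x))) else 0)"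


section \<open>Cayley graph and finite subgraphs\<close>

text \<open>
  The unoriented edge \<open>[x, y]\<close> is the set \<open>{x, y}\<close>; if the identity lies in \<open>S\<close>, the graph has the
  loops \<open>[x, x] = {x}\<close>.
\<close>

definition cayley_edges :: "('g, 'm) monoid_scheme \<Rightarrow> 'g set \<Rightarrow> 'g set set" where
  "cayley_edges G S = {{x, x \<otimes>\<^bsub>G\<^esub> s} | x s. x \<in> carrier G \<and> s \<in> S}"

definition edge_reachable :: "'g set set \<Rightarrow> ('g \<times> 'g) set" where
  "edge_reachable D = {(x, y). {x, y} \<in> D}\<^sup>*"

text \<open>A subgraph is a pair of a vertex set and an edge set.\<close>

definition bd_subgraphs :: "('g, 'm) monoid_scheme \<Rightarrow> 'g set \<Rightarrow> ('g set \<times> 'g set set) set" where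
  "bd_subgraphs G S =
     {(V, D). finite V \<and> V \<subseteq> carrier G \<and> \<one>\<^bsub>G\<^esub> \<in> V \<and>
              D \<subseteq> cayley_edges G S \<and> (\<forall>\<epsilon>\<in>D. \<epsilon> \<subseteq> V) \<and>
              (\<forall>x\<in>V. \<forall>y\<in>V. (x, y) \<in> edge_reachable D)}"

definition subgraph_matrix ::
  "('g, 'm) monoid_scheme \<Rightarrow> 'g pmf \<Rightarrow> 'g set set \<Rightarrow> 'g \<Rightarrow> 'g \<Rightarrow> real" where
  "subgraph_matrix G \<mu> D x y = (if {x, y} \<in> D then pmf \<mu> (inv\<^bsub>G\<^esub> x \<otimes>\<^bsub>G\<^esub> y) else 0)"

definition matrix_spectrum :: "'v set \<Rightarrow> ('v \<Rightarrow> 'v \<Rightarrow> real) \<Rightarrow> complex set" where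
  "matrix_spectrum V M =
     {c. \<exists>f. (\<exists>x\<in>V. f x \<noteq> 0) \<and>
             (\<forall>x\<in>V. (\<Sum>y\<in>V. complex_of_real (M x y) * f y) = c * f x)}"

definition Lambda_bd :: "('g, 'm) monoid_scheme \<Rightarrow> 'g pmf \<Rightarrow> complex set" where
  "Lambda_bd G \<mu> =
     (\<Union>(V, D)\<in>bd_subgraphs G (set_pmf \<mu>). matrix_spectrum V (subgraph_matrix G \<mu> D))"


section \<open>The bond lamplighter group and the walk on it\<close>

definition semidirect_product ::
  "('n, 'k) monoid_scheme \<Rightarrow> ('g, 'm) monoid_scheme \<Rightarrow> ('g \<Rightarrow> 'n \<Rightarrow> 'n) \<Rightarrow> ('n \<times> 'g) monoid" where
  "semidirect_product N G act =
     \<lparr>carrier = carrier N \<times> carrier G,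
      monoid.mult = (\<lambda>(n, g) (n', g'). (n \<otimes>\<^bsub>N\<^esub> act g n', g \<otimes>\<^bsub>G\<^esub> g')),
      one = (\<one>\<^bsub>N\<^esub>, \<one>\<^bsub>G\<^esub>)\<rparr>"

definition lamp_shift ::
  "('g, 'm) monoid_scheme \<Rightarrow> 'g set \<Rightarrow> 'g \<Rightarrow> ('g set \<Rightarrow> 'h) \<Rightarrow> 'g set \<Rightarrow> 'h" where
  "lamp_shift G S g \<eta> = (\<lambda>\<epsilon>\<in>cayley_edges G S. \<eta> ((\<lambda>x. inv\<^bsub>G\<^esub> g \<otimes>\<^bsub>G\<^esub> x) ` \<epsilon>))"

definition bd_lamplighter ::
  "('g, 'm) monoid_scheme \<Rightarrow> ('h, 'k) monoid_scheme \<Rightarrow> 'g set \<Rightarrow> (('g set \<Rightarrow> 'h) \<times> 'g) monoid" where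
  "bd_lamplighter G H S =
     semidirect_product (sum_group (cayley_edges G S) (\<lambda>_. H)) G (lamp_shift G S)"

definition lamp_support ::
  "('g, 'm) monoid_scheme \<Rightarrow> ('h, 'k) monoid_scheme \<Rightarrow> 'g set \<Rightarrow> ('g set \<Rightarrow> 'h) \<Rightarrow> 'g set set" where
  "lamp_support G H S \<eta> = {\<epsilon> \<in> cayley_edges G S. \<eta> \<epsilon> \<noteq> \<one>\<^bsub>H\<^esub>}"

definition mu_bd ::
  "('g, 'm) monoid_scheme \<Rightarrow> ('h, 'k) monoid_scheme \<Rightarrow> 'g pmf \<Rightarrow> ('g set \<Rightarrow> 'h) \<times> 'g \<Rightarrow> real" where
  "mu_bd G H \<mu> = (\<lambda>(\<eta>, g).
     if g \<in> set_pmf \<mu> \<and> lamp_support G H (set_pmf \<mu>) \<eta> \<subseteq> {{\<one>\<^bsub>G\<^esub>, g}}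
     then pmf \<mu> g / real (card (carrier H)) else 0)"

definition R_bd ::
  "('g, 'm) monoid_scheme \<Rightarrow> ('h, 'k) monoid_scheme \<Rightarrow> 'g pmf \<Rightarrow>
   (('g set \<Rightarrow> 'h) \<times> 'g \<Rightarrow> complex) \<Rightarrow> ('g set \<Rightarrow> 'h) \<times> 'g \<Rightarrow> complex" where
  "R_bd G H \<mu> = right_convolution (bd_lamplighter G H (set_pmf \<mu>)) (mu_bd G H \<mu>)"


section \<open>Bond percolation\<close>

text \<open>A configuration maps each edge to a truth value, true meaning open.\<close>

definition bond_percolation ::
  "('g, 'm) monoid_scheme \<Rightarrow> 'g set \<Rightarrow> real \<Rightarrow> ('g set \<Rightarrow> bool) measure" where
  "bond_percolation G S p =
     PiM (cayley_edges G S) (\<lambda>_. measure_pmf (bernoulli_pmf p))"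

definition open_cluster ::
  "('g, 'm) monoid_scheme \<Rightarrow> 'g set \<Rightarrow> ('g set \<Rightarrow> bool) \<Rightarrow> 'g \<Rightarrow> 'g set" where
  "open_cluster G S \<omega> x = {y. (x, y) \<in> edge_reachable {\<epsilon> \<in> cayley_edges G S. \<omega> \<epsilon>}}"

end

theory Submission
  imports Defs "HOL-Computational_Algebra.Fundamental_Theorem_Algebra"
begin

text \<open>
  The operator moves the walker along an edge while averaging the lamp at that edge over \<open>H\<close>. The edge
  averages are commuting projections. For a finite subgraph \<open>A\<close> containing the identity, a lamp
  function that is fixed by the averages at the edges of \<open>A\<close> and killed by those at the other edges
  touching \<open>A\<close> confines the walker to \<open>A\<close>; its product with an eigenvector of \<open>P\<^sub>A\<close> is an eigenfunction
  of finite support. The components of the point mass at the trivial lamp configuration with respect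
  to these projections have square norms \<open>Pr[C(e) = A]\<close> for the percolation parameter \<open>1 / |H|\<close>.
  If the cluster is almost surely finite, they sum to one, so the finitely supported eigenfunctions
  approximate that point mass and, by left translation, everything.
\<close>

section \<open>The space of square summable functions\<close>

text \<open>The parameter 1 / |H| is the squared norm of the constant part of the point mass at the
  identity of \<open>H\<close>; the mean-zero part has squared norm 1 - 1 / |H|. Squared norms
  multiply over edges, which is why an edge fixed by its average behaves like an open edge and an
  edge killed by it like a closed one. Two different finite clusters disagree at some edge, open for
  one and closed for the other, so their components are orthogonal, and the squared distance from
  the point mass to a sum of finitely many components is exactly the remaining probability.
  Diagonalisation takes place in finite symmetric matrices. Their eigenvalues are real, which makes
  different eigenspaces of the operator orthogonal. Inside one eigenspace an orthonormal basis has
  to be found without leaving the finitely supported functions; this works because the points are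
  countable and each function lives on finitely many of them. In the resulting basis the operator is
  diagonal, and its spectrum is the closure of \<Lambda> since every element of \<Lambda> is an
  eigenvalue.\<close>

lemma ell2I:
  assumes "\<And>x. x \<notin> X \<Longrightarrow> F x = 0"
    and C: "\<And>A. finite A \<Longrightarrow> A \<subseteq> X \<Longrightarrow> L2_set (\<lambda>x. cmod (F x)) A \<le> C"
  shows "F \<in> ell2 X" "ell2_norm X F \<le> C"
proof -
  have "0 \<le> C"
    using C[of "{}"] by simp
  have sums: "(\<Sum>x\<in>A. (cmod (F x))\<^sup>2) \<le> C\<^sup>2" if "finite A" "A \<subseteq> X" for A
    using C[OF that] unfolding L2_set_def by (simp add: real_sqrt_le_iff sqrt_le_D)
  have s: "(\<lambda>x. (cmod (F x))\<^sup>2) summable_on X"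
    by (rule nonneg_bdd_above_summable_on) (auto intro!: bdd_aboveI[of _ "C\<^sup>2"] sums)
  then show "F \<in> ell2 X"
    using assms by (auto simp: ell2_def)
  have "infsum (\<lambda>x. (cmod (F x))\<^sup>2) X \<le> C\<^sup>2"
    using s sums by (intro infsum_le_finite_sums) auto
  then show "ell2_norm X F \<le> C"
    unfolding ell2_norm_def using \<open>0 \<le> C\<close> by (simp add: real_le_lsqrt)
qed

lemma ell2_outside: "F \<in> ell2 X \<Longrightarrow> x \<notin> X \<Longrightarrow> F x = 0"
  by (auto simp: ell2_def)

text \<open>Together with \<open>ell2I\<close> this reduces norm estimates to \<open>L2_set\<close>
  on finite sets, where Minkowski's inequality and passage to pointwise limits are
  available.\<close>

lemma L2_set_le_ell2_norm:
  assumes "F \<in> ell2 X" "finite A" "A \<subseteq> X"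
  shows "L2_set (\<lambda>x. cmod (F x)) A \<le> ell2_norm X F"
  unfolding L2_set_def ell2_norm_def
  using assms by (intro real_sqrt_le_mono finite_sum_le_infsum) (auto simp: ell2_def)

lemma ell2_norm_nonneg: "0 \<le> ell2_norm X F"
  unfolding ell2_norm_def by (simp add: infsum_nonneg)

lemma cmod_le_ell2_norm:
  assumes "F \<in> ell2 X"
  shows "cmod (F x) \<le> ell2_norm X F"
proof (cases "x \<in> X")
  case True
  then show ?thesis
    using L2_set_le_ell2_norm[OF assms, of "{x}"] by simp
next
  case False
  then show ?thesis
    using ell2_outside[OF assms] by (simp add: ell2_norm_nonneg)
qed

lemma ell2_add:
  assumes "F \<in> ell2 X" "K \<in> ell2 X"
  shows "F + K \<in> ell2 X" "ell2_norm X (F + K) \<le> ell2_norm X F + ell2_norm X K"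
proof -
  have *: "L2_set (\<lambda>x. cmod ((F + K) x)) A \<le> ell2_norm X F + ell2_norm X K"
    if A: "finite A" "A \<subseteq> X" for A
  proof -
    have "L2_set (\<lambda>x. cmod ((F + K) x)) A \<le> L2_set (\<lambda>x. cmod (F x) + cmod (K x)) A"
      by (intro L2_set_mono) (auto simp: norm_triangle_ineq)
    also have "\<dots> \<le> L2_set (\<lambda>x. cmod (F x)) A + L2_set (\<lambda>x. cmod (K x)) A"
      by (rule L2_set_triangle_ineq)
    also have "\<dots> \<le> ell2_norm X F + ell2_norm X K"
      using A assms by (intro add_mono L2_set_le_ell2_norm)
    finally show ?thesis .
  qed
  show "F + K \<in> ell2 X" "ell2_norm X (F + K) \<le> ell2_norm X F + ell2_norm X K"
    by (rule ell2I[OF _ *]; use assms in \<open>auto simp: ell2_outside\<close>)+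
qed

lemma ell2_cscale:
  assumes "F \<in> ell2 X"
  shows "cscale c F \<in> ell2 X" "ell2_norm X (cscale c F) = cmod c * ell2_norm X F"
proof -
  have sq: "(\<lambda>x. (cmod (cscale c F x))\<^sup>2) = (\<lambda>x. (cmod c)\<^sup>2 * (cmod (F x))\<^sup>2)"
    by (simp add: cscale_def norm_mult power_mult_distrib)
  show "cscale c F \<in> ell2 X"
    using assms by (auto simp: ell2_def sq intro: summable_on_cmult_right) (simp add: cscale_def)
  show "ell2_norm X (cscale c F) = cmod c * ell2_norm X F"
    by (simp add: ell2_norm_def sq infsum_cmult_right' real_sqrt_mult)
qed

lemma ell2_uminus:
  assumes "F \<in> ell2 X"
  shows "- F \<in> ell2 X" "ell2_norm X (- F) = ell2_norm X F"
proof -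
  have "- F = cscale (-1) F"
    by (auto simp: cscale_def)
  then show "- F \<in> ell2 X" "ell2_norm X (- F) = ell2_norm X F"
    using ell2_cscale[OF assms, of "-1"] by auto
qed

lemma ell2_diff:
  assumes "F \<in> ell2 X" "K \<in> ell2 X"
  shows "F - K \<in> ell2 X" "ell2_norm X (F - K) \<le> ell2_norm X F + ell2_norm X K"
  using ell2_add[OF assms(1), of "- K"] ell2_uminus[OF assms(2)] by auto

lemma ell2_zero: "0 \<in> ell2 X" "ell2_norm X 0 = 0"
  by (auto simp: ell2_def ell2_norm_def)

lemma ell2_norm_eq_0: "F \<in> ell2 X \<Longrightarrow> ell2_norm X F = 0 \<Longrightarrow> F = 0"
  using cmod_le_ell2_norm[of F X] by (auto simp: fun_eq_iff)

lemma ell2_norm_minus_commute: "ell2_norm X (F - K) = ell2_norm X (K - F)"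
  by (simp add: ell2_norm_def norm_minus_commute)

lemma ell2_norm_triangle_sub:
  assumes "F \<in> ell2 X" "K \<in> ell2 X"
  shows "ell2_norm X F \<le> ell2_norm X K + ell2_norm X (F - K)"
  using ell2_add(2)[OF assms(2) ell2_diff(1)[OF assms]] by simp

lemma subspace_ell2: "cfun.subspace (ell2 X)"
  by (auto simp: cfun.subspace_def ell2_zero ell2_add ell2_cscale)

lemma ell2_sum:
  assumes "\<And>i. i \<in> I \<Longrightarrow> F i \<in> ell2 X"
  shows "sum F I \<in> ell2 X" "ell2_norm X (sum F I) \<le> (\<Sum>i\<in>I. ell2_norm X (F i))"
proof -
  show "sum F I \<in> ell2 X"
    using assms by (rule cfun.subspace_sum[OF subspace_ell2])
  show "ell2_norm X (sum F I) \<le> (\<Sum>i\<in>I. ell2_norm X (F i))"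
    using assms
  proof (induction I rule: infinite_finite_induct)
    case (insert i I)
    have "ell2_norm X (sum F (insert i I)) \<le> ell2_norm X (F i) + ell2_norm X (sum F I)"
      using insert.hyps insert.prems
      by (auto intro!: ell2_add cfun.subspace_sum[OF subspace_ell2])
    also have "\<dots> \<le> ell2_norm X (F i) + (\<Sum>i\<in>I. ell2_norm X (F i))"
      using insert by simp
    finally show ?case
      unfolding sum.insert[OF insert.hyps] .
  qed (auto simp: ell2_zero)
qed

lemma ell2_finite:
  assumes "finite A" "A \<subseteq> X" "\<And>x. x \<notin> A \<Longrightarrow> F x = 0"
  shows "F \<in> ell2 X" "ell2_norm X F = L2_set (\<lambda>x. cmod (F x)) A"
proof -
  have le: "L2_set (\<lambda>x. cmod (F x)) B \<le> L2_set (\<lambda>x. cmod (F x)) A" if "finite B" for B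
  proof -
    have "(\<Sum>x\<in>B. (cmod (F x))\<^sup>2) = (\<Sum>x\<in>B \<inter> A. (cmod (F x))\<^sup>2)"
      using assms that by (intro sum.mono_neutral_right) auto
    also have "\<dots> \<le> (\<Sum>x\<in>A. (cmod (F x))\<^sup>2)"
      using assms by (intro sum_mono2) auto
    finally show ?thesis
      by (simp add: L2_set_def)
  qed
  show F: "F \<in> ell2 X"
    by (rule ell2I[of X F, OF _ le]) (use assms in auto)
  show "ell2_norm X F = L2_set (\<lambda>x. cmod (F x)) A"
    using L2_set_le_ell2_norm[OF F assms(1,2)] ell2I(2)[of X F, OF _ le] assms(2,3)
    by (meson antisym subset_iff)
qed

lemma ell2_inner_finite:
  assumes "finite A" "A \<subseteq> X" "\<And>x. x \<notin> A \<Longrightarrow> F x = 0 \<or> K x = 0"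
  shows "ell2_inner X F K = (\<Sum>x\<in>A. F x * cnj (K x))"
proof -
  have "infsum (\<lambda>x. F x * cnj (K x)) X = infsum (\<lambda>x. F x * cnj (K x)) A"
    using assms by (intro infsum_cong_neutral) auto
  then show ?thesis
    by (simp add: ell2_inner_def assms)
qed

lemma ell2_finite_approx:
  assumes F: "F \<in> ell2 X" and "\<epsilon> > 0"
  obtains A where "finite A" "A \<subseteq> X" "ell2_norm X (F - (\<lambda>x. if x \<in> A then F x else 0)) < \<epsilon>"
proof -
  let ?f = "\<lambda>x. (cmod (F x))\<^sup>2"
  have s: "?f summable_on X"
    using F by (auto simp: ell2_def)
  \<comment> \<open>Half of \<epsilon> is aimed at because the approximation gives only a non-strict
    bound; it is squared since the sums are squared norms.\<close>
  obtain A where A: "finite A" "A \<subseteq> X" "dist (sum ?f A) (infsum ?f X) \<le> (\<epsilon>/2)\<^sup>2"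
    using infsum_finite_approximation[OF s, of "(\<epsilon>/2)\<^sup>2"] \<open>\<epsilon> > 0\<close> by auto
  have "ell2_norm X (F - (\<lambda>x. if x \<in> A then F x else 0)) \<le> \<epsilon>/2"
  proof (rule ell2I)
    fix B assume B: "finite B" "B \<subseteq> X"
    have "(\<Sum>x\<in>B. (cmod ((F - (\<lambda>x. if x \<in> A then F x else 0)) x))\<^sup>2) = sum ?f (B - A)"
      using B by (intro sum.mono_neutral_cong_right) auto
    moreover have "sum ?f (B - A) + sum ?f A = sum ?f (B \<union> A)"
      using A B by (subst sum.union_disjoint[symmetric]) auto
    moreover have "sum ?f (B \<union> A) \<le> infsum ?f X"
      using A B s by (intro finite_sum_le_infsum) auto
    ultimately have "(\<Sum>x\<in>B. (cmod ((F - (\<lambda>x. if x \<in> A then F x else 0)) x))\<^sup>2) \<le> (\<epsilon>/2)\<^sup>2"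
      using A(3) by (auto simp: dist_real_def)
    then show "L2_set (\<lambda>x. cmod ((F - (\<lambda>x. if x \<in> A then F x else 0)) x)) B \<le> \<epsilon>/2"
      unfolding L2_set_def using \<open>\<epsilon> > 0\<close> by (intro real_le_lsqrt) auto
  qed (use A F in \<open>auto simp: ell2_outside\<close>)
  with that[OF A(1,2)] \<open>\<epsilon> > 0\<close> show ?thesis
    by fastforce
qed

text \<open>Values are bounded by the norm, so the sequence converges pointwise; on each finite set
  the Cauchy bound survives this limit, and \<open>ell2I\<close> extends it to all of
  \<open>X\<close>.\<close>

lemma ell2_complete:
  assumes F: "\<And>n. F n \<in> ell2 X"
    and cauchy: "\<And>\<epsilon>. \<epsilon> > 0 \<Longrightarrow> \<exists>N. \<forall>m\<ge>N. \<forall>n\<ge>N. ell2_norm X (F m - F n) \<le> \<epsilon>"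
  obtains L where "L \<in> ell2 X" "(\<lambda>n. ell2_norm X (F n - L)) \<longlonglongrightarrow> 0"
proof -
  have "Cauchy (\<lambda>n. F n x)" for x
  proof (rule metric_CauchyI)
    fix e :: real assume "e > 0"
    then obtain N where N: "\<forall>m\<ge>N. \<forall>n\<ge>N. ell2_norm X (F m - F n) \<le> e/2"
      using cauchy[of "e/2"] by auto
    have "dist (F m x) (F n x) < e" if "m \<ge> N" "n \<ge> N" for m n
      using cmod_le_ell2_norm[OF ell2_diff(1)[OF F F], of m n x] N that \<open>e > 0\<close>
      by (fastforce simp: dist_norm)
    then show "\<exists>M. \<forall>m\<ge>M. \<forall>n\<ge>M. dist (F m x) (F n x) < e"
      by blast
  qed
  then have "convergent (\<lambda>n. F n x)" for x
    by (simp add: Cauchy_convergent_iff)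
  then obtain L where L: "(\<lambda>n. F n x) \<longlonglongrightarrow> L x" for x
    unfolding convergent_def by metis
  \<comment> \<open>The limit is taken in the second index only. Membership of
    \<open>F m - L\<close> is obtained before that of \<open>L\<close>, which then follows by
    subtraction.\<close>
  have bound: "F m - L \<in> ell2 X \<and> ell2_norm X (F m - L) \<le> \<epsilon>"
    if N: "\<forall>m\<ge>N. \<forall>n\<ge>N. ell2_norm X (F m - F n) \<le> \<epsilon>" and m: "m \<ge> N" for N m \<epsilon>
  proof -
    have "L x = 0" if "x \<notin> X" for x
      using L[of x] ell2_outside[OF F that] by (simp add: LIMSEQ_const_iff)
    then have out: "(F m - L) x = 0" if "x \<notin> X" for x
      using ell2_outside[OF F that] that by simp
    have "L2_set (\<lambda>x. cmod ((F m - L) x)) A \<le> \<epsilon>" if A: "finite A" "A \<subseteq> X" for A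
    proof (rule LIMSEQ_le_const2)
      show "(\<lambda>n. L2_set (\<lambda>x. cmod ((F m - F n) x)) A) \<longlonglongrightarrow> L2_set (\<lambda>x. cmod ((F m - L) x)) A"
        unfolding L2_set_def by (auto intro!: tendsto_intros L)
      show "\<exists>N. \<forall>n\<ge>N. L2_set (\<lambda>x. cmod ((F m - F n) x)) A \<le> \<epsilon>"
        using L2_set_le_ell2_norm[OF ell2_diff(1)[OF F F] A] N m
        by (intro exI[of _ N]) (meson order_trans)
    qed
    with ell2I[of X "F m - L", OF out] show ?thesis
      by blast
  qed
  obtain N where "\<forall>m\<ge>N. \<forall>n\<ge>N. ell2_norm X (F m - F n) \<le> 1"
    using cauchy[of 1] by auto
  then have "F N - L \<in> ell2 X"
    using bound by blast
  from ell2_diff(1)[OF F this, of N] have "L \<in> ell2 X"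
    by simp
  moreover have "(\<lambda>n. ell2_norm X (F n - L)) \<longlonglongrightarrow> 0"
  proof (rule LIMSEQ_I)
    fix r :: real assume "r > 0"
    then obtain N where "\<forall>m\<ge>N. \<forall>n\<ge>N. ell2_norm X (F m - F n) \<le> r/2"
      using cauchy[of "r/2"] by auto
    then have "norm (ell2_norm X (F n - L) - 0) < r" if "n \<ge> N" for n
      using bound[of N "r/2" n] that \<open>r > 0\<close> by (simp add: ell2_norm_nonneg)
    then show "\<exists>N. \<forall>n\<ge>N. norm (ell2_norm X (F n - L) - 0) < r"
      by blast
  qed
  ultimately show thesis
    by (rule that)
qed

lemma ell2_reindex:
  assumes \<pi>: "bij_betw \<pi> X X" and F: "F \<in> ell2 X"
  shows "(\<lambda>x. if x \<in> X then F (\<pi> x) else 0) \<in> ell2 X"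
    and "ell2_norm X (\<lambda>x. if x \<in> X then F (\<pi> x) else 0) = ell2_norm X F"
proof -
  have "(\<lambda>x. (cmod (if x \<in> X then F (\<pi> x) else 0))\<^sup>2) summable_on X \<longleftrightarrow>
      (\<lambda>x. (cmod (F (\<pi> x)))\<^sup>2) summable_on X"
    by (rule summable_on_cong) simp
  then show "(\<lambda>x. if x \<in> X then F (\<pi> x) else 0) \<in> ell2 X"
    using F summable_on_reindex_bij_betw[OF \<pi>, of "\<lambda>x. (cmod (F x))\<^sup>2"]
    by (auto simp: ell2_def)
  have "infsum (\<lambda>x. (cmod (if x \<in> X then F (\<pi> x) else 0))\<^sup>2) X = infsum (\<lambda>x. (cmod (F (\<pi> x)))\<^sup>2) X"
    by (rule infsum_cong) simp
  then show "ell2_norm X (\<lambda>x. if x \<in> X then F (\<pi> x) else 0) = ell2_norm X F"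
    using infsum_reindex_bij_betw[OF \<pi>, of "\<lambda>x. (cmod (F x))\<^sup>2"]
    by (simp add: ell2_norm_def)
qed

section \<open>Eigenvectors of symmetric matrices\<close>

lemma sum_cfun_apply: "(\<Sum>i\<in>I. f i) x = (\<Sum>i\<in>I. f i x)"
  for f :: "'i \<Rightarrow> 'a \<Rightarrow> complex"
  by (induction I rule: infinite_finite_induct) simp_all

section \<open>Polynomials in a linear operator and decomposition into eigenvectors\<close>

definition poly_op :: "(('a \<Rightarrow> complex) \<Rightarrow> 'a \<Rightarrow> complex) \<Rightarrow> complex poly \<Rightarrow> ('a \<Rightarrow> complex) \<Rightarrow> 'a \<Rightarrow> complex" where
  "poly_op T p v = (\<Sum>i\<le>degree p. cscale (coeff p i) ((T ^^ i) v))"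

lemma poly_op_upto:
  assumes "degree p \<le> N"
  shows "poly_op T p v = (\<Sum>i\<le>N. cscale (coeff p i) ((T ^^ i) v))"
  unfolding poly_op_def
  using assms by (intro sum.mono_neutral_left) (auto simp: cscale_def coeff_eq_0 fun_eq_iff)

locale cfun_linear =
  fixes T :: "('a \<Rightarrow> complex) \<Rightarrow> 'a \<Rightarrow> complex"
  assumes T_add: "T (f + g) = T f + T g"
    and T_cscale: "T (cscale c f) = cscale c (T f)"
begin

lemma T_zero: "T 0 = 0"
  using T_cscale[of 0 0] by simp

lemma T_diff: "T (f - g) = T f - T g"
  using T_add[of "f - g" g] by (simp add: algebra_simps)

lemma T_sum: "T (sum f I) = (\<Sum>i\<in>I. T (f i))"
  by (induction I rule: infinite_finite_induct)
    (simp_all only: T_zero T_add sum.infinite sum.empty sum.insert if_False not_False_eq_True)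

lemma power_cscale: "(T ^^ i) (cscale c f) = cscale c ((T ^^ i) f)"
  by (induction i) (simp_all only: T_cscale funpow.simps o_apply id_apply)

lemma power_diff: "(T ^^ i) (f - g) = (T ^^ i) f - (T ^^ i) g"
  by (induction i) (simp_all only: T_diff funpow.simps o_apply id_apply)

text \<open>The coefficients of the product are those of a shifted copy of \<open>q\<close> minus
  \<open>x\<close> times those of \<open>q\<close>. Splitting off a root thus trades one degree of
  the polynomial for replacing \<open>v\<close> by \<open>T v - cscale x v\<close>, the induction
  step of \<open>span_eigenvectors\<close>.\<close>

lemma poly_op_linear_factor:
  "poly_op T ([:-x, 1:] * q) v = poly_op T q (T v - cscale x v)"
proof -
  let ?N = "degree q"
  have c: "coeff ([:-x, 1:] * q) 0 = - x * coeff q 0"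
      "coeff ([:-x, 1:] * q) (Suc i) = coeff q i - x * coeff q (Suc i)" for i
    by simp_all
  have d: "degree ([:-x, 1:] * q) \<le> Suc ?N"
    by (rule order_trans[OF degree_mult_le]) simp
  have "poly_op T ([:-x, 1:] * q) v
      = (\<Sum>i\<le>Suc ?N. cscale (coeff ([:-x, 1:] * q) i) ((T ^^ i) v))"
    by (rule poly_op_upto[OF d])
  also have "\<dots> = cscale (- x * coeff q 0) v +
      (\<Sum>i\<le>?N. cscale (coeff q i - x * coeff q (Suc i)) ((T ^^ Suc i) v))"
    unfolding sum.atMost_Suc_shift c by simp
  also have "(\<Sum>i\<le>?N. cscale (coeff q i - x * coeff q (Suc i)) ((T ^^ Suc i) v)) =
      (\<Sum>i\<le>?N. cscale (coeff q i) ((T ^^ Suc i) v)) -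
      (\<Sum>i\<le>?N. cscale (x * coeff q (Suc i)) ((T ^^ Suc i) v))"
    by (simp add: cfun.scale_left_diff_distrib sum_subtractf)
  also have "(\<Sum>i\<le>?N. cscale (x * coeff q (Suc i)) ((T ^^ Suc i) v)) =
      (\<Sum>i\<le>Suc ?N. cscale (x * coeff q i) ((T ^^ i) v)) - cscale (x * coeff q 0) v"
    unfolding sum.atMost_Suc_shift by simp
  \<comment> \<open>The extra top term carries the coefficient of \<open>q\<close> beyond its
    degree, which is 0.\<close>
  also have "(\<Sum>i\<le>Suc ?N. cscale (x * coeff q i) ((T ^^ i) v)) =
      (\<Sum>i\<le>?N. cscale (x * coeff q i) ((T ^^ i) v))"
    by (simp add: coeff_eq_0)
  finally have "poly_op T ([:-x, 1:] * q) v =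
      (\<Sum>i\<le>?N. cscale (coeff q i) ((T ^^ Suc i) v)) - (\<Sum>i\<le>?N. cscale (x * coeff q i) ((T ^^ i) v))"
    by (simp only: algebra_simps cfun.scale_minus_left mult_minus_left) simp
  also have "\<dots> = poly_op T q (T v - cscale x v)"
    unfolding poly_op_def sum_subtractf[symmetric]
    by (rule sum.cong) (auto simp: power_diff power_cscale funpow_swap1 cfun.scale_right_diff_distrib mult.commute)
  finally show ?thesis .
qed

text \<open>The first \<open>card A + 1\<close> iterates of \<open>v\<close> lie in the span of
  \<open>card A\<close> vectors, so they satisfy a nontrivial linear relation, whose coefficients
  are taken as those of \<open>p\<close>.\<close>

lemma annihilating_polynomial:
  assumes "finite A" and inv: "\<And>i. (T ^^ i) v \<in> cfun.span A"
  obtains p where "p \<noteq> 0" "poly_op T p v = 0"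
proof -
  have "\<exists>u. (\<exists>i\<le>card A. u i \<noteq> 0) \<and> (\<Sum>i\<le>card A. cscale (u i) ((T ^^ i) v)) = 0"
  proof (cases "inj_on (\<lambda>i. (T ^^ i) v) {..card A}")
    case True
    let ?S = "(\<lambda>i. (T ^^ i) v) ` {..card A}"
    have "card ?S = Suc (card A)"
      using True by (simp add: card_image)
    then have "cfun.dependent ?S"
      using cfun.independent_span_bound[of A ?S] assms by fastforce
    then obtain u where u: "\<exists>w\<in>?S. u w \<noteq> 0" "(\<Sum>w\<in>?S. cscale (u w) w) = 0"
      using cfun.dependent_finite[of ?S] by auto
    then show ?thesis
      using True by (intro exI[of _ "\<lambda>i. u ((T ^^ i) v)"]) (auto simp: sum.reindex)
  next
    \<comment> \<open>Equal iterates collapse in the set to which \<open>cfun.dependent\<close>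
      applies; here their difference is itself the relation.\<close>
    case False
    then obtain i j where ij: "i \<le> card A" "j \<le> card A" "i \<noteq> j" "(T ^^ i) v = (T ^^ j) v"
      by (auto simp: inj_on_def)
    let ?u = "\<lambda>k. if k = i then 1 else if k = j then - 1 else (0::complex)"
    have "(\<Sum>k\<le>card A. cscale (?u k) ((T ^^ k) v)) = (\<Sum>k\<in>{i, j}. cscale (?u k) ((T ^^ k) v))"
      using ij by (intro sum.mono_neutral_right) (auto simp: cscale_def fun_eq_iff)
    also have "\<dots> = 0"
      using ij by (simp add: cfun.scale_minus_left)
    finally show ?thesis
      using ij by (intro exI[of _ ?u]) auto
  qed
  then obtain u j where u: "j \<le> card A" "u j \<noteq> 0" "(\<Sum>i\<le>card A. cscale (u i) ((T ^^ i) v)) = 0"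
    by blast
  let ?p = "Abs_poly (\<lambda>i. if i \<le> card A then u i else 0)"
  have c: "coeff ?p i = (if i \<le> card A then u i else 0)" for i
    by (subst coeff_Abs_poly[of "card A"]) auto
  have "?p \<noteq> 0"
    using u c[of j] by (metis coeff_0)
  moreover have "degree ?p \<le> card A"
    by (rule degree_le) (simp add: c)
  then have "poly_op T ?p v = 0"
    using u by (simp add: poly_op_upto c)
  ultimately show thesis
    by (rule that)
qed

text \<open>
  If \<open>(T - x) v\<close> is a sum of eigenvectors, then dividing their coefficients by \<open>c - x\<close> for the
  eigenvalues \<open>c \<noteq> x\<close> reduces to the case where \<open>(T - x) v\<close> lies in the kernel of \<open>T - x\<close>; by
  symmetry it is then orthogonal to itself.
\<close>

lemma span_eigenvectors:
  assumes W: "cfun.subspace W" "\<And>f. f \<in> W \<Longrightarrow> T f \<in> W"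
    and self: "\<And>f x. f \<in> W \<Longrightarrow> T (T f - cscale x f) = cscale x (T f - cscale x f) \<Longrightarrow> T f = cscale x f"
    and "p \<noteq> 0" "poly_op T p v = 0" "v \<in> W"
  shows "v \<in> cfun.span {f \<in> W. f \<noteq> 0 \<and> (\<exists>c. T f = cscale c f)}" (is "_ \<in> cfun.span ?E")
  using assms(4-)
proof (induction "degree p" arbitrary: p v)
  case 0
  then obtain a where "p = [:a:]"
    by (metis degree_eq_zeroE)
  with 0 have "cscale a v = 0" "a \<noteq> 0"
    by (auto simp: poly_op_def)
  then have "v = 0"
    by simp
  then show ?case
    by (simp only: cfun.span_zero)
next
  case (Suc n)
  obtain x where "poly p x = 0"
    using Suc.hyps(2) fundamental_theorem_of_algebra[of p] by (auto simp: constant_degree)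
  then obtain q where p: "p = [:-x, 1:] * q"
    by (auto simp: poly_eq_0_iff_dvd)
  with Suc.prems have "q \<noteq> 0"
    by auto
  then have "degree p = Suc (degree q)"
    unfolding p by (subst degree_mult_eq) auto
  then have n: "n = degree q"
    using Suc.hyps(2) by simp
  let ?u = "T v - cscale x v"
  have "?u \<in> W"
    using Suc.prems W by (auto intro!: cfun.subspace_diff cfun.subspace_scale)
  moreover have "poly_op T q ?u = 0"
    using Suc.prems(2) unfolding p poly_op_linear_factor .
  ultimately have "?u \<in> cfun.span ?E"
    using Suc.hyps(1)[OF n \<open>q \<noteq> 0\<close>] by simp
  then obtain t r where t: "finite t" "t \<subseteq> ?E" and u: "?u = (\<Sum>f\<in>t. cscale (r f) f)"
    by (auto simp: cfun.span_explicit)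
  then have "\<forall>f\<in>t. \<exists>c. T f = cscale c f"
    by auto
  then obtain e where e: "T f = cscale (e f) f" if "f \<in> t" for f
    by metis
  define v' where "v' = (\<Sum>f\<in>{f\<in>t. e f \<noteq> x}. cscale (r f / (e f - x)) f)"
  define u0 where "u0 = (\<Sum>f\<in>{f\<in>t. e f = x}. cscale (r f) f)"
  have v'_span: "v' \<in> cfun.span ?E"
    unfolding v'_def using t(2) by (intro cfun.span_sum cfun.span_scale cfun.span_base) auto
  have v'_W: "v' \<in> W"
    unfolding v'_def using t W by (auto intro!: cfun.subspace_sum cfun.subspace_scale)
  have wW: "v - v' \<in> W"
    using v'_W Suc.prems W by (auto intro: cfun.subspace_diff)
  have "T v' - cscale x v' = (\<Sum>f\<in>{f\<in>t. e f \<noteq> x}. cscale (r f) f)"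
    unfolding v'_def T_sum T_cscale cfun.scale_sum_right sum_subtractf[symmetric]
  proof (rule sum.cong)
    fix f assume f: "f \<in> {f \<in> t. e f \<noteq> x}"
    have "cscale a (cscale d f) - cscale x (cscale a f) = cscale ((d - x) * a) f" for a d
      by (auto simp: cscale_def fun_eq_iff algebra_simps)
    moreover have "(e f - x) * (r f / (e f - x)) = r f" "T f = cscale (e f) f"
      using f e by auto
    ultimately show "cscale (r f / (e f - x)) (T f) - cscale x (cscale (r f / (e f - x)) f) = cscale (r f) f"
      by metis
  qed simp
  moreover have "(\<Sum>f\<in>t. cscale (r f) f) = (\<Sum>f\<in>{f\<in>t. e f \<noteq> x}. cscale (r f) f) + u0"
    unfolding u0_def using t(1) by (subst sum.union_disjoint[symmetric]) (auto intro!: sum.cong)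
  ultimately have *: "T (v - v') - cscale x (v - v') = u0"
    using u by (simp add: T_diff cfun.scale_right_diff_distrib algebra_simps)
  have "T u0 = cscale x u0"
    unfolding u0_def T_sum T_cscale cfun.scale_sum_right
    by (rule sum.cong) (auto simp: e cscale_def)
  then have "T (v - v') = cscale x (v - v')"
    using self[OF wW] * by metis
  then have "v - v' \<in> cfun.span ?E"
    using wW by (cases "v - v' = 0") (auto intro: cfun.span_base simp: cfun.span_zero)
  from cfun.span_add[OF v'_span this] show ?case
    by simp
qed

end

text \<open>Extended by 0 off \<open>V\<close>, so that an eigenvalue equation on \<open>V\<close>
  becomes an equality of functions on the whole type.\<close>

definition matrix_apply :: "'v set \<Rightarrow> ('v \<Rightarrow> 'v \<Rightarrow> real) \<Rightarrow> ('v \<Rightarrow> complex) \<Rightarrow> 'v \<Rightarrow> complex" where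
  "matrix_apply V M f x = (if x \<in> V then \<Sum>y\<in>V. complex_of_real (M x y) * f y else 0)"

lemma matrix_apply_symmetric:
  assumes sym: "\<And>x y. x \<in> V \<Longrightarrow> y \<in> V \<Longrightarrow> M x y = M y x"
  shows "(\<Sum>x\<in>V. matrix_apply V M f x * cnj (g x)) = (\<Sum>x\<in>V. f x * cnj (matrix_apply V M g x))"
proof -
  have "(\<Sum>x\<in>V. matrix_apply V M f x * cnj (g x)) = (\<Sum>x\<in>V. \<Sum>y\<in>V. M x y * f y * cnj (g x))"
    by (rule sum.cong) (auto simp: matrix_apply_def sum_distrib_right)
  also have "\<dots> = (\<Sum>y\<in>V. \<Sum>x\<in>V. M x y * f y * cnj (g x))"
    by (rule sum.swap)
  also have "\<dots> = (\<Sum>y\<in>V. f y * cnj (matrix_apply V M g y))"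
    by (intro sum.cong refl) (auto simp: matrix_apply_def sum_distrib_left sym mult_ac intro!: sum.cong)
  finally show ?thesis .
qed

lemma sum_cmod_square_eq_0:
  assumes "finite V" "(\<Sum>x\<in>V. f x * cnj (f x)) = 0" "x \<in> V"
  shows "f x = 0"
proof -
  have "complex_of_real (\<Sum>x\<in>V. (cmod (f x))\<^sup>2) = 0"
    using assms(2) by (simp only: complex_norm_square of_real_sum)
  then have "(\<Sum>x\<in>V. (cmod (f x))\<^sup>2) = 0"
    by (simp only: of_real_eq_0_iff)
  then show ?thesis
    using assms by (simp add: sum_nonneg_eq_0_iff)
qed

text \<open>The Hermitian form of \<open>M\<close> at an eigenvector equals both \<open>c\<close>
  and \<open>cnj c\<close> times its squared norm, which is nonzero.\<close>

lemma matrix_spectrum_real: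
  assumes V: "finite V" and sym: "\<And>x y. x \<in> V \<Longrightarrow> y \<in> V \<Longrightarrow> M x y = M y x"
    and "c \<in> matrix_spectrum V M"
  shows "cnj c = c"
proof -
  obtain f where f: "\<exists>x\<in>V. f x \<noteq> 0" "\<forall>x\<in>V. (\<Sum>y\<in>V. complex_of_real (M x y) * f y) = c * f x"
    using assms by (auto simp: matrix_spectrum_def)
  have "c * (\<Sum>x\<in>V. f x * cnj (f x)) = (\<Sum>x\<in>V. matrix_apply V M f x * cnj (f x))"
    using f by (simp add: sum_distrib_left matrix_apply_def mult_ac)
  also have "\<dots> = (\<Sum>x\<in>V. f x * cnj (matrix_apply V M f x))"
    by (rule matrix_apply_symmetric[OF sym])
  also have "\<dots> = cnj c * (\<Sum>x\<in>V. f x * cnj (f x))"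
  proof -
    have "cnj (matrix_apply V M f x) = cnj c * cnj (f x)" if "x \<in> V" for x
      using f(2) that by (simp add: matrix_apply_def flip: complex_cnj_mult)
    then show ?thesis
      by (simp add: sum_distrib_left mult_ac)
  qed
  finally have "c * (\<Sum>x\<in>V. f x * cnj (f x)) = cnj c * (\<Sum>x\<in>V. f x * cnj (f x))" .
  moreover have "(\<Sum>x\<in>V. f x * cnj (f x)) \<noteq> 0"
    using f(1) sum_cmod_square_eq_0[OF V, of f] by blast
  ultimately show ?thesis
    by (metis mult_right_cancel)
qed

text \<open>The finite-dimensional spectral theorem as a decomposition of a vector. Iterates of
  \<open>v\<close> stay in the span of the unit vectors of \<open>V\<close>, which yields an
  annihilating polynomial; symmetry excludes Jordan blocks, which is the hypothesis
  \<open>self\<close> of \<open>span_eigenvectors\<close>.\<close>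

lemma symmetric_matrix_eigenvectors_span:
  assumes V: "finite V" and sym: "\<And>x y. x \<in> V \<Longrightarrow> y \<in> V \<Longrightarrow> M x y = M y x"
    and v: "\<And>x. x \<notin> V \<Longrightarrow> v x = 0"
  shows "v \<in> cfun.span {f. (\<forall>x. x \<notin> V \<longrightarrow> f x = 0) \<and> f \<noteq> 0 \<and> (\<exists>c. matrix_apply V M f = cscale c f)}"
proof -
  define W where "W = {f :: 'a \<Rightarrow> complex. \<forall>x. x \<notin> V \<longrightarrow> f x = 0}"
  interpret cfun_linear "matrix_apply V M"
    by unfold_locales
      (auto simp: matrix_apply_def fun_eq_iff cscale_def algebra_simps sum.distrib sum_distrib_left)
  have W: "cfun.subspace W" "\<And>f. matrix_apply V M f \<in> W"
    by (auto simp: W_def cfun.subspace_def cscale_def matrix_apply_def)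
  define A where "A = (\<lambda>x. (\<lambda>y. if y = x then 1 else 0) :: 'a \<Rightarrow> complex) ` V"
  have W_span: "W \<subseteq> cfun.span A"
  proof
    fix f assume "f \<in> W"
    then have "f = (\<Sum>x\<in>V. cscale (f x) (\<lambda>y. if y = x then 1 else 0))"
      using V by (auto simp: fun_eq_iff W_def cscale_def sum_cfun_apply if_distrib cong: if_cong)
    also have "\<dots> \<in> cfun.span A"
      unfolding A_def by (intro cfun.span_sum cfun.span_scale cfun.span_base imageI)
    finally show "f \<in> cfun.span A" .
  qed
  have "v \<in> W"
    using v by (simp add: W_def)
  then have pw: "(matrix_apply V M ^^ i) v \<in> W" for i
    using W(2) by (cases i) auto
  obtain p where "p \<noteq> 0" "poly_op (matrix_apply V M) p v = 0"
    by (rule annihilating_polynomial[of A v]) (use V W_span pw in \<open>auto simp: A_def\<close>)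
  \<comment> \<open>If \<open>?g\<close>, the image of \<open>f\<close> under the operator minus
    \<open>x\<close>, is nonzero, it is an eigenvector, so \<open>x\<close> is real. Symmetry then
    moves the operator from \<open>f\<close> to \<open>?g\<close>, and the inner product of
    \<open>?g\<close> with itself comes out as 0.\<close>
  moreover have "matrix_apply V M f = cscale x f"
    if f: "f \<in> W" and eq: "matrix_apply V M (matrix_apply V M f - cscale x f) = cscale x (matrix_apply V M f - cscale x f)"
    for f x
  proof (rule ccontr)
    let ?g = "matrix_apply V M f - cscale x f"
    assume "matrix_apply V M f \<noteq> cscale x f"
    then have "?g \<noteq> 0"
      by simp
    moreover have gW: "?g \<in> W"
      using W f by (auto intro!: cfun.subspace_diff cfun.subspace_scale)
    ultimately obtain z where "z \<in> V" "?g z \<noteq> 0"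
      by (auto simp: W_def fun_eq_iff)
    moreover have "(\<Sum>y\<in>V. complex_of_real (M z y) * ?g y) = x * ?g z" if "z \<in> V" for z
      using fun_cong[OF eq, of z] that by (simp add: matrix_apply_def cscale_def)
    ultimately have "x \<in> matrix_spectrum V M"
      unfolding matrix_spectrum_def by blast
    then have x: "cnj x = x"
      using matrix_spectrum_real[OF V, of M x] sym by blast
    have "(\<Sum>y\<in>V. ?g y * cnj (?g y)) =
        (\<Sum>y\<in>V. matrix_apply V M f y * cnj (?g y)) - (\<Sum>y\<in>V. f y * (x * cnj (?g y)))"
    proof -
      have "?g y * d = matrix_apply V M f y * d - f y * (x * d)" for y d
        by (simp add: cscale_def algebra_simps)
      then show ?thesis
        by (simp only: sum_subtractf)
    qed
    also have "(\<Sum>y\<in>V. matrix_apply V M f y * cnj (?g y)) = (\<Sum>y\<in>V. f y * cnj (matrix_apply V M ?g y))"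
      by (rule matrix_apply_symmetric[OF sym])
    also have "\<dots> = (\<Sum>y\<in>V. f y * (x * cnj (?g y)))"
      unfolding eq by (simp add: cscale_def x)
    finally have "(\<Sum>y\<in>V. ?g y * cnj (?g y)) = 0"
      by simp
    with sum_cmod_square_eq_0[OF V this \<open>z \<in> V\<close>] \<open>?g z \<noteq> 0\<close> show False
      by simp
  qed
  ultimately have "v \<in> cfun.span {f \<in> W. f \<noteq> 0 \<and> (\<exists>c. matrix_apply V M f = cscale c f)}"
    using span_eigenvectors[OF W(1) W(2)] \<open>v \<in> W\<close> by blast
  then show ?thesis
    by (simp add: W_def)
qed

section \<open>Orthonormal systems of finitely supported functions\<close>

text \<open>Junk value 0 if \<open>F\<close> has infinite support.\<close>

definition fin_inner :: "('a \<Rightarrow> complex) \<Rightarrow> ('a \<Rightarrow> complex) \<Rightarrow> complex" where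
  "fin_inner F K = (\<Sum>x\<in>{x. F x \<noteq> 0}. F x * cnj (K x))"

lemma fin_inner_eq:
  assumes "finite A" "\<And>x. x \<notin> A \<Longrightarrow> F x = 0"
  shows "fin_inner F K = (\<Sum>x\<in>A. F x * cnj (K x))"
  unfolding fin_inner_def using assms by (intro sum.mono_neutral_left) auto

lemma ell2_inner_eq_fin_inner:
  assumes "finite_support F" "\<And>x. x \<notin> X \<Longrightarrow> F x = 0"
  shows "ell2_inner X F K = fin_inner F K"
  unfolding fin_inner_def
  using assms by (intro ell2_inner_finite) (auto simp: finite_support_def)

lemma finite_support_add:
  "finite_support F \<Longrightarrow> finite_support K \<Longrightarrow> finite_support (F + K)"
  unfolding finite_support_def by (rule finite_subset[of _ "{x. F x \<noteq> 0} \<union> {x. K x \<noteq> 0}"]) auto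

lemma finite_support_cscale: "finite_support F \<Longrightarrow> finite_support (cscale c F)"
  unfolding finite_support_def by (rule finite_subset[of _ "{x. F x \<noteq> 0}"]) (auto simp: cscale_def)

lemma subspace_finite_support: "cfun.subspace (Collect finite_support)"
proof (rule cfun.subspaceI)
  show "0 \<in> Collect finite_support"
    by (simp add: finite_support_def)
qed (auto intro: finite_support_add finite_support_cscale)

lemma fin_inner_sym:
  assumes "finite_support F" "finite_support K"
  shows "fin_inner F K = cnj (fin_inner K F)"
proof -
  let ?A = "{x. F x \<noteq> 0} \<union> {x. K x \<noteq> 0}"
  have "finite ?A"
    using assms by (simp add: finite_support_def)
  then have "fin_inner F K = (\<Sum>x\<in>?A. F x * cnj (K x))" "fin_inner K F = (\<Sum>x\<in>?A. K x * cnj (F x))"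
    by (auto intro!: fin_inner_eq)
  then show ?thesis
    by (simp add: mult.commute)
qed

lemma fin_inner_add:
  assumes "finite_support F" "finite_support K"
  shows "fin_inner (F + K) L = fin_inner F L + fin_inner K L"
proof -
  let ?A = "{x. F x \<noteq> 0} \<union> {x. K x \<noteq> 0}"
  have A: "finite ?A"
    using assms by (simp add: finite_support_def)
  have "fin_inner (F + K) L = (\<Sum>x\<in>?A. (F + K) x * cnj (L x))"
    using A by (intro fin_inner_eq) auto
  moreover have "fin_inner F L = (\<Sum>x\<in>?A. F x * cnj (L x))" "fin_inner K L = (\<Sum>x\<in>?A. K x * cnj (L x))"
    using A by (auto intro!: fin_inner_eq)
  ultimately show ?thesis
    by (simp add: distrib_right sum.distrib)
qed

lemma fin_inner_cscale: "finite_support F \<Longrightarrow> fin_inner (cscale c F) L = c * fin_inner F L"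
  using fin_inner_eq[of "{x. F x \<noteq> 0}" "cscale c F" L]
  by (auto simp: finite_support_def cscale_def fin_inner_def sum_distrib_left mult.assoc)

lemma fin_inner_diff:
  assumes "finite_support F" "finite_support K"
  shows "fin_inner (F - K) L = fin_inner F L - fin_inner K L"
  using fin_inner_add[OF cfun.subspace_diff[OF subspace_finite_support, of F K, simplified] assms(2), of L]
    assms by (simp add: algebra_simps)

lemma fin_inner_sum:
  assumes "\<And>i. i \<in> I \<Longrightarrow> finite_support (F i)"
  shows "fin_inner (sum F I) L = (\<Sum>i\<in>I. fin_inner (F i) L)"
  using assms
proof (induction I rule: infinite_finite_induct)
  case (insert i I)
  have "finite_support (sum F I)"
    using cfun.subspace_sum[OF subspace_finite_support, of I F] insert.prems by auto
  moreover have "finite_support (F i)"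
    using insert.prems by simp
  moreover have "fin_inner (sum F I) L = (\<Sum>i\<in>I. fin_inner (F i) L)"
    using insert.IH insert.prems by simp
  ultimately show ?case
    unfolding sum.insert[OF insert.hyps] by (simp only: fin_inner_add)
qed (auto simp: fin_inner_def)

lemma fin_inner_lincomb:
  assumes "\<And>F. F \<in> t \<Longrightarrow> finite_support F"
  shows "fin_inner (\<Sum>F\<in>t. cscale (r F) F) L = (\<Sum>F\<in>t. r F * fin_inner F L)"
proof -
  have "fin_inner (\<Sum>F\<in>t. cscale (r F) F) L = (\<Sum>F\<in>t. fin_inner (cscale (r F) F) L)"
    using assms by (intro fin_inner_sum finite_support_cscale)
  also have "\<dots> = (\<Sum>F\<in>t. r F * fin_inner F L)"
    using assms by (intro sum.cong refl fin_inner_cscale)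
  finally show ?thesis .
qed

lemma fin_inner_zero_right: "fin_inner F 0 = 0"
  by (simp add: fin_inner_def)

lemma fin_inner_self:
  assumes "finite A" "\<And>x. x \<notin> A \<Longrightarrow> F x = 0"
  shows "fin_inner F F = complex_of_real ((L2_set (\<lambda>x. cmod (F x)) A)\<^sup>2)"
proof -
  have "(L2_set (\<lambda>x. cmod (F x)) A)\<^sup>2 = (\<Sum>x\<in>A. (cmod (F x))\<^sup>2)"
    by (simp add: L2_set_def sum_nonneg)
  then show ?thesis
    using fin_inner_eq[OF assms, where K = F] by (simp only: of_real_sum complex_norm_square)
qed

lemma fin_inner_ell2_norm:
  assumes "finite_support F" "\<And>x. x \<notin> X \<Longrightarrow> F x = 0"
  shows "fin_inner F F = complex_of_real ((ell2_norm X F)\<^sup>2)"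
proof -
  have fin: "finite {x. F x \<noteq> 0}" and out: "\<And>x. x \<notin> {x. F x \<noteq> 0} \<Longrightarrow> F x = 0"
    using assms by (simp_all add: finite_support_def)
  have "{x. F x \<noteq> 0} \<subseteq> X"
    using assms(2) by blast
  then show ?thesis
    using fin_inner_self[OF fin out] ell2_finite(2)[OF fin _ out] by simp
qed

lemma fin_inner_self_eq_0:
  assumes "finite_support F" "fin_inner F F = 0"
  shows "F = 0"
proof
  fix x
  show "F x = 0 x"
    using sum_cmod_square_eq_0[of "{x. F x \<noteq> 0}" F x] assms
    by (auto simp: finite_support_def fin_inner_def)
qed

lemma fin_inner_normalize:
  assumes "finite_support F" "F \<noteq> 0"
  obtains r where "r \<noteq> 0" "fin_inner (cscale r F) (cscale r F) = 1"
proof -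
  let ?n = "ell2_norm UNIV F"
  have n: "fin_inner F F = complex_of_real (?n\<^sup>2)"
    using assms by (intro fin_inner_ell2_norm) auto
  have n0: "?n \<noteq> 0"
    using fin_inner_self_eq_0[OF assms(1)] assms(2) n by fastforce
  let ?r = "complex_of_real (1 / ?n)"
  have "fin_inner (cscale ?r F) (cscale ?r F) = ?r * cnj (?r * fin_inner F F)"
    by (subst fin_inner_cscale[OF assms(1)], subst fin_inner_sym)
      (use assms in \<open>simp_all add: finite_support_cscale fin_inner_cscale\<close>)
  also have "\<dots> = 1"
    using n0 by (simp add: n power2_eq_square)
  finally show thesis
    using n0 that[of ?r] by simp
qed

text \<open>
  \<open>W n\<close> consists of the functions in \<open>W\<close> supported on the first \<open>n\<close> points. Since \<open>W n\<close> has
  codimension at most one in \<open>W (Suc n)\<close>, Gram-Schmidt orthogonalisation yields at most one new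
  basis vector at each point.
\<close>

lemma finitely_supported_orthonormal_basis:
  fixes W :: "('a \<Rightarrow> complex) set"
  assumes sub: "cfun.subspace W" and fin: "\<And>F. F \<in> W \<Longrightarrow> finite_support F"
    and supp: "\<And>F x. F \<in> W \<Longrightarrow> x \<notin> X \<Longrightarrow> F x = 0" and count: "countable X"
  obtains B where "B \<subseteq> W" "W \<subseteq> cfun.span B"
    "\<And>F K. F \<in> B \<Longrightarrow> K \<in> B \<Longrightarrow> fin_inner F K = (if F = K then 1 else 0)"
proof -
  define num where "num = to_nat_on X"
  have inj: "inj_on num X"
    unfolding num_def using count by (rule inj_on_to_nat_on)
  define Wn where "Wn n = {F \<in> W. \<forall>x\<in>X. F x \<noteq> 0 \<longrightarrow> num x < n}" for n
  have Wn_sub: "cfun.subspace (Wn n)" for n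
    unfolding Wn_def cfun.subspace_def
    using cfun.subspace_0[OF sub] cfun.subspace_add[OF sub] cfun.subspace_scale[OF sub]
    by (auto simp: cscale_def)
  have WnW: "F \<in> W" if "F \<in> Wn n" for F n
    using that by (simp add: Wn_def)
  have Wn_fin: "finite_support F" if "F \<in> Wn n" for F n
    using fin WnW that by blast
  have Wn_mono: "m \<le> n \<Longrightarrow> Wn m \<subseteq> Wn n" for m n
    by (auto simp: Wn_def)
  define new where "new n b \<longleftrightarrow> b \<in> Wn (Suc n) \<and> fin_inner b b = 1 \<and> (\<forall>F\<in>Wn n. fin_inner b F = 0)" for n b
  \<comment> \<open>As the codimension is at most one, a \<open>new\<close> vector at a given level
    is unique up to a phase. \<open>SOME\<close> fixes one per level, so that members of
    \<open>B\<close> with equal level are equal; levels without a new vector contribute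
    none.\<close>
  define B where "B = {b. \<exists>n. (\<exists>b. new n b) \<and> b = (SOME b. new n b)}"
  have B_new: "\<exists>n. new n b \<and> b = (SOME b. new n b)" if "b \<in> B" for b
  proof -
    obtain n where n: "\<exists>b. new n b" "b = (SOME b. new n b)"
      using \<open>b \<in> B\<close> unfolding B_def by blast
    then show ?thesis
      using someI_ex[OF n(1)] by blast
  qed
  have some_B: "new n (SOME b. new n b) \<and> (SOME b. new n b) \<in> B" if "new n b" for n b
    using someI[of "new n" b, OF that] that unfolding B_def by blast
  have BW: "B \<subseteq> W"
    using B_new unfolding new_def by (auto dest: WnW)
  have ortho: "fin_inner F K = (if F = K then 1 else 0)" if "F \<in> B" "K \<in> B" for F K
  proof -
    from B_new[OF that(1)] obtain m where F: "new m F" "F = (SOME b. new m b)"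
      by (elim exE conjE)
    from B_new[OF that(2)] obtain n where K: "new n K" "K = (SOME b. new n b)"
      by (elim exE conjE)
    have zero: "fin_inner b c = 0" if "new i b" "new j c" "i > j" for b c i j
    proof -
      have "c \<in> Wn i"
        using that(2,3) Wn_mono[of "Suc j" i] unfolding new_def by (meson Suc_leI subsetD)
      then show ?thesis
        using that(1) unfolding new_def by blast
    qed
    have "finite_support F" "finite_support K"
      using that BW fin by auto
    then have "fin_inner F K = 0" if "m < n"
      using zero[OF K(1) F(1) that] fin_inner_sym[of F K] by simp
    moreover have "fin_inner F K = 0" if "n < m"
      using zero[OF F(1) K(1) that] .
    moreover have "F = K" if "m = n"
      using that F(2) K(2) by blast
    moreover have "fin_inner F F = 1"
      using F(1) unfolding new_def by blast
    ultimately show ?thesis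
      by (metis linorder_neqE_nat zero_neq_one)
  qed
  have "Wn n \<subseteq> cfun.span {b \<in> B. \<exists>m<n. new m b}" for n
  proof (induction n)
    case 0
    have "F = 0" if "F \<in> Wn 0" for F
    proof
      fix x
      show "F x = 0 x"
        using that supp[of F x] by (cases "x \<in> X") (auto simp: Wn_def)
    qed
    then show ?case
      using cfun.span_zero by blast
  next
    case (Suc n)
    let ?S = "\<lambda>n. cfun.span {b \<in> B. \<exists>m<n. new m b}"
    have S_mono: "?S n \<subseteq> ?S (Suc n)"
      by (rule cfun.span_mono) (auto intro: less_SucI)
    have fin_bs: "{b \<in> B. \<exists>m<n. new m b} \<subseteq> Wn n"
    proof
      fix b assume "b \<in> {b \<in> B. \<exists>m<n. new m b}"
      then obtain m where "m < n" "b \<in> Wn (Suc m)"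
        unfolding new_def by blast
      then show "b \<in> Wn n"
        using Wn_mono[of "Suc m" n] by auto
    qed
    show ?case
    proof
      fix F assume F: "F \<in> Wn (Suc n)"
      show "F \<in> ?S (Suc n)"
      proof (cases "\<exists>b. new n b")
        case True
        then obtain b where b: "new n b" "b \<in> B"
          using some_B by blast
        \<comment> \<open>\<open>b\<close> cannot vanish at the point numbered \<open>n\<close>:
          otherwise it would lie in \<open>Wn n\<close> and be orthogonal to itself. Subtracting a
          multiple of \<open>b\<close> from \<open>F\<close> therefore clears that point and lands
          in \<open>Wn n\<close>.\<close>
        obtain z where z: "z \<in> X" "num z = n" "b z \<noteq> 0"
        proof (rule ccontr)
          assume "\<not> thesis"
          then have "\<forall>z\<in>X. b z \<noteq> 0 \<longrightarrow> num z \<noteq> n"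
            using that by blast
          then have "b \<in> Wn n"
            using b unfolding new_def Wn_def by (auto simp: less_Suc_eq)
          then show False
            using b unfolding new_def by fastforce
        qed
        define K where "K = F - cscale (F z / b z) b"
        have "K \<in> Wn (Suc n)"
          unfolding K_def using F b Wn_sub unfolding new_def
          by (auto intro!: cfun.subspace_diff cfun.subspace_scale)
        moreover have "K z = 0"
          using z by (simp add: K_def cscale_def)
        ultimately have "K \<in> Wn n"
          using z inj unfolding Wn_def by (auto simp: less_Suc_eq inj_on_def)
        then have "K \<in> ?S (Suc n)"
          using Suc S_mono by blast
        moreover have "b \<in> ?S (Suc n)"
          using b by (intro cfun.span_base) auto
        ultimately have "K + cscale (F z / b z) b \<in> ?S (Suc n)"
          by (intro cfun.span_add cfun.span_scale)
        then show ?thesis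
          by (simp add: K_def)
      next
        case False
        \<comment> \<open>Without a new vector, \<open>F\<close> already lies in
          \<open>Wn n\<close>: projecting it onto the earlier basis vectors leaves a remainder
          orthogonal to \<open>Wn n\<close>, and a nonzero remainder could be normalised to a new
          vector.\<close>
        have "\<exists>K\<in>Wn n. \<forall>b\<in>{b \<in> B. \<exists>m<n. new m b}. fin_inner (F - K) b = 0"
        proof -
          define t where "t = {b \<in> B. \<exists>m<n. new m b}"
          have t_fin: "finite t"
          proof (rule finite_subset)
            show "t \<subseteq> (\<lambda>m. SOME b. new m b) ` {..<n}"
            proof
              fix b assume "b \<in> t"
              then obtain m k where m: "m < n" "new m b" and k: "b = (SOME b. new k b)" "new k b"
                using B_new unfolding t_def by blast
              \<comment> \<open>A vector new at two levels would be orthogonal to itself. Hence each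
                level contributes at most one vector, and finitely many levels finitely
                many.\<close>
              have "m = k"
              proof (rule ccontr)
                assume "m \<noteq> k"
                then have "fin_inner b b = 0"
                  using m k Wn_mono[of "Suc m" k] Wn_mono[of "Suc k" m] unfolding new_def
                  by (metis Suc_leI linorder_neqE_nat subsetD)
                then show False
                  using m unfolding new_def by simp
              qed
              then show "b \<in> (\<lambda>m. SOME b. new m b) ` {..<n}"
                using m k by auto
            qed
          qed simp
          define K where "K = (\<Sum>b\<in>t. cscale (fin_inner F b) b)"
          have tW: "b \<in> Wn n" if "b \<in> t" for b
            using that fin_bs t_def by blast
          have K: "K \<in> Wn n"
            unfolding K_def using tW Wn_sub by (intro cfun.subspace_sum cfun.subspace_scale) auto
          have "fin_inner (F - K) b = 0" if "b \<in> t" for b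
          proof -
            have "fin_inner K b = (\<Sum>c\<in>t. fin_inner F c * fin_inner c b)"
              unfolding K_def using tW Wn_fin
              by (intro fin_inner_lincomb) auto
            also have "\<dots> = (\<Sum>c\<in>t. if c = b then fin_inner F c else 0)"
              using that ortho unfolding t_def by (intro sum.cong) auto
            also have "\<dots> = fin_inner F b"
              using that t_fin by simp
            finally show ?thesis
              using fin_inner_diff[of F K b] Wn_fin[OF K] Wn_fin[OF F] by simp
          qed
          then show ?thesis
            using K unfolding t_def by blast
        qed
        then obtain K where K: "K \<in> Wn n" and perp: "\<And>b. b \<in> {b \<in> B. \<exists>m<n. new m b} \<Longrightarrow> fin_inner (F - K) b = 0"
          by blast
        have FK: "F - K \<in> Wn (Suc n)"
          using F K Wn_mono[of n "Suc n"] Wn_sub by (auto intro: cfun.subspace_diff)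
        have perp': "fin_inner (F - K) L = 0" if "L \<in> Wn n" for L
        proof -
          have "L \<in> ?S n"
            using Suc that by blast
          then obtain t r where t: "finite t" "t \<subseteq> {b \<in> B. \<exists>m<n. new m b}" and L: "L = (\<Sum>b\<in>t. cscale (r b) b)"
            by (auto simp: cfun.span_explicit)
          have fs: "finite_support b" if "b \<in> t" for b
            using that t(2) fin_bs Wn_fin by blast
          have "fin_inner L (F - K) = (\<Sum>b\<in>t. r b * fin_inner b (F - K))"
            unfolding L using fs by (intro fin_inner_lincomb) auto
          also have "\<dots> = 0"
            using perp t(2) fin_inner_sym[OF fs Wn_fin[OF FK]]
            by (intro sum.neutral) (auto dest!: subsetD)
          finally show ?thesis
            using fin_inner_sym[OF Wn_fin[OF FK] Wn_fin[OF that]] by simp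
        qed
        have "F - K = 0"
        proof (rule ccontr)
          assume "F - K \<noteq> 0"
          with Wn_fin[OF FK] obtain r where r: "fin_inner (cscale r (F - K)) (cscale r (F - K)) = 1"
            using fin_inner_normalize by blast
          then have "new n (cscale r (F - K))"
            unfolding new_def using FK Wn_sub perp' Wn_fin[OF FK]
            by (auto intro: cfun.subspace_scale simp: fin_inner_cscale)
          with False show False
            by blast
        qed
        then show ?thesis
          using Suc K S_mono by auto
      qed
    qed
  qed
  moreover have "\<exists>n. F \<in> Wn n" if "F \<in> W" for F
  proof -
    have "finite (num ` {x. F x \<noteq> 0})"
      using fin[OF that] by (simp add: finite_support_def)
    then obtain n where "\<forall>k\<in>num ` {x. F x \<noteq> 0}. k < n"
      using finite_nat_set_iff_bounded by blast
    then show ?thesis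
      using that unfolding Wn_def by auto
  qed
  moreover have "cfun.span {b \<in> B. \<exists>m<n. new m b} \<subseteq> cfun.span B" for n
    by (rule cfun.span_mono) auto
  ultimately have "W \<subseteq> cfun.span B"
    by blast
  with BW ortho that show thesis
    by blast
qed

section \<open>The spectrum of an operator with an orthonormal system of eigenfunctions\<close>

text \<open>A bounded inverse of \<open>T\<close> minus \<open>c\<close> acts on an eigenfunction
  for \<open>d\<close> as division by \<open>d - c\<close>, so eigenvalues keep a positive distance
  from \<open>c\<close>.\<close>

lemma ell2_spectrum_supset_closure:
  assumes T: "\<And>c. c \<in> \<Lambda> \<Longrightarrow> \<exists>F. eigenfunction X T c F"
  shows "closure \<Lambda> \<subseteq> ell2_spectrum X T"
proof
  fix c assume c: "c \<in> closure \<Lambda>"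
  show "c \<in> ell2_spectrum X T"
  proof (rule ccontr)
    assume "c \<notin> ell2_spectrum X T"
    then obtain B where B: "ell2_bounded_operator X B"
      and inv: "\<And>F. F \<in> ell2 X \<Longrightarrow> B (T F - cscale c F) = F"
      unfolding ell2_spectrum_def by blast
    from B obtain C where C: "\<And>F. F \<in> ell2 X \<Longrightarrow> ell2_norm X (B F) \<le> C * ell2_norm X F"
      unfolding ell2_bounded_operator_def by blast
    \<comment> \<open>The radius makes \<open>C\<close> times the distance less than 1. The absolute
      value covers a negative \<open>C\<close>, the summand 1 the case \<open>C = 0\<close>.\<close>
    obtain d where d: "d \<in> \<Lambda>" "dist d c < 1 / (\<bar>C\<bar> + 1)"
      using c unfolding closure_approachable by (meson abs_ge_zero add_nonneg_pos divide_pos_pos zero_less_one)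
    obtain F where F: "F \<in> ell2 X" "F \<noteq> 0" "T F = cscale d F"
      using T[OF d(1)] by (auto simp: eigenfunction_def)
    have n: "ell2_norm X F > 0"
      using F ell2_norm_eq_0 ell2_norm_nonneg by (metis less_eq_real_def)
    have TF: "T F - cscale c F = cscale (d - c) F"
      by (simp only: F(3) cfun.scale_left_diff_distrib)
    have "ell2_norm X F = ell2_norm X (B (cscale (d - c) F))"
      using inv[OF F(1)] TF by simp
    also have "\<dots> \<le> C * (cmod (d - c) * ell2_norm X F)"
      using C[OF ell2_cscale(1)[OF F(1)]] ell2_cscale(2)[OF F(1)] by metis
    finally have "1 \<le> C * cmod (d - c)"
      using n by (simp add: mult.assoc[symmetric])
    also have "\<dots> \<le> \<bar>C\<bar> * cmod (d - c)"
      by (simp add: mult_right_mono)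
    also have "\<dots> \<le> \<bar>C\<bar> * (1 / (\<bar>C\<bar> + 1))"
      using d by (intro mult_left_mono) (auto simp: dist_norm)
    also have "\<dots> < 1"
      by (simp add: field_simps)
    finally show False
      by simp
  qed
qed

text \<open>Parseval turns both norms into sums of squared coefficients, which are compared
  termwise. Applied with \<open>s F = r F * (e F - c)\<close>, where \<open>e F\<close> is the
  eigenvalue of \<open>F\<close>, this bounds \<open>T\<close> minus \<open>c\<close> from below on
  the span.\<close>

lemma bounded_below_eigenfunction_span:
  assumes B: "\<And>F. F \<in> B \<Longrightarrow> finite_support F" "B \<subseteq> ell2 X"
    and orth: "\<And>F K. F \<in> B \<Longrightarrow> K \<in> B \<Longrightarrow> fin_inner F K = (if F = K then 1 else 0)"
    and t: "finite t" "t \<subseteq> B" and \<delta>: "\<delta> \<ge> 0" "\<And>F. F \<in> t \<Longrightarrow> \<delta> * cmod (r F) \<le> cmod (s F)"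
  shows "\<delta> * ell2_norm X (\<Sum>F\<in>t. cscale (r F) F) \<le> ell2_norm X (\<Sum>F\<in>t. cscale (s F) F)"
proof -
  have norm: "(ell2_norm X (\<Sum>F\<in>t. cscale (u F) F))\<^sup>2 = (\<Sum>F\<in>t. (cmod (u F))\<^sup>2)" for u
  proof -
    let ?S = "\<Sum>F\<in>t. cscale (u F) F"
    have tB: "finite_support F" "F \<in> ell2 X" if "F \<in> t" for F
      using that B t by auto
    have fS: "finite_support ?S"
      using tB cfun.subspace_sum[OF subspace_finite_support, of t "\<lambda>F. cscale (u F) F"]
      by (simp only: mem_Collect_eq finite_support_cscale)
    have eS: "?S \<in> ell2 X"
      using tB by (intro ell2_sum ell2_cscale)
    have FS: "fin_inner F ?S = cnj (u F)" if "F \<in> t" for F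
    proof -
      have "fin_inner ?S F = (\<Sum>K\<in>t. u K * fin_inner K F)"
        using tB by (intro fin_inner_lincomb) auto
      also have "\<dots> = (\<Sum>K\<in>t. if K = F then u K else 0)"
      proof (rule sum.cong)
        fix K assume "K \<in> t"
        then show "u K * fin_inner K F = (if K = F then u K else 0)"
          using orth[OF subsetD[OF t(2)] subsetD[OF t(2) that], of K] by simp
      qed simp
      also have "\<dots> = u F"
        using that t by simp
      finally show ?thesis
        using fin_inner_sym[OF tB(1)[OF that] fS] by simp
    qed
    have "complex_of_real ((ell2_norm X ?S)\<^sup>2) = fin_inner ?S ?S"
      using fS eS by (intro fin_inner_ell2_norm[symmetric]) (auto simp: ell2_outside)
    also have "\<dots> = (\<Sum>F\<in>t. u F * fin_inner F ?S)"
      using tB by (intro fin_inner_lincomb) auto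
    also have "\<dots> = (\<Sum>F\<in>t. u F * cnj (u F))"
      using FS by (intro sum.cong) auto
    also have "\<dots> = complex_of_real (\<Sum>F\<in>t. (cmod (u F))\<^sup>2)"
      by (simp only: of_real_sum complex_norm_square)
    finally show ?thesis
      by (simp only: of_real_eq_iff)
  qed
  have "(\<delta> * ell2_norm X (\<Sum>F\<in>t. cscale (r F) F))\<^sup>2 = (\<Sum>F\<in>t. (\<delta> * cmod (r F))\<^sup>2)"
    by (simp only: power_mult_distrib norm sum_distrib_left)
  also have "\<dots> \<le> (ell2_norm X (\<Sum>F\<in>t. cscale (s F) F))\<^sup>2"
    unfolding norm using \<delta> by (intro sum_mono power_mono) auto
  finally show ?thesis
    by (rule power2_le_imp_le) (rule ell2_norm_nonneg)
qed

text \<open>\<open>T\<close> is diagonal in the system \<open>B\<close>. For \<open>c\<close> at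
  distance at least \<delta> from \<Lambda>, the operator \<open>T\<close> minus \<open>c\<close> is
  bounded below by \<delta> on the span of \<open>B\<close>, hence everywhere by density; its range
  contains the span and, by completeness, everything. The inverse has norm at most
  \<open>1 / \<delta>\<close>.\<close>

lemma ell2_spectrum_subset_closure:
  assumes T: "ell2_bounded_operator X T"
    and B: "\<And>F. F \<in> B \<Longrightarrow> finite_support F" "B \<subseteq> ell2 X"
    and orth: "\<And>F K. F \<in> B \<Longrightarrow> K \<in> B \<Longrightarrow> fin_inner F K = (if F = K then 1 else 0)"
    and dense: "\<And>F \<epsilon>. F \<in> ell2 X \<Longrightarrow> \<epsilon> > 0 \<Longrightarrow> \<exists>K\<in>cfun.span B. ell2_norm X (F - K) < \<epsilon>"
    and eig: "\<And>F. F \<in> B \<Longrightarrow> \<exists>c\<in>\<Lambda>. T F = cscale c F"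
  shows "ell2_spectrum X T \<subseteq> closure \<Lambda>"
proof (rule subsetI, rule ccontr)
  fix c assume c: "c \<in> ell2_spectrum X T" "c \<notin> closure \<Lambda>"
  then obtain \<delta> where \<delta>: "\<delta> > 0" "\<And>d. d \<in> \<Lambda> \<Longrightarrow> \<delta> \<le> dist d c"
    unfolding closure_approachable by (auto simp: not_less)
  obtain e where e: "e F \<in> \<Lambda>" "T F = cscale (e F) F" if "F \<in> B" for F
    using eig by metis
  have e_dist: "\<delta> \<le> cmod (e F - c)" if "F \<in> B" for F
    using \<delta>(2)[OF e(1)[OF that]] by (simp add: dist_norm)
  define A where "A F = T F - cscale c F" for F
  obtain C where T_in: "\<And>F. F \<in> ell2 X \<Longrightarrow> T F \<in> ell2 X"
    and T_add: "\<And>F K. F \<in> ell2 X \<Longrightarrow> K \<in> ell2 X \<Longrightarrow> T (F + K) = T F + T K"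
    and T_scale: "\<And>r F. F \<in> ell2 X \<Longrightarrow> T (cscale r F) = cscale r (T F)"
    and C: "\<And>F. F \<in> ell2 X \<Longrightarrow> ell2_norm X (T F) \<le> C * ell2_norm X F"
    using T unfolding ell2_bounded_operator_def by metis
  have A_in: "A F \<in> ell2 X" if "F \<in> ell2 X" for F
    unfolding A_def using that by (intro ell2_diff T_in ell2_cscale)
  have A_add: "A (F + K) = A F + A K" if "F \<in> ell2 X" "K \<in> ell2 X" for F K
    unfolding A_def by (simp only: T_add[OF that] cfun.scale_right_distrib add_diff_add)
  have A_scale: "A (cscale r F) = cscale r (A F)" if "F \<in> ell2 X" for F r
    unfolding A_def by (simp only: T_scale[OF that] cfun.scale_right_diff_distrib cfun.scale_left_commute)
  have A_diff: "A (F - K) = A F - A K" if "F \<in> ell2 X" "K \<in> ell2 X" for F K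
    using A_add[OF ell2_diff(1)[OF that] that(2)] by (simp only: diff_add_cancel eq_diff_eq)
  have A_sum: "A (\<Sum>F\<in>t. cscale (r F) F) = (\<Sum>F\<in>t. cscale (r F) (A F))" if "finite t" "t \<subseteq> B" for t r
    using that
  proof (induction t rule: finite_induct)
    case empty
    have "A (cscale 0 0) = cscale 0 (A 0)"
      by (rule A_scale[OF ell2_zero(1)])
    then show ?case
      by (simp only: cfun.scale_zero_left sum.empty)
  next
    case (insert F t)
    then have "F \<in> ell2 X" "(\<Sum>F\<in>t. cscale (r F) F) \<in> ell2 X"
      using B by (auto intro!: ell2_sum ell2_cscale)
    moreover have "A (\<Sum>F\<in>t. cscale (r F) F) = (\<Sum>F\<in>t. cscale (r F) (A F))"
      using insert by simp
    ultimately show ?case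
      unfolding sum.insert[OF insert.hyps] by (simp only: A_add ell2_cscale A_scale)
  qed
  define M where "M = C + cmod c"
  have A_bound: "ell2_norm X (A F) \<le> M * ell2_norm X F" if "F \<in> ell2 X" for F
    using ell2_diff(2)[OF T_in[OF that] ell2_cscale(1)[OF that, of c]] C[OF that] ell2_cscale(2)[OF that, of c]
    unfolding A_def M_def by (simp add: distrib_right)
  have eA: "A F = cscale (e F - c) F" if "F \<in> B" for F
    unfolding A_def e(2)[OF that] by (simp only: cfun.scale_left_diff_distrib)
  have span_ell2: "cfun.span B \<subseteq> ell2 X"
    using B(2) subspace_ell2 by (rule cfun.span_minimal)
  have A_below_span: "\<delta> * ell2_norm X K \<le> ell2_norm X (A K)" if K: "K \<in> cfun.span B" for K
  proof -
    obtain t r where t: "finite t" "t \<subseteq> B" and Ke: "K = (\<Sum>F\<in>t. cscale (r F) F)"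
      using K by (auto simp: cfun.span_explicit)
    have "A K = (\<Sum>F\<in>t. cscale (r F * (e F - c)) F)"
      unfolding Ke A_sum[OF t] using t by (intro sum.cong refl) (auto simp: eA)
    moreover have "\<delta> * cmod (r F) \<le> cmod (r F * (e F - c))" if "F \<in> t" for F
    proof -
      have "\<delta> \<le> cmod (e F - c)"
        using e_dist that t(2) by blast
      then have "\<delta> * cmod (r F) \<le> cmod (e F - c) * cmod (r F)"
        by (rule mult_right_mono) simp
      then show ?thesis
        by (simp only: norm_mult mult.commute)
    qed
    ultimately show ?thesis
      unfolding Ke using bounded_below_eigenfunction_span[OF B orth t, of \<delta> r "\<lambda>F. r F * (e F - c)"] \<delta>(1)
      by (metis less_imp_le)
  qed
  have A_below: "\<delta> * ell2_norm X F \<le> ell2_norm X (A F)" if F: "F \<in> ell2 X" for F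
  proof (rule field_le_epsilon)
    fix \<epsilon> :: real assume "\<epsilon> > 0"
    \<comment> \<open>An approximation error \<eta> costs \<open>\<delta> * \<eta>\<close> in the
      lower bound and at most \<open>\<bar>M\<bar> * \<eta>\<close> through the boundedness of
      \<open>A\<close>; the total is \<epsilon>.\<close>
    define \<eta> where "\<eta> = \<epsilon> / (\<delta> + \<bar>M\<bar>)"
    have \<eta>: "\<eta> > 0" "(\<delta> + \<bar>M\<bar>) * \<eta> = \<epsilon>"
      using \<open>\<epsilon> > 0\<close> \<delta>(1) by (auto simp: \<eta>_def)
    obtain K where K: "K \<in> cfun.span B" "ell2_norm X (F - K) < \<eta>"
      using dense[OF F \<eta>(1)] by blast
    then have K2: "K \<in> ell2 X"
      using span_ell2 by blast
    have FK: "F - K \<in> ell2 X" "K - F \<in> ell2 X"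
      using F K2 by (auto intro: ell2_diff)
    have "ell2_norm X F \<le> ell2_norm X K + \<eta>"
      using ell2_norm_triangle_sub[OF F K2] K(2) by simp
    then have "\<delta> * ell2_norm X F \<le> \<delta> * ell2_norm X K + \<delta> * \<eta>"
      using \<delta>(1) by (simp add: distrib_left[symmetric])
    also have "\<delta> * ell2_norm X K \<le> ell2_norm X (A K)"
      by (rule A_below_span[OF K(1)])
    also have "ell2_norm X (A K) \<le> ell2_norm X (A F) + ell2_norm X (A (K - F))"
      using ell2_norm_triangle_sub[OF A_in[OF K2] A_in[OF F]] A_diff[OF K2 F] by simp
    also have "ell2_norm X (A (K - F)) \<le> M * ell2_norm X (K - F)"
      by (rule A_bound[OF FK(2)])
    also have "\<dots> \<le> \<bar>M\<bar> * \<eta>"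
      using K(2) by (intro mult_mono) (auto simp: ell2_norm_minus_commute ell2_norm_nonneg)
    finally show "\<delta> * ell2_norm X F \<le> ell2_norm X (A F) + \<epsilon>"
      using \<eta>(2) by (simp add: distrib_right)
  qed
  have inj: "F = K" if "F \<in> ell2 X" "K \<in> ell2 X" "A F = A K" for F K
  proof -
    have "A (F - K) = 0"
      using A_diff that by simp
    then have "ell2_norm X (F - K) \<le> 0"
      using A_below[OF ell2_diff(1)[OF that(1,2)]] \<delta>(1) by (simp add: ell2_zero mult_le_0_iff)
    then have "F - K = 0"
      using ell2_norm_eq_0[OF ell2_diff(1)[OF that(1,2)]] ell2_norm_nonneg antisym by blast
    then show ?thesis
      by simp
  qed
  \<comment> \<open>On the span, \<open>A\<close> is inverted by dividing coefficients by
    \<open>e F - c\<close>. Approximants of \<open>F\<close> in the span thus have preimages, which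
    form a Cauchy sequence because \<open>A\<close> is bounded below; their limit is mapped to
    \<open>F\<close>.\<close>
  have surj: "\<exists>L\<in>ell2 X. A L = F" if F: "F \<in> ell2 X" for F
  proof -
    have "\<exists>K\<in>cfun.span B. ell2_norm X (F - K) < 1 / real (Suc n)" for n
      using dense[OF F] by simp
    then obtain Fn where Fn: "Fn n \<in> cfun.span B" "ell2_norm X (F - Fn n) < 1 / real (Suc n)" for n
      by metis
    have "\<exists>K\<in>cfun.span B. A K = Fn n" for n
    proof -
      obtain t r where t: "finite t" "t \<subseteq> B" and Fne: "Fn n = (\<Sum>F\<in>t. cscale (r F) F)"
        using Fn(1)[of n] by (auto simp: cfun.span_explicit)
      let ?K = "\<Sum>F\<in>t. cscale (r F / (e F - c)) F"
      have "?K \<in> cfun.span B"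
        using t by (intro cfun.span_sum cfun.span_scale cfun.span_base) auto
      moreover have "A ?K = (\<Sum>F\<in>t. cscale (r F) F)"
        unfolding A_sum[OF t]
      proof (rule sum.cong)
        fix F assume "F \<in> t"
        then have "F \<in> B"
          using t by auto
        then have "e F - c \<noteq> 0" "A F = cscale (e F - c) F"
          using e_dist[of F] \<delta>(1) eA by auto
        then show "cscale (r F / (e F - c)) (A F) = cscale (r F) F"
          by simp
      qed simp
      ultimately show ?thesis
        using Fne by metis
    qed
    then obtain Kn where Kn: "Kn n \<in> cfun.span B" "A (Kn n) = Fn n" for n
      by metis
    have Kn2: "Kn n \<in> ell2 X" and Fn2: "Fn n \<in> ell2 X" for n
      using Kn(1) Fn(1) span_ell2 by auto
    have "\<exists>N. \<forall>m\<ge>N. \<forall>n\<ge>N. ell2_norm X (Kn m - Kn n) \<le> \<epsilon>" if "\<epsilon> > 0" for \<epsilon>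
    proof -
      \<comment> \<open>Two approximation errors of at most \<open>\<delta> * \<epsilon> / 2\<close>
        add up to \<open>\<delta> * \<epsilon>\<close>, and the lower bound for \<open>A\<close>
        divides by \<delta>.\<close>
      obtain N where N: "1 / real (Suc N) < \<delta> * \<epsilon> / 2"
        by (rule nat_approx_posE[of "\<delta> * \<epsilon> / 2"]) (use \<delta>(1) \<open>\<epsilon> > 0\<close> in simp)
      have "ell2_norm X (Kn m - Kn n) \<le> \<epsilon>" if "m \<ge> N" "n \<ge> N" for m n
      proof -
        have small: "ell2_norm X (F - Fn k) \<le> \<delta> * \<epsilon> / 2" if "k \<ge> N" for k
        proof -
          have "1 / real (Suc k) \<le> 1 / real (Suc N)"
            using that by (simp add: field_simps)
          then show ?thesis
            using Fn(2)[of k] N by simp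
        qed
        have "\<delta> * ell2_norm X (Kn m - Kn n) \<le> ell2_norm X (A (Kn m - Kn n))"
          by (intro A_below ell2_diff Kn2)
        also have "A (Kn m - Kn n) = (F - Fn n) - (F - Fn m)"
          using A_diff[OF Kn2 Kn2, of m n] Kn(2) by simp
        also have "ell2_norm X \<dots> \<le> ell2_norm X (F - Fn n) + ell2_norm X (F - Fn m)"
          by (intro ell2_diff F Fn2)
        also have "\<dots> \<le> \<delta> * \<epsilon>"
          using small[OF that(1)] small[OF that(2)] by simp
        finally show ?thesis
          using \<delta>(1) by (simp only: mult_le_cancel_left_pos)
      qed
      then show ?thesis
        by blast
    qed
    then obtain L where L: "L \<in> ell2 X" "(\<lambda>n. ell2_norm X (Kn n - L)) \<longlonglongrightarrow> 0"
      using ell2_complete[of Kn X, OF Kn2] by blast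
    have "ell2_norm X (A L - F) \<le> 0"
    proof (rule LIMSEQ_le_const)
      have "(\<lambda>n. 1 / real (Suc n)) \<longlonglongrightarrow> 0"
        by (rule lim_1_over_n[THEN LIMSEQ_Suc])
      then have "(\<lambda>n. M * ell2_norm X (Kn n - L) + 1 / real (Suc n)) \<longlonglongrightarrow> M * 0 + 0"
        using L(2) by (intro tendsto_add tendsto_mult tendsto_const)
      then show "(\<lambda>n. M * ell2_norm X (Kn n - L) + 1 / real (Suc n)) \<longlonglongrightarrow> 0"
        by simp
      have "ell2_norm X (A L - F) \<le> M * ell2_norm X (Kn n - L) + 1 / real (Suc n)" for n
      proof -
        have "A L - F = (Fn n - F) - A (Kn n - L)"
          using A_diff[OF Kn2 L(1), of n] Kn(2)[of n] by simp
        then have "ell2_norm X (A L - F) \<le> ell2_norm X (Fn n - F) + ell2_norm X (A (Kn n - L))"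
          using ell2_diff(2)[OF ell2_diff(1)[OF Fn2 F] A_in[OF ell2_diff(1)[OF Kn2 L(1)]], of n n] by (simp only:)
        then show ?thesis
          using A_bound[OF ell2_diff(1)[OF Kn2 L(1)], of n] Fn(2)[of n]
          by (simp add: ell2_norm_minus_commute[of X "Fn n"])
      qed
      then show "\<exists>N. \<forall>n\<ge>N. ell2_norm X (A L - F) \<le> M * ell2_norm X (Kn n - L) + 1 / real (Suc n)"
        by blast
    qed
    then have "A L - F = 0"
      using ell2_norm_eq_0[OF ell2_diff(1)[OF A_in[OF L(1)] F]] ell2_norm_nonneg antisym by blast
    then show ?thesis
      using L(1) by auto
  qed
  obtain R where R: "\<And>F. F \<in> ell2 X \<Longrightarrow> R F \<in> ell2 X" "\<And>F. F \<in> ell2 X \<Longrightarrow> A (R F) = F"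
    using surj by metis
  have "ell2_bounded_operator X R"
    unfolding ell2_bounded_operator_def
  proof (intro conjI ballI allI exI)
    fix F assume F: "F \<in> ell2 X"
    show "R F \<in> ell2 X"
      by (rule R(1)[OF F])
    show "R (cscale r F) = cscale r (R F)" for r
      by (rule inj) (use F in \<open>simp_all add: R ell2_cscale A_scale\<close>)
    show "R (F + K) = R F + R K" if "K \<in> ell2 X" for K
    proof (rule inj)
      show "A (R (F + K)) = A (R F + R K)"
        by (simp only: R F that ell2_add A_add)
    qed (simp_all only: R F that ell2_add)
    show "ell2_norm X (R F) \<le> (1 / \<delta>) * ell2_norm X F"
      using A_below[OF R(1)[OF F]] R(2)[OF F] \<delta>(1) by (simp add: field_simps)
  qed
  moreover have "R (T F - cscale c F) = F" if "F \<in> ell2 X" for F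
    using inj[OF R(1)[OF A_in[OF that]] that R(2)[OF A_in[OF that]]] by (simp only: A_def)
  moreover have "T (R F) - cscale c (R F) = F" if "F \<in> ell2 X" for F
    using R(2)[OF that] by (simp only: A_def)
  ultimately have "c \<notin> ell2_spectrum X T"
    unfolding ell2_spectrum_def by blast
  with c(1) show False
    by simp
qed

section \<open>Right convolution operators\<close>

text \<open>Summing over increments \<open>z\<close> instead of starting points \<open>y\<close>
  exhibits the convolution as a finite combination of right translations, each an isometry; the norm
  is at most the sum of the absolute weights.\<close>

lemma right_convolution_bounded_operator:
  fixes \<Gamma> :: "('a, 'm) monoid_scheme"
  assumes "Group.group \<Gamma>" and Z: "finite {z \<in> carrier \<Gamma>. \<nu> z \<noteq> 0}"
  shows "ell2_bounded_operator (carrier \<Gamma>) (right_convolution \<Gamma> \<nu>)"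
proof -
  interpret group \<Gamma> by fact
  let ?X = "carrier \<Gamma>" and ?Z = "{z \<in> carrier \<Gamma>. \<nu> z \<noteq> 0}"
  define sh where "sh z F = (\<lambda>x. if x \<in> ?X then F (x \<otimes>\<^bsub>\<Gamma>\<^esub> inv\<^bsub>\<Gamma>\<^esub> z) else 0)" for z and F :: "'a \<Rightarrow> complex"
  have R: "right_convolution \<Gamma> \<nu> F = (\<Sum>z\<in>?Z. cscale (\<nu> z) (sh z F))" for F
  proof
    fix x
    show "right_convolution \<Gamma> \<nu> F x = (\<Sum>z\<in>?Z. cscale (\<nu> z) (sh z F)) x"
    proof (cases "x \<in> ?X")
      case True
      have bij: "bij_betw (\<lambda>z. x \<otimes>\<^bsub>\<Gamma>\<^esub> inv\<^bsub>\<Gamma>\<^esub> z) ?X ?X"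
        by (rule bij_betw_byWitness[where f' = "\<lambda>y. inv\<^bsub>\<Gamma>\<^esub> y \<otimes>\<^bsub>\<Gamma>\<^esub> x"])
          (use True in \<open>auto simp: inv_mult_group m_assoc[symmetric] inv_solve_right' m_assoc\<close>)
      have "right_convolution \<Gamma> \<nu> F x = (\<Sum>\<^sub>\<infinity>y\<in>?X. F y * complex_of_real (\<nu> (inv\<^bsub>\<Gamma>\<^esub> y \<otimes>\<^bsub>\<Gamma>\<^esub> x)))"
        using True by (simp add: right_convolution_def)
      also have "\<dots> = (\<Sum>\<^sub>\<infinity>z\<in>?X. F (x \<otimes>\<^bsub>\<Gamma>\<^esub> inv\<^bsub>\<Gamma>\<^esub> z) * complex_of_real (\<nu> (inv\<^bsub>\<Gamma>\<^esub> (x \<otimes>\<^bsub>\<Gamma>\<^esub> inv\<^bsub>\<Gamma>\<^esub> z) \<otimes>\<^bsub>\<Gamma>\<^esub> x)))"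
        by (rule infsum_reindex_bij_betw[OF bij, symmetric])
      also have "\<dots> = (\<Sum>\<^sub>\<infinity>z\<in>?X. F (x \<otimes>\<^bsub>\<Gamma>\<^esub> inv\<^bsub>\<Gamma>\<^esub> z) * complex_of_real (\<nu> z))"
        by (rule infsum_cong) (use True in \<open>simp add: inv_mult_group m_assoc\<close>)
      also have "\<dots> = (\<Sum>\<^sub>\<infinity>z\<in>?Z. F (x \<otimes>\<^bsub>\<Gamma>\<^esub> inv\<^bsub>\<Gamma>\<^esub> z) * complex_of_real (\<nu> z))"
        by (rule infsum_cong_neutral) auto
      also have "\<dots> = (\<Sum>z\<in>?Z. F (x \<otimes>\<^bsub>\<Gamma>\<^esub> inv\<^bsub>\<Gamma>\<^esub> z) * complex_of_real (\<nu> z))"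
        by (rule infsum_finite[OF Z])
      finally show ?thesis
        using True by (simp add: sum_cfun_apply cscale_def sh_def mult.commute)
    next
      case False
      then show ?thesis
        by (simp add: right_convolution_def sum_cfun_apply cscale_def sh_def)
    qed
  qed
  have sh: "sh z F \<in> ell2 ?X" "ell2_norm ?X (sh z F) = ell2_norm ?X F"
    if "z \<in> ?X" "F \<in> ell2 ?X" for z F
  proof -
    have "bij_betw (\<lambda>x. x \<otimes>\<^bsub>\<Gamma>\<^esub> inv\<^bsub>\<Gamma>\<^esub> z) ?X ?X"
      by (rule bij_betw_byWitness[where f' = "\<lambda>x. x \<otimes>\<^bsub>\<Gamma>\<^esub> z"]) (use that in \<open>auto simp: m_assoc\<close>)
    then show "sh z F \<in> ell2 ?X" "ell2_norm ?X (sh z F) = ell2_norm ?X F"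
      unfolding sh_def using ell2_reindex that(2) by blast+
  qed
  have sh_add: "sh z (F + K) = sh z F + sh z K" and sh_scale: "sh z (cscale c F) = cscale c (sh z F)" for z F K c
    by (auto simp: sh_def cscale_def fun_eq_iff)
  show ?thesis
    unfolding ell2_bounded_operator_def
  proof (intro conjI ballI allI exI)
    fix F assume F: "F \<in> ell2 ?X"
    have in_ell2: "cscale (\<nu> z) (sh z F) \<in> ell2 ?X" if "z \<in> ?Z" for z
      using that F by (intro ell2_cscale sh) auto
    show "right_convolution \<Gamma> \<nu> F \<in> ell2 ?X"
      unfolding R by (intro ell2_sum in_ell2)
    show "right_convolution \<Gamma> \<nu> (F + K) = right_convolution \<Gamma> \<nu> F + right_convolution \<Gamma> \<nu> K" for K
      unfolding R sh_add cfun.scale_right_distrib sum.distrib ..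
    show "right_convolution \<Gamma> \<nu> (cscale c F) = cscale c (right_convolution \<Gamma> \<nu> F)" for c
      unfolding R sh_scale cfun.scale_sum_right by (rule sum.cong) (auto simp: mult.commute)
    have "ell2_norm ?X (right_convolution \<Gamma> \<nu> F) \<le> (\<Sum>z\<in>?Z. ell2_norm ?X (cscale (\<nu> z) (sh z F)))"
      unfolding R by (intro ell2_sum in_ell2)
    also have "\<dots> = (\<Sum>z\<in>?Z. \<bar>\<nu> z\<bar> * ell2_norm ?X F)"
      using F by (intro sum.cong refl) (simp add: ell2_cscale sh)
    finally show "ell2_norm ?X (right_convolution \<Gamma> \<nu> F) \<le> (\<Sum>z\<in>?Z. \<bar>\<nu> z\<bar>) * ell2_norm ?X F"
      by (simp only: sum_distrib_right)
  qed
qed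

lemma right_convolution_finite:
  assumes "finite A" "A \<subseteq> carrier \<Gamma>" "\<And>y. y \<notin> A \<Longrightarrow> F y = 0" "x \<in> carrier \<Gamma>"
  shows "right_convolution \<Gamma> \<nu> F x = (\<Sum>y\<in>A. F y * complex_of_real (\<nu> (inv\<^bsub>\<Gamma>\<^esub> y \<otimes>\<^bsub>\<Gamma>\<^esub> x)))"
proof -
  have "right_convolution \<Gamma> \<nu> F x = (\<Sum>\<^sub>\<infinity>y\<in>A. F y * complex_of_real (\<nu> (inv\<^bsub>\<Gamma>\<^esub> y \<otimes>\<^bsub>\<Gamma>\<^esub> x)))"
    unfolding right_convolution_def if_P[OF assms(4)] using assms(2,3) by (intro infsum_cong_neutral) auto
  then show ?thesis
    unfolding infsum_finite[OF assms(1)] .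
qed

text \<open>Symmetry of the kernel, after exchanging two finite sums. Convolution may spread beyond
  \<open>A\<close>, but there the other factor vanishes.\<close>

lemma right_convolution_self_adjoint:
  assumes A: "finite A" "A \<subseteq> carrier \<Gamma>" and F: "\<And>x. x \<notin> A \<Longrightarrow> F x = 0" and K: "\<And>x. x \<notin> A \<Longrightarrow> K x = 0"
    and sym: "\<And>x y. x \<in> carrier \<Gamma> \<Longrightarrow> y \<in> carrier \<Gamma> \<Longrightarrow> \<nu> (inv\<^bsub>\<Gamma>\<^esub> y \<otimes>\<^bsub>\<Gamma>\<^esub> x) = \<nu> (inv\<^bsub>\<Gamma>\<^esub> x \<otimes>\<^bsub>\<Gamma>\<^esub> y)"
  shows "(\<Sum>x\<in>A. right_convolution \<Gamma> \<nu> F x * cnj (K x)) = (\<Sum>y\<in>A. F y * cnj (right_convolution \<Gamma> \<nu> K y))"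
proof -
  let ?k = "\<lambda>y x. complex_of_real (\<nu> (inv\<^bsub>\<Gamma>\<^esub> y \<otimes>\<^bsub>\<Gamma>\<^esub> x))"
  have "(\<Sum>x\<in>A. right_convolution \<Gamma> \<nu> F x * cnj (K x)) = (\<Sum>x\<in>A. \<Sum>y\<in>A. F y * ?k y x * cnj (K x))"
    using A by (intro sum.cong refl) (simp add: right_convolution_finite[OF A F] sum_distrib_right subset_iff)
  also have "\<dots> = (\<Sum>y\<in>A. \<Sum>x\<in>A. F y * ?k y x * cnj (K x))"
    by (rule sum.swap)
  also have "\<dots> = (\<Sum>y\<in>A. F y * cnj (right_convolution \<Gamma> \<nu> K y))"
  proof (rule sum.cong)
    fix y assume "y \<in> A"
    then have "cnj (right_convolution \<Gamma> \<nu> K y) = (\<Sum>x\<in>A. cnj (K x) * ?k y x)"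
      using A sym by (subst right_convolution_finite[OF A K]) (auto simp: subset_iff intro!: sum.cong)
    then show "(\<Sum>x\<in>A. F y * ?k y x * cnj (K x)) = F y * cnj (right_convolution \<Gamma> \<nu> K y)"
      by (simp add: sum_distrib_left mult_ac)
  qed simp
  finally show ?thesis .
qed

section \<open>Left translations and their commutation with right convolution\<close>

definition left_translate :: "('a, 'm) monoid_scheme \<Rightarrow> 'a \<Rightarrow> ('a \<Rightarrow> complex) \<Rightarrow> 'a \<Rightarrow> complex" where
  "left_translate \<Gamma> \<gamma> F = (\<lambda>x. if x \<in> carrier \<Gamma> then F (inv\<^bsub>\<Gamma>\<^esub> \<gamma> \<otimes>\<^bsub>\<Gamma>\<^esub> x) else 0)"

lemma left_translate_add: "left_translate \<Gamma> \<gamma> (F + K) = left_translate \<Gamma> \<gamma> F + left_translate \<Gamma> \<gamma> K"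
  and left_translate_diff: "left_translate \<Gamma> \<gamma> (F - K) = left_translate \<Gamma> \<gamma> F - left_translate \<Gamma> \<gamma> K"
  and left_translate_cscale: "left_translate \<Gamma> \<gamma> (cscale c F) = cscale c (left_translate \<Gamma> \<gamma> F)"
  by (auto simp: left_translate_def cscale_def fun_eq_iff)

context
  fixes \<Gamma> :: "('a, 'm) monoid_scheme" and \<gamma>
  assumes group: "Group.group \<Gamma>" and \<gamma>: "\<gamma> \<in> carrier \<Gamma>"
begin

interpretation group \<Gamma> by (rule group)

lemma left_mult_bij: "bij_betw (\<lambda>x. \<gamma> \<otimes>\<^bsub>\<Gamma>\<^esub> x) (carrier \<Gamma>) (carrier \<Gamma>)"
  by (rule bij_betw_byWitness[where f' = "\<lambda>x. inv\<^bsub>\<Gamma>\<^esub> \<gamma> \<otimes>\<^bsub>\<Gamma>\<^esub> x"])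
    (use \<gamma> in \<open>auto simp: m_assoc[symmetric]\<close>)

lemma inv_left_mult_bij: "bij_betw (\<lambda>x. inv\<^bsub>\<Gamma>\<^esub> \<gamma> \<otimes>\<^bsub>\<Gamma>\<^esub> x) (carrier \<Gamma>) (carrier \<Gamma>)"
  by (rule bij_betw_byWitness[where f' = "\<lambda>x. \<gamma> \<otimes>\<^bsub>\<Gamma>\<^esub> x"])
    (use \<gamma> in \<open>auto simp: m_assoc[symmetric]\<close>)

lemma left_translate_ell2:
  assumes "F \<in> ell2 (carrier \<Gamma>)"
  shows "left_translate \<Gamma> \<gamma> F \<in> ell2 (carrier \<Gamma>)"
    and "ell2_norm (carrier \<Gamma>) (left_translate \<Gamma> \<gamma> F) = ell2_norm (carrier \<Gamma>) F"
  unfolding left_translate_def using ell2_reindex[OF inv_left_mult_bij assms] by auto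

lemma left_translate_mult: "x \<in> carrier \<Gamma> \<Longrightarrow> left_translate \<Gamma> \<gamma> F (\<gamma> \<otimes>\<^bsub>\<Gamma>\<^esub> x) = F x"
  using \<gamma> by (simp add: left_translate_def m_assoc[symmetric])

lemma left_translate_finite_support:
  assumes "finite_support F"
  shows "finite_support (left_translate \<Gamma> \<gamma> F)"
proof -
  have "x = \<gamma> \<otimes>\<^bsub>\<Gamma>\<^esub> (inv\<^bsub>\<Gamma>\<^esub> \<gamma> \<otimes>\<^bsub>\<Gamma>\<^esub> x)" if "x \<in> carrier \<Gamma>" for x
    using that \<gamma> by (simp add: m_assoc[symmetric])
  then have "{x. left_translate \<Gamma> \<gamma> F x \<noteq> 0} \<subseteq> (\<lambda>x. \<gamma> \<otimes>\<^bsub>\<Gamma>\<^esub> x) ` {x. F x \<noteq> 0}"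
    by (auto simp: left_translate_def image_iff split: if_splits)
  then show ?thesis
    using assms unfolding finite_support_def by (metis finite_imageI finite_subset)
qed

text \<open>Substituting \<gamma> times \<open>y\<close> for \<open>y\<close> moves the inverse of
  \<gamma> to the argument. Eigenspaces are therefore invariant under left translation, the source
  both of infinite multiplicity and of the reduction of density to a single point mass.\<close>

lemma right_convolution_left_translate:
  "right_convolution \<Gamma> \<nu> (left_translate \<Gamma> \<gamma> F) = left_translate \<Gamma> \<gamma> (right_convolution \<Gamma> \<nu> F)"
proof
  fix x
  show "right_convolution \<Gamma> \<nu> (left_translate \<Gamma> \<gamma> F) x = left_translate \<Gamma> \<gamma> (right_convolution \<Gamma> \<nu> F) x"
  proof (cases "x \<in> carrier \<Gamma>")
    case True
    have "(\<Sum>\<^sub>\<infinity>y\<in>carrier \<Gamma>. left_translate \<Gamma> \<gamma> F y * complex_of_real (\<nu> (inv\<^bsub>\<Gamma>\<^esub> y \<otimes>\<^bsub>\<Gamma>\<^esub> x))) =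
      (\<Sum>\<^sub>\<infinity>y\<in>carrier \<Gamma>. left_translate \<Gamma> \<gamma> F (\<gamma> \<otimes>\<^bsub>\<Gamma>\<^esub> y) * complex_of_real (\<nu> (inv\<^bsub>\<Gamma>\<^esub> (\<gamma> \<otimes>\<^bsub>\<Gamma>\<^esub> y) \<otimes>\<^bsub>\<Gamma>\<^esub> x)))"
      by (rule infsum_reindex_bij_betw[OF left_mult_bij, symmetric])
    also have "\<dots> = (\<Sum>\<^sub>\<infinity>y\<in>carrier \<Gamma>. F y * complex_of_real (\<nu> (inv\<^bsub>\<Gamma>\<^esub> y \<otimes>\<^bsub>\<Gamma>\<^esub> (inv\<^bsub>\<Gamma>\<^esub> \<gamma> \<otimes>\<^bsub>\<Gamma>\<^esub> x))))"
      by (rule infsum_cong) (use True \<gamma> in \<open>simp add: left_translate_mult inv_mult_group m_assoc\<close>)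
    finally show ?thesis
      using True \<gamma> by (simp add: right_convolution_def left_translate_def)
  qed (simp add: right_convolution_def left_translate_def)
qed

lemma eigenfunction_left_translate:
  assumes "eigenfunction (carrier \<Gamma>) (right_convolution \<Gamma> \<nu>) c F"
  shows "eigenfunction (carrier \<Gamma>) (right_convolution \<Gamma> \<nu>) c (left_translate \<Gamma> \<gamma> F)"
proof -
  have F: "F \<in> ell2 (carrier \<Gamma>)" "F \<noteq> 0" "right_convolution \<Gamma> \<nu> F = cscale c F"
    using assms by (auto simp: eigenfunction_def)
  obtain x where "F x \<noteq> 0"
    using F(2) by (auto simp: fun_eq_iff)
  then have "x \<in> carrier \<Gamma>"
    using F(1) ell2_outside by metis
  then have "left_translate \<Gamma> \<gamma> F (\<gamma> \<otimes>\<^bsub>\<Gamma>\<^esub> x) \<noteq> 0"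
    using \<open>F x \<noteq> 0\<close> by (simp add: left_translate_mult)
  then have "left_translate \<Gamma> \<gamma> F \<noteq> 0"
    by (metis zero_fun_apply)
  then show ?thesis
    unfolding eigenfunction_def
    by (simp only: left_translate_ell2(1)[OF F(1)] right_convolution_left_translate F(3)
        left_translate_cscale not_False_eq_True simp_thms)
qed

end

section \<open>The bond lamplighter group\<close>

lemma semidirect_product_simps [simp]:
  "carrier (semidirect_product N G act) = carrier N \<times> carrier G"
  "(n, g) \<otimes>\<^bsub>semidirect_product N G act\<^esub> (n', g') = (n \<otimes>\<^bsub>N\<^esub> act g n', g \<otimes>\<^bsub>G\<^esub> g')"
  "\<one>\<^bsub>semidirect_product N G act\<^esub> = (\<one>\<^bsub>N\<^esub>, \<one>\<^bsub>G\<^esub>)"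
  by (auto simp: semidirect_product_def)

lemma group_semidirect_product:
  assumes N: "Group.group N" and G: "Group.group G"
    and hom: "\<And>g. g \<in> carrier G \<Longrightarrow> act g \<in> hom N N"
    and act_one: "\<And>n. n \<in> carrier N \<Longrightarrow> act \<one>\<^bsub>G\<^esub> n = n"
    and act_mult: "\<And>g g' n. g \<in> carrier G \<Longrightarrow> g' \<in> carrier G \<Longrightarrow> n \<in> carrier N \<Longrightarrow>
      act (g \<otimes>\<^bsub>G\<^esub> g') n = act g (act g' n)"
  shows "Group.group (semidirect_product N G act)"
proof -
  interpret N: group N by (rule N)
  interpret G: group G by (rule G)
  have act_closed: "act g n \<in> carrier N" if "g \<in> carrier G" "n \<in> carrier N" for g n
    using hom[OF that(1)] that(2) by (rule hom_in_carrier)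
  have act_prod: "act g (n \<otimes>\<^bsub>N\<^esub> n') = act g n \<otimes>\<^bsub>N\<^esub> act g n'"
    if "g \<in> carrier G" "n \<in> carrier N" "n' \<in> carrier N" for g n n'
    using hom[OF that(1)] that(2,3) by (rule hom_mult)
  have act_unit: "act g \<one>\<^bsub>N\<^esub> = \<one>\<^bsub>N\<^esub>" if "g \<in> carrier G" for g
    using hom_one[OF hom[OF that] N N] .
  show ?thesis
  proof (rule groupI)
    fix x assume x: "x \<in> carrier (semidirect_product N G act)"
    obtain n g where ng: "x = (n, g)" "n \<in> carrier N" "g \<in> carrier G"
      using x by auto
    let ?y = "(act (inv\<^bsub>G\<^esub> g) (inv\<^bsub>N\<^esub> n), inv\<^bsub>G\<^esub> g)"
    have "?y \<in> carrier (semidirect_product N G act)"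
      using ng by (simp add: act_closed)
    moreover have "?y \<otimes>\<^bsub>semidirect_product N G act\<^esub> x = \<one>\<^bsub>semidirect_product N G act\<^esub>"
      using ng by (simp add: act_prod[symmetric] act_unit)
    ultimately show "\<exists>y\<in>carrier (semidirect_product N G act).
        y \<otimes>\<^bsub>semidirect_product N G act\<^esub> x = \<one>\<^bsub>semidirect_product N G act\<^esub>"
      by blast
  qed (auto simp: act_closed act_one act_mult act_prod N.m_assoc G.m_assoc)
qed

locale bond_lamplighter =
  fixes G :: "('g, 'm) monoid_scheme" and H :: "('h, 'k) monoid_scheme" and \<mu> :: "'g pmf"
  assumes group_G: "Group.group G" and group_H: "Group.group H"
    and finite_H: "finite (carrier H)" and card_H: "card (carrier H) \<ge> 2"
    and S_carrier: "set_pmf \<mu> \<subseteq> carrier G" and finite_S: "finite (set_pmf \<mu>)"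
    and \<mu>_sym: "\<And>g. g \<in> carrier G \<Longrightarrow> pmf \<mu> (inv\<^bsub>G\<^esub> g) = pmf \<mu> g"
    and generate_S: "generate G (set_pmf \<mu>) = carrier G"
begin

sublocale G: group G by (rule group_G)
sublocale H: group H by (rule group_H)

abbreviation S :: "'g set" where "S \<equiv> set_pmf \<mu>"
abbreviation E :: "'g set set" where "E \<equiv> cayley_edges G S"
abbreviation L :: "('g set \<Rightarrow> 'h) set" where "L \<equiv> carrier (sum_group E (\<lambda>_. H))"
abbreviation \<Gamma> :: "(('g set \<Rightarrow> 'h) \<times> 'g) monoid" where "\<Gamma> \<equiv> bd_lamplighter G H S"
abbreviation X :: "(('g set \<Rightarrow> 'h) \<times> 'g) set" where "X \<equiv> carrier \<Gamma>"
abbreviation R :: "(('g set \<Rightarrow> 'h) \<times> 'g \<Rightarrow> complex) \<Rightarrow> ('g set \<Rightarrow> 'h) \<times> 'g \<Rightarrow> complex" where "R \<equiv> R_bd G H \<mu>"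
abbreviation q :: nat where "q \<equiv> card (carrier H)"
abbreviation act :: "'g \<Rightarrow> 'g set \<Rightarrow> 'g set" where "act g \<epsilon> \<equiv> (\<lambda>x. g \<otimes>\<^bsub>G\<^esub> x) ` \<epsilon>"

section \<open>Lamp configurations, edges, and the group acting on them\<close>

lemma L_iff: "\<eta> \<in> L \<longleftrightarrow> \<eta> \<in> E \<rightarrow>\<^sub>E carrier H \<and> finite {\<epsilon> \<in> E. \<eta> \<epsilon> \<noteq> \<one>\<^bsub>H\<^esub>}"
  by (simp add: carrier_sum_group group_H)

lemma S_in [simp]: "s \<in> S \<Longrightarrow> s \<in> carrier G"
  using S_carrier by auto

lemma inv_S [simp]: "g \<in> carrier G \<Longrightarrow> inv\<^bsub>G\<^esub> g \<in> S \<longleftrightarrow> g \<in> S"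
  by (simp add: set_pmf_iff \<mu>_sym)

lemma edge_iff: "\<epsilon> \<in> E \<longleftrightarrow> (\<exists>x s. \<epsilon> = {x, x \<otimes>\<^bsub>G\<^esub> s} \<and> x \<in> carrier G \<and> s \<in> S)"
  by (auto simp: cayley_edges_def)

lemma edgeI: "x \<in> carrier G \<Longrightarrow> s \<in> S \<Longrightarrow> {x, x \<otimes>\<^bsub>G\<^esub> s} \<in> E"
  by (auto simp: edge_iff)

lemma edge_subset: "\<epsilon> \<in> E \<Longrightarrow> \<epsilon> \<subseteq> carrier G"
  by (auto simp: edge_iff)

text \<open>Either endpoint may be the base point in the definition of an edge; symmetry of the
  support makes both readings give the same condition.\<close>

lemma edge_pair_iff:
  assumes "x \<in> carrier G" "y \<in> carrier G"
  shows "{x, y} \<in> E \<longleftrightarrow> inv\<^bsub>G\<^esub> x \<otimes>\<^bsub>G\<^esub> y \<in> S"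
proof
  assume "{x, y} \<in> E"
  then obtain z s where zs: "{x, y} = {z, z \<otimes>\<^bsub>G\<^esub> s}" "z \<in> carrier G" "s \<in> S"
    by (auto simp: edge_iff)
  then consider "x = z" "y = z \<otimes>\<^bsub>G\<^esub> s" | "y = z" "x = z \<otimes>\<^bsub>G\<^esub> s"
    by (auto simp: doubleton_eq_iff)
  then show "inv\<^bsub>G\<^esub> x \<otimes>\<^bsub>G\<^esub> y \<in> S"
    using zs by cases (simp_all add: G.m_assoc[symmetric] G.inv_mult_group G.m_assoc)
next
  assume "inv\<^bsub>G\<^esub> x \<otimes>\<^bsub>G\<^esub> y \<in> S"
  then have "{x, x \<otimes>\<^bsub>G\<^esub> (inv\<^bsub>G\<^esub> x \<otimes>\<^bsub>G\<^esub> y)} \<in> E"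
    by (rule edgeI[OF assms(1)])
  then show "{x, y} \<in> E"
    using assms by (simp add: G.m_assoc[symmetric])
qed

lemma act_edge: "g \<in> carrier G \<Longrightarrow> \<epsilon> \<in> E \<Longrightarrow> act g \<epsilon> \<in> E"
  by (auto simp: edge_iff G.m_assoc[symmetric]) blast

lemma act_mult: "g \<in> carrier G \<Longrightarrow> g' \<in> carrier G \<Longrightarrow> \<epsilon> \<subseteq> carrier G \<Longrightarrow> act g (act g' \<epsilon>) = act (g \<otimes>\<^bsub>G\<^esub> g') \<epsilon>"
  by (force simp: image_image G.m_assoc subset_iff intro!: image_cong)

lemma act_one: "\<epsilon> \<subseteq> carrier G \<Longrightarrow> act \<one>\<^bsub>G\<^esub> \<epsilon> = \<epsilon>"
  by (force simp: subset_iff)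

lemma act_inv: "g \<in> carrier G \<Longrightarrow> \<epsilon> \<subseteq> carrier G \<Longrightarrow> act (inv\<^bsub>G\<^esub> g) (act g \<epsilon>) = \<epsilon>"
  "g \<in> carrier G \<Longrightarrow> \<epsilon> \<subseteq> carrier G \<Longrightarrow> act g (act (inv\<^bsub>G\<^esub> g) \<epsilon>) = \<epsilon>"
  by (simp_all add: act_mult act_one)

lemma lamp_shift_closed:
  assumes "g \<in> carrier G" "\<eta> \<in> L"
  shows "lamp_shift G S g \<eta> \<in> L"
proof -
  have "{\<epsilon> \<in> E. lamp_shift G S g \<eta> \<epsilon> \<noteq> \<one>\<^bsub>H\<^esub>} \<subseteq> act g ` {\<epsilon> \<in> E. \<eta> \<epsilon> \<noteq> \<one>\<^bsub>H\<^esub>}"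
  proof
    fix \<epsilon> assume "\<epsilon> \<in> {\<epsilon> \<in> E. lamp_shift G S g \<eta> \<epsilon> \<noteq> \<one>\<^bsub>H\<^esub>}"
    then have "\<epsilon> \<in> E" "\<eta> (act (inv\<^bsub>G\<^esub> g) \<epsilon>) \<noteq> \<one>\<^bsub>H\<^esub>"
      by (auto simp: lamp_shift_def)
    then show "\<epsilon> \<in> act g ` {\<epsilon> \<in> E. \<eta> \<epsilon> \<noteq> \<one>\<^bsub>H\<^esub>}"
      using assms(1) act_inv(2)[OF assms(1) edge_subset, of \<epsilon>]
      by (intro image_eqI[of _ _ "act (inv\<^bsub>G\<^esub> g) \<epsilon>"]) (auto simp: act_edge)
  qed
  then have "finite {\<epsilon> \<in> E. lamp_shift G S g \<eta> \<epsilon> \<noteq> \<one>\<^bsub>H\<^esub>}"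
    using assms(2) unfolding L_iff by (metis (no_types, lifting) finite_imageI finite_subset)
  moreover have "lamp_shift G S g \<eta> \<in> E \<rightarrow>\<^sub>E carrier H"
    using assms unfolding L_iff lamp_shift_def by (auto intro!: act_edge)
  ultimately show ?thesis
    by (simp add: L_iff)
qed

lemma group_\<Gamma>: "Group.group \<Gamma>"
  unfolding bd_lamplighter_def
proof (rule group_semidirect_product)
  show "lamp_shift G S g \<in> hom (sum_group E (\<lambda>_. H)) (sum_group E (\<lambda>_. H))" if "g \<in> carrier G" for g
    unfolding hom_def
    using lamp_shift_closed that by (auto simp: lamp_shift_def fun_eq_iff restrict_def act_edge)
  show "lamp_shift G S \<one>\<^bsub>G\<^esub> \<eta> = \<eta>" if "\<eta> \<in> L" for \<eta>
  proof
    fix \<epsilon>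
    have "\<eta> \<in> extensional E"
      using that by (simp add: L_iff PiE_iff)
    then show "lamp_shift G S \<one>\<^bsub>G\<^esub> \<eta> \<epsilon> = \<eta> \<epsilon>"
    proof (cases "\<epsilon> \<in> E")
      case True
      then show ?thesis
        by (simp only: lamp_shift_def restrict_apply' G.inv_one act_one edge_subset)
    qed (simp add: lamp_shift_def extensional_def)
  qed
  show "lamp_shift G S (g \<otimes>\<^bsub>G\<^esub> g') \<eta> = lamp_shift G S g (lamp_shift G S g' \<eta>)"
    if "g \<in> carrier G" "g' \<in> carrier G" "\<eta> \<in> L" for g g' \<eta>
  proof
    fix \<epsilon>
    show "lamp_shift G S (g \<otimes>\<^bsub>G\<^esub> g') \<eta> \<epsilon> = lamp_shift G S g (lamp_shift G S g' \<eta>) \<epsilon>"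
    proof (cases "\<epsilon> \<in> E")
      case True
      have "act (inv\<^bsub>G\<^esub> (g \<otimes>\<^bsub>G\<^esub> g')) \<epsilon> = act (inv\<^bsub>G\<^esub> g') (act (inv\<^bsub>G\<^esub> g) \<epsilon>)"
        using that edge_subset[OF True] by (subst act_mult) (simp_all only: G.inv_mult_group G.inv_closed)
      moreover have "act (inv\<^bsub>G\<^esub> g) \<epsilon> \<in> E"
        using that True by (intro act_edge G.inv_closed)
      ultimately show ?thesis
        using True by (simp only: lamp_shift_def restrict_apply')
    qed (simp add: lamp_shift_def)
  qed
qed (simp_all add: group_G group_H)

sublocale \<Gamma>: group \<Gamma> by (rule group_\<Gamma>)

lemma X_eq: "X = L \<times> carrier G"
  by (simp add: bd_lamplighter_def)

text \<open>Left translation by \<open>g\<close> carries the edge from the identity to the increment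
  onto \<open>{g, g'}\<close>, so the support condition on the increment says that the two
  configurations agree off the edge just crossed.\<close>

lemma mu_bd_transition:
  assumes y: "(\<eta>, g) \<in> X" and x: "(\<eta>', g') \<in> X"
  shows "mu_bd G H \<mu> (inv\<^bsub>\<Gamma>\<^esub> (\<eta>, g) \<otimes>\<^bsub>\<Gamma>\<^esub> (\<eta>', g')) =
    (if {g, g'} \<in> E \<and> (\<forall>\<epsilon>\<in>E. \<epsilon> \<noteq> {g, g'} \<longrightarrow> \<eta> \<epsilon> = \<eta>' \<epsilon>) then pmf \<mu> (inv\<^bsub>G\<^esub> g \<otimes>\<^bsub>G\<^esub> g') / q else 0)"
proof -
  obtain \<zeta> k where z: "inv\<^bsub>\<Gamma>\<^esub> (\<eta>, g) \<otimes>\<^bsub>\<Gamma>\<^esub> (\<eta>', g') = (\<zeta>, k)"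
    by (metis surj_pair)
  have zX: "(\<zeta>, k) \<in> X"
    using assms unfolding z[symmetric] by simp
  have "(\<eta>, g) \<otimes>\<^bsub>\<Gamma>\<^esub> (\<zeta>, k) = (\<eta>', g')"
    unfolding z[symmetric] using assms by (simp add: \<Gamma>.m_assoc[symmetric])
  then have \<eta>': "\<eta>' = (\<lambda>\<epsilon>\<in>E. \<eta> \<epsilon> \<otimes>\<^bsub>H\<^esub> lamp_shift G S g \<zeta> \<epsilon>)" and g': "g' = g \<otimes>\<^bsub>G\<^esub> k"
    by (auto simp: bd_lamplighter_def)
  have c: "g \<in> carrier G" "k \<in> carrier G" "\<eta> \<in> L" "\<zeta> \<in> L"
    using y zX by (auto simp: X_eq)
  have k: "k = inv\<^bsub>G\<^esub> g \<otimes>\<^bsub>G\<^esub> g'"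
    using c g' by (simp add: G.m_assoc[symmetric])
  have edge: "act g {\<one>\<^bsub>G\<^esub>, k} = {g, g'}"
    using c g' by simp
  have gg': "{g, g'} \<in> E \<longleftrightarrow> k \<in> S"
    using edge_pair_iff[OF c(1), of g', folded k] G.m_closed[OF c(1,2), folded g'] by blast
  have eq: "\<eta> \<epsilon> = \<eta>' \<epsilon> \<longleftrightarrow> \<zeta> (act (inv\<^bsub>G\<^esub> g) \<epsilon>) = \<one>\<^bsub>H\<^esub>" if "\<epsilon> \<in> E" for \<epsilon>
  proof -
    have "\<eta> \<epsilon> \<in> carrier H" "\<zeta> (act (inv\<^bsub>G\<^esub> g) \<epsilon>) \<in> carrier H"
      using c that act_edge[of "inv\<^bsub>G\<^esub> g" \<epsilon>] unfolding L_iff by auto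
    moreover have "\<eta>' \<epsilon> = \<eta> \<epsilon> \<otimes>\<^bsub>H\<^esub> \<zeta> (act (inv\<^bsub>G\<^esub> g) \<epsilon>)"
      using that by (simp only: \<eta>' lamp_shift_def restrict_apply')
    ultimately show ?thesis
      by (simp only: H.l_cancel_one')
  qed
  have "lamp_support G H S \<zeta> \<subseteq> {{\<one>\<^bsub>G\<^esub>, k}} \<longleftrightarrow> (\<forall>\<epsilon>\<in>E. \<epsilon> \<noteq> {g, g'} \<longrightarrow> \<eta> \<epsilon> = \<eta>' \<epsilon>)"
  proof
    assume l: "lamp_support G H S \<zeta> \<subseteq> {{\<one>\<^bsub>G\<^esub>, k}}"
    show "\<forall>\<epsilon>\<in>E. \<epsilon> \<noteq> {g, g'} \<longrightarrow> \<eta> \<epsilon> = \<eta>' \<epsilon>"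
    proof (intro ballI impI)
      fix \<epsilon> assume \<epsilon>: "\<epsilon> \<in> E" "\<epsilon> \<noteq> {g, g'}"
      then have "act (inv\<^bsub>G\<^esub> g) \<epsilon> \<noteq> {\<one>\<^bsub>G\<^esub>, k}"
        using act_inv(2)[OF c(1) edge_subset[OF \<epsilon>(1)]] edge by metis
      then have "\<zeta> (act (inv\<^bsub>G\<^esub> g) \<epsilon>) = \<one>\<^bsub>H\<^esub>"
        using l act_edge[OF G.inv_closed[OF c(1)] \<epsilon>(1)] unfolding lamp_support_def by blast
      then show "\<eta> \<epsilon> = \<eta>' \<epsilon>"
        using eq[OF \<epsilon>(1)] by simp
    qed
  next
    assume r: "\<forall>\<epsilon>\<in>E. \<epsilon> \<noteq> {g, g'} \<longrightarrow> \<eta> \<epsilon> = \<eta>' \<epsilon>"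
    show "lamp_support G H S \<zeta> \<subseteq> {{\<one>\<^bsub>G\<^esub>, k}}"
    proof (rule subsetI, rule ccontr)
      fix \<epsilon> assume "\<epsilon> \<in> lamp_support G H S \<zeta>" "\<epsilon> \<notin> {{\<one>\<^bsub>G\<^esub>, k}}"
      then have \<epsilon>: "\<epsilon> \<in> E" "\<zeta> \<epsilon> \<noteq> \<one>\<^bsub>H\<^esub>" "\<epsilon> \<noteq> {\<one>\<^bsub>G\<^esub>, k}"
        by (auto simp: lamp_support_def)
      have act_back: "act (inv\<^bsub>G\<^esub> g) (act g \<epsilon>) = \<epsilon>"
        by (rule act_inv(1)[OF c(1) edge_subset[OF \<epsilon>(1)]])
      have "act (inv\<^bsub>G\<^esub> g) {g, g'} = {\<one>\<^bsub>G\<^esub>, k}"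
        using c by (simp add: k)
      then have "act g \<epsilon> \<noteq> {g, g'}"
        using act_back \<epsilon>(3) by metis
      then show False
        using r eq[OF act_edge[OF c(1) \<epsilon>(1)]] act_edge[OF c(1) \<epsilon>(1)] \<epsilon>(2) act_back by metis
    qed
  qed
  then show ?thesis
    unfolding z using gg' k by (simp add: mu_bd_def)
qed

lemma mu_bd_transition_sym:
  assumes "x \<in> X" "y \<in> X"
  shows "mu_bd G H \<mu> (inv\<^bsub>\<Gamma>\<^esub> y \<otimes>\<^bsub>\<Gamma>\<^esub> x) = mu_bd G H \<mu> (inv\<^bsub>\<Gamma>\<^esub> x \<otimes>\<^bsub>\<Gamma>\<^esub> y)"
proof -
  obtain \<eta> g \<eta>' g' where yx: "y = (\<eta>, g)" "x = (\<eta>', g')"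
    by (metis surj_pair)
  have c: "g \<in> carrier G" "g' \<in> carrier G"
    using assms yx by (auto simp: X_eq)
  have "pmf \<mu> (inv\<^bsub>G\<^esub> g \<otimes>\<^bsub>G\<^esub> g') = pmf \<mu> (inv\<^bsub>G\<^esub> g' \<otimes>\<^bsub>G\<^esub> g)"
    using \<mu>_sym[of "inv\<^bsub>G\<^esub> g \<otimes>\<^bsub>G\<^esub> g'"] c by (simp add: G.inv_mult_group)
  moreover have "{g, g'} = {g', g}"
    by auto
  moreover have "(\<forall>\<epsilon>\<in>E. \<epsilon> \<noteq> {g, g'} \<longrightarrow> \<eta> \<epsilon> = \<eta>' \<epsilon>) \<longleftrightarrow> (\<forall>\<epsilon>\<in>E. \<epsilon> \<noteq> {g', g} \<longrightarrow> \<eta>' \<epsilon> = \<eta> \<epsilon>)"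
    unfolding \<open>{g, g'} = {g', g}\<close> by metis
  ultimately show ?thesis
    using mu_bd_transition[of \<eta> g \<eta>' g'] mu_bd_transition[of \<eta>' g' \<eta> g] assms yx by (simp only:)
qed

lemma lamp_update:
  assumes "\<eta> \<in> L" "\<epsilon> \<in> E" "h \<in> carrier H"
  shows "\<eta>(\<epsilon> := h) \<in> L"
proof -
  have "{\<delta> \<in> E. (\<eta>(\<epsilon> := h)) \<delta> \<noteq> \<one>\<^bsub>H\<^esub>} \<subseteq> insert \<epsilon> {\<delta> \<in> E. \<eta> \<delta> \<noteq> \<one>\<^bsub>H\<^esub>}"
    by auto
  then have "finite {\<delta> \<in> E. (\<eta>(\<epsilon> := h)) \<delta> \<noteq> \<one>\<^bsub>H\<^esub>}"
    using assms(1) unfolding L_iff by (meson finite_insert finite_subset)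
  moreover have "\<eta>(\<epsilon> := h) \<in> E \<rightarrow>\<^sub>E carrier H"
    using assms unfolding L_iff by (auto simp: PiE_iff extensional_def)
  ultimately show ?thesis
    by (simp only: L_iff)
qed

text \<open>Right convolution sums over predecessors; as \<mu> is symmetric, these can be indexed by
  the outgoing steps \<open>s\<close> and the previous lamp value \<open>h\<close> at the crossed
  edge. The inner sum with the factor \<open>1 / q\<close> is the average over the lamp at that
  edge.\<close>

lemma R_apply:
  assumes x: "(\<eta>, g) \<in> X"
  shows "R F (\<eta>, g) = (\<Sum>s\<in>S. \<Sum>h\<in>carrier H. F (\<eta>({g, g \<otimes>\<^bsub>G\<^esub> s} := h), g \<otimes>\<^bsub>G\<^esub> s) * complex_of_real (pmf \<mu> s / q))"
proof -
  have c: "\<eta> \<in> L" "g \<in> carrier G"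
    using x by (auto simp: X_eq)
  let ?k = "\<lambda>y. complex_of_real (mu_bd G H \<mu> (inv\<^bsub>\<Gamma>\<^esub> y \<otimes>\<^bsub>\<Gamma>\<^esub> (\<eta>, g)))"
  let ?y = "\<lambda>(s, h). (\<eta>({g, g \<otimes>\<^bsub>G\<^esub> s} := h), g \<otimes>\<^bsub>G\<^esub> s)"
  let ?N = "?y ` (S \<times> carrier H)"
  have inj: "inj_on ?y (S \<times> carrier H)"
  proof (rule inj_onI, clarify)
    fix s h s' h'
    assume s: "s \<in> S" "s' \<in> S" and
      eq: "\<eta>({g, g \<otimes>\<^bsub>G\<^esub> s} := h) = \<eta>({g, g \<otimes>\<^bsub>G\<^esub> s'} := h')" "g \<otimes>\<^bsub>G\<^esub> s = g \<otimes>\<^bsub>G\<^esub> s'"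
    then have "s = s'"
      using c by simp
    with fun_cong[OF eq(1), of "{g, g \<otimes>\<^bsub>G\<^esub> s}"] show "s = s' \<and> h = h'"
      by simp
  qed
  have NX: "?y (s, h) \<in> X" if "s \<in> S" "h \<in> carrier H" for s h
    using that c by (auto simp: X_eq intro!: lamp_update edgeI)
  have zero: "?k y = 0" if y: "y \<in> X - ?N" for y
  proof (rule ccontr)
    obtain \<zeta> k where yk: "y = (\<zeta>, k)"
      by fastforce
    then have ck: "\<zeta> \<in> L" "k \<in> carrier G"
      using y by (auto simp: X_eq)
    assume "?k y \<noteq> 0"
    then have e: "{k, g} \<in> E" "\<forall>\<epsilon>\<in>E. \<epsilon> \<noteq> {k, g} \<longrightarrow> \<zeta> \<epsilon> = \<eta> \<epsilon>"
      using mu_bd_transition[of \<zeta> k \<eta> g] y yk x by (auto split: if_splits)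
    define s where "s = inv\<^bsub>G\<^esub> g \<otimes>\<^bsub>G\<^esub> k"
    have k: "k = g \<otimes>\<^bsub>G\<^esub> s"
      using c ck by (simp add: s_def G.m_assoc[symmetric])
    have "s \<in> S"
      using edge_pair_iff[OF c(2) ck(2)] e(1) by (simp add: s_def insert_commute)
    moreover have "\<zeta> {k, g} \<in> carrier H"
      using ck e(1) unfolding L_iff by auto
    moreover have "\<zeta> = \<eta>({g, k} := \<zeta> {k, g})"
    proof
      fix \<epsilon>
      have "\<zeta> \<epsilon> = \<eta> \<epsilon>" if "\<epsilon> \<noteq> {k, g}"
        using that e(2) c(1) ck(1) unfolding L_iff PiE_iff extensional_def by (cases "\<epsilon> \<in> E") simp_all
      then show "\<zeta> \<epsilon> = (\<eta>({g, k} := \<zeta> {k, g})) \<epsilon>"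
        by (simp add: insert_commute)
    qed
    ultimately have "y \<in> ?N"
      unfolding yk k by (intro image_eqI[of _ _ "(s, \<zeta> {k, g})"]) (simp_all add: k)
    then show False
      using y by simp
  qed
  have ker_at: "?k (?y (s, h)) = complex_of_real (pmf \<mu> s / q)" if "s \<in> S" "h \<in> carrier H" for s h
  proof -
    have e: "{g \<otimes>\<^bsub>G\<^esub> s, g} \<in> E"
      using edgeI[OF c(2) that(1)] by (simp add: insert_commute)
    have i: "inv\<^bsub>G\<^esub> (g \<otimes>\<^bsub>G\<^esub> s) \<otimes>\<^bsub>G\<^esub> g = inv\<^bsub>G\<^esub> s"
      using c that by (simp add: G.inv_mult_group G.m_assoc)
    have "\<eta> \<epsilon> = (\<eta>({g, g \<otimes>\<^bsub>G\<^esub> s} := h)) \<epsilon>" if "\<epsilon> \<noteq> {g \<otimes>\<^bsub>G\<^esub> s, g}" for \<epsilon>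
      using that by (simp add: insert_commute)
    then show ?thesis
      unfolding prod.case mu_bd_transition[OF NX[OF that, unfolded prod.case] x] i \<mu>_sym[OF S_in[OF that(1)]]
      using e by auto
  qed
  have "R F (\<eta>, g) = (\<Sum>\<^sub>\<infinity>y\<in>X. F y * ?k y)"
    using x by (simp add: R_bd_def right_convolution_def)
  also have "\<dots> = (\<Sum>\<^sub>\<infinity>y\<in>?N. F y * ?k y)"
    by (rule infsum_cong_neutral) (use zero NX in auto)
  also have "\<dots> = (\<Sum>y\<in>?N. F y * ?k y)"
    using finite_S finite_H by (intro infsum_finite) auto
  also have "\<dots> = (\<Sum>z\<in>S \<times> carrier H. F (?y z) * ?k (?y z))"
    by (subst sum.reindex[OF inj]) simp
  also have "\<dots> = (\<Sum>(s, h)\<in>S \<times> carrier H. F (?y (s, h)) * complex_of_real (pmf \<mu> s / q))"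
    using ker_at by (intro sum.cong) auto
  finally show ?thesis
    by (simp add: sum.cartesian_product)
qed

end

section \<open>Eigenfunctions from finite subgraphs\<close>

context bond_lamplighter
begin

abbreviation \<iota> :: "'g set \<Rightarrow> 'h" where "\<iota> \<equiv> \<lambda>\<epsilon>\<in>E. \<one>\<^bsub>H\<^esub>"

text \<open>The edges that have to be closed for the open cluster to be the given subgraph.
  Subgraphs need not be induced, so an edge joining two vertices of \<open>V\<close> may belong here
  too.\<close>

definition boundary :: "'g set \<Rightarrow> 'g set set \<Rightarrow> 'g set set" where
  "boundary V D = {\<epsilon> \<in> E. \<epsilon> \<inter> V \<noteq> {} \<and> \<epsilon> \<notin> D}"

abbreviation touching :: "'g set \<Rightarrow> 'g set set \<Rightarrow> 'g set set" where
  "touching V D \<equiv> D \<union> boundary V D"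

text \<open>
  On \<open>\<ell>\<^sup>2(H)\<close> the point mass at the identity is the sum of the constant \<open>1 / q\<close> and its mean-zero
  part. An edge in \<open>D\<close> carries the former, a boundary edge the latter, any other edge the point mass.
\<close>

definition lamp_weight :: "'g set \<Rightarrow> 'g set set \<Rightarrow> 'g set \<Rightarrow> 'h \<Rightarrow> real" where
  "lamp_weight V D \<epsilon> h =
     (if \<epsilon> \<in> D then 1 / q else (if h = \<one>\<^bsub>H\<^esub> then 1 else 0) - (if \<epsilon> \<in> boundary V D then 1 / q else 0))"

text \<open>Formally the product of the weights over all edges. Omitting the factors equal to 1
  leaves a finite product when the subgraph is finite and the configuration finitely
  supported.\<close>

definition lamp_fun :: "'g set \<Rightarrow> 'g set set \<Rightarrow> ('g set \<Rightarrow> 'h) \<Rightarrow> real" where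
  "lamp_fun V D \<eta> =
     (if \<eta> \<in> L then \<Prod>\<epsilon>\<in>{\<epsilon> \<in> E. lamp_weight V D \<epsilon> (\<eta> \<epsilon>) \<noteq> 1}. lamp_weight V D \<epsilon> (\<eta> \<epsilon>) else 0)"

definition lift :: "'g set \<Rightarrow> 'g set set \<Rightarrow> ('g \<Rightarrow> complex) \<Rightarrow> ('g set \<Rightarrow> 'h) \<times> 'g \<Rightarrow> complex" where
  "lift V D f = (\<lambda>(\<eta>, g). complex_of_real (lamp_fun V D \<eta>) * f g)"

lemma q_pos: "q > 0"
  using card_H by simp

lemma iota_L: "\<iota> \<in> L"
  by (simp add: L_iff)

lemma finite_lamps: "finite {\<epsilon> \<in> E. \<eta> \<epsilon> \<noteq> \<one>\<^bsub>H\<^esub>}" if "\<eta> \<in> L"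
  using that by (simp add: L_iff)

lemma bd_subgraphsD:
  assumes "(V, D) \<in> bd_subgraphs G S"
  shows "finite V" "V \<subseteq> carrier G" "\<one>\<^bsub>G\<^esub> \<in> V" "D \<subseteq> E" "\<And>\<epsilon>. \<epsilon> \<in> D \<Longrightarrow> \<epsilon> \<subseteq> V"
    "\<And>x y. x \<in> V \<Longrightarrow> y \<in> V \<Longrightarrow> (x, y) \<in> edge_reachable D"
  using assms unfolding bd_subgraphs_def by blast+

lemma finite_edges_meeting:
  assumes "finite V" "V \<subseteq> carrier G"
  shows "finite {\<epsilon> \<in> E. \<epsilon> \<inter> V \<noteq> {}}"
proof (rule finite_subset)
  show "{\<epsilon> \<in> E. \<epsilon> \<inter> V \<noteq> {}} \<subseteq> (\<lambda>(x, s). {x, x \<otimes>\<^bsub>G\<^esub> s}) ` (V \<times> S)"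
  proof
    fix \<epsilon> assume \<epsilon>: "\<epsilon> \<in> {\<epsilon> \<in> E. \<epsilon> \<inter> V \<noteq> {}}"
    then obtain x s where xs: "\<epsilon> = {x, x \<otimes>\<^bsub>G\<^esub> s}" "x \<in> carrier G" "s \<in> S" "\<epsilon> \<inter> V \<noteq> {}"
      by (auto simp: edge_iff)
    then consider "x \<in> V" | "x \<otimes>\<^bsub>G\<^esub> s \<in> V"
      by blast
    then show "\<epsilon> \<in> (\<lambda>(x, s). {x, x \<otimes>\<^bsub>G\<^esub> s}) ` (V \<times> S)"
    proof cases
      case 1
      then show ?thesis
        using xs by (intro image_eqI[of _ _ "(x, s)"]) auto
    next
      case 2
      have "x \<otimes>\<^bsub>G\<^esub> s \<otimes>\<^bsub>G\<^esub> inv\<^bsub>G\<^esub> s = x"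
        using xs by (simp add: G.m_assoc)
      with 2 show ?thesis
        using xs by (intro image_eqI[of _ _ "(x \<otimes>\<^bsub>G\<^esub> s, inv\<^bsub>G\<^esub> s)"]) auto
    qed
  qed
  show "finite ((\<lambda>(x, s). {x, x \<otimes>\<^bsub>G\<^esub> s}) ` (V \<times> S))"
    using assms finite_S by auto
qed

lemma touching_eq:
  assumes "(V, D) \<in> bd_subgraphs G S"
  shows "touching V D = {\<epsilon> \<in> E. \<epsilon> \<inter> V \<noteq> {}}"
proof -
  have "\<epsilon> \<inter> V \<noteq> {}" if "\<epsilon> \<in> D" for \<epsilon>
    using bd_subgraphsD(4,5)[OF assms] that edge_iff[of \<epsilon>] by blast
  then show ?thesis
    using bd_subgraphsD(4)[OF assms] by (auto simp: boundary_def)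
qed

lemma finite_touching:
  assumes "(V, D) \<in> bd_subgraphs G S"
  shows "finite (touching V D)" "touching V D \<subseteq> E"
  unfolding touching_eq[OF assms] using finite_edges_meeting bd_subgraphsD(1,2)[OF assms] by auto

lemma lamp_weight_off: "\<epsilon> \<notin> touching V D \<Longrightarrow> lamp_weight V D \<epsilon> h = (if h = \<one>\<^bsub>H\<^esub> then 1 else 0)"
  by (simp add: lamp_weight_def)

text \<open>Factors outside \<open>K\<close> are 1. The choice of \<open>K\<close> is left free so
  that products for different subgraphs or different configurations can be taken over a common index
  set.\<close>

lemma lamp_fun_eq_prod:
  assumes "(V, D) \<in> bd_subgraphs G S" "\<eta> \<in> L" "finite K" "touching V D \<subseteq> K" "K \<subseteq> E"
    "\<And>\<epsilon>. \<epsilon> \<in> E - K \<Longrightarrow> \<eta> \<epsilon> = \<one>\<^bsub>H\<^esub>"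
  shows "lamp_fun V D \<eta> = (\<Prod>\<epsilon>\<in>K. lamp_weight V D \<epsilon> (\<eta> \<epsilon>))"
proof -
  have "{\<epsilon> \<in> E. lamp_weight V D \<epsilon> (\<eta> \<epsilon>) \<noteq> 1} \<subseteq> K"
  proof (rule subsetI, rule ccontr)
    fix \<epsilon> assume "\<epsilon> \<in> {\<epsilon> \<in> E. lamp_weight V D \<epsilon> (\<eta> \<epsilon>) \<noteq> 1}" "\<epsilon> \<notin> K"
    then have "\<eta> \<epsilon> = \<one>\<^bsub>H\<^esub>" "\<epsilon> \<notin> touching V D" "lamp_weight V D \<epsilon> (\<eta> \<epsilon>) \<noteq> 1"
      using assms(4,6) by blast+
    then show False
      using lamp_weight_off[where V = V and D = D and \<epsilon> = \<epsilon> and h = "\<eta> \<epsilon>"] by simp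
  qed
  then show ?thesis
    unfolding lamp_fun_def if_P[OF assms(2)] using assms(3,5)
    by (intro prod.mono_neutral_left) auto
qed

lemma lamp_fun_support:
  assumes A: "(V, D) \<in> bd_subgraphs G S" and \<eta>: "lamp_fun V D \<eta> \<noteq> 0" and \<epsilon>: "\<epsilon> \<in> E - touching V D"
  shows "\<eta> \<epsilon> = \<one>\<^bsub>H\<^esub>"
proof (rule ccontr)
  assume ne: "\<eta> \<epsilon> \<noteq> \<one>\<^bsub>H\<^esub>"
  have \<eta>L: "\<eta> \<in> L"
    using \<eta> by (auto simp: lamp_fun_def split: if_splits)
  let ?K = "touching V D \<union> {\<epsilon> \<in> E. \<eta> \<epsilon> \<noteq> \<one>\<^bsub>H\<^esub>}"
  have K: "finite ?K" "?K \<subseteq> E"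
    using finite_touching[OF A] finite_lamps[OF \<eta>L] by auto
  have "lamp_weight V D \<epsilon> (\<eta> \<epsilon>) = 0"
    using ne \<epsilon> lamp_weight_off[where V = V and D = D and \<epsilon> = \<epsilon> and h = "\<eta> \<epsilon>"] by auto
  moreover have "\<epsilon> \<in> ?K"
    using ne \<epsilon> by auto
  ultimately have "(\<Prod>\<epsilon>\<in>?K. lamp_weight V D \<epsilon> (\<eta> \<epsilon>)) = 0"
    using K(1) by (intro prod_zero) blast+
  moreover have "lamp_fun V D \<eta> = (\<Prod>\<epsilon>\<in>?K. lamp_weight V D \<epsilon> (\<eta> \<epsilon>))"
    by (rule lamp_fun_eq_prod[OF A \<eta>L K(1) Un_upper1 K(2)]) blast
  ultimately show False
    using \<eta> by (simp only:)
qed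

lemma lamp_weight_sum:
  assumes "(V, D) \<in> bd_subgraphs G S"
  shows "\<epsilon> \<in> D \<Longrightarrow> (\<Sum>h\<in>carrier H. lamp_weight V D \<epsilon> h) = 1"
    and "\<epsilon> \<in> boundary V D \<Longrightarrow> (\<Sum>h\<in>carrier H. lamp_weight V D \<epsilon> h) = 0"
proof -
  show "\<epsilon> \<in> D \<Longrightarrow> (\<Sum>h\<in>carrier H. lamp_weight V D \<epsilon> h) = 1"
    using q_pos by (simp add: lamp_weight_def)
  show "(\<Sum>h\<in>carrier H. lamp_weight V D \<epsilon> h) = 0" if b: "\<epsilon> \<in> boundary V D"
  proof -
    have "\<epsilon> \<notin> D"
      using b by (simp add: boundary_def)
    then have "(\<Sum>h\<in>carrier H. lamp_weight V D \<epsilon> h) =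
        (\<Sum>h\<in>carrier H. (if h = \<one>\<^bsub>H\<^esub> then 1 else 0)) - (\<Sum>h\<in>carrier H. 1 / real q)"
      using b by (simp only: lamp_weight_def if_False if_True sum_subtractf)
    also have "\<dots> = 0"
      using q_pos finite_H H.one_closed by auto
    finally show ?thesis .
  qed
qed

text \<open>Changing the lamp at \<epsilon> affects a single factor of the product, so averaging
  acts on that factor alone: a constant is fixed, a mean-zero function is killed.\<close>

lemma lamp_fun_average:
  assumes A: "(V, D) \<in> bd_subgraphs G S" and \<eta>: "\<eta> \<in> L"
  shows "\<epsilon> \<in> D \<Longrightarrow> (\<Sum>h\<in>carrier H. lamp_fun V D (\<eta>(\<epsilon> := h))) / q = lamp_fun V D \<eta>"
    and "\<epsilon> \<in> boundary V D \<Longrightarrow> (\<Sum>h\<in>carrier H. lamp_fun V D (\<eta>(\<epsilon> := h))) = 0"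
proof -
  let ?K = "touching V D \<union> {\<epsilon> \<in> E. \<eta> \<epsilon> \<noteq> \<one>\<^bsub>H\<^esub>}"
  let ?P = "\<lambda>\<epsilon>. \<Prod>\<delta>\<in>?K - {\<epsilon>}. lamp_weight V D \<delta> (\<eta> \<delta>)"
  have K: "finite ?K" "?K \<subseteq> E"
    using finite_touching[OF A] finite_lamps[OF \<eta>] by auto
  have split: "lamp_fun V D (\<eta>(\<epsilon> := h)) = lamp_weight V D \<epsilon> h * ?P \<epsilon>" if "\<epsilon> \<in> touching V D" "h \<in> carrier H" for \<epsilon> h
  proof -
    have "\<epsilon> \<in> E"
      using that K(2) by auto
    then have "lamp_fun V D (\<eta>(\<epsilon> := h)) = (\<Prod>\<delta>\<in>?K. lamp_weight V D \<delta> ((\<eta>(\<epsilon> := h)) \<delta>))"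
      using that K by (intro lamp_fun_eq_prod[OF A lamp_update[OF \<eta>]]) auto
    also have "\<dots> = lamp_weight V D \<epsilon> h * (\<Prod>\<delta>\<in>?K - {\<epsilon>}. lamp_weight V D \<delta> ((\<eta>(\<epsilon> := h)) \<delta>))"
      using that K by (subst prod.remove[of ?K \<epsilon>]) auto
    also have "(\<Prod>\<delta>\<in>?K - {\<epsilon>}. lamp_weight V D \<delta> ((\<eta>(\<epsilon> := h)) \<delta>)) = ?P \<epsilon>"
      by (intro prod.cong) auto
    finally show ?thesis .
  qed
  have sum: "(\<Sum>h\<in>carrier H. lamp_fun V D (\<eta>(\<epsilon> := h))) = (\<Sum>h\<in>carrier H. lamp_weight V D \<epsilon> h) * ?P \<epsilon>"
    if "\<epsilon> \<in> touching V D" for \<epsilon>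
    using split[OF that] by (simp add: sum_distrib_right)
  show "(\<Sum>h\<in>carrier H. lamp_fun V D (\<eta>(\<epsilon> := h))) / q = lamp_fun V D \<eta>" if "\<epsilon> \<in> D"
  proof -
    have "\<epsilon> \<in> E"
      using that bd_subgraphsD(4)[OF A] by auto
    then have "\<eta> \<epsilon> \<in> carrier H"
      using \<eta> by (auto simp: L_iff)
    then have "lamp_fun V D \<eta> = lamp_weight V D \<epsilon> (\<eta> \<epsilon>) * ?P \<epsilon>"
      using split[of \<epsilon> "\<eta> \<epsilon>"] that by simp
    moreover have "lamp_weight V D \<epsilon> (\<eta> \<epsilon>) = 1 / q"
      using that by (simp add: lamp_weight_def)
    ultimately show ?thesis
      using sum[of \<epsilon>] lamp_weight_sum(1)[OF A that] that by simp
  qed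
  show "(\<Sum>h\<in>carrier H. lamp_fun V D (\<eta>(\<epsilon> := h))) = 0" if "\<epsilon> \<in> boundary V D"
    using sum[of \<epsilon>] lamp_weight_sum(2)[OF A that] that by simp
qed

text \<open>
  Averaging over the lamp at an edge fixes \<open>lamp_fun V D\<close> if the edge lies in \<open>D\<close> and kills it if the
  edge is a boundary edge, so the walker never leaves the subgraph.
\<close>

lemma R_lift:
  assumes A: "(V, D) \<in> bd_subgraphs G S" and f: "\<And>x. x \<notin> V \<Longrightarrow> f x = 0"
  shows "R (lift V D f) = lift V D (matrix_apply V (subgraph_matrix G \<mu> D) f)"
proof
  fix x :: "('g set \<Rightarrow> 'h) \<times> 'g"
  obtain \<eta> g where x: "x = (\<eta>, g)"
    by (metis surj_pair)
  note VD = bd_subgraphsD[OF A]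
  show "R (lift V D f) x = lift V D (matrix_apply V (subgraph_matrix G \<mu> D) f) x"
  proof (cases "x \<in> X")
    case False
    then have "\<eta> \<notin> L \<or> g \<notin> V"
      using VD(2) by (auto simp: x X_eq)
    then show ?thesis
      using False by (auto simp: x R_bd_def right_convolution_def lift_def lamp_fun_def matrix_apply_def)
  next
    case True
    then have c: "\<eta> \<in> L" "g \<in> carrier G"
      by (auto simp: x X_eq)
    let ?t = "\<lambda>y. if {g, y} \<in> D then complex_of_real (pmf \<mu> (inv\<^bsub>G\<^esub> g \<otimes>\<^bsub>G\<^esub> y)) * f y else 0"
    have inner: "(\<Sum>h\<in>carrier H. lift V D f (\<eta>({g, g \<otimes>\<^bsub>G\<^esub> s} := h), g \<otimes>\<^bsub>G\<^esub> s) * complex_of_real (pmf \<mu> s / q)) =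
        complex_of_real (lamp_fun V D \<eta>) * ?t (g \<otimes>\<^bsub>G\<^esub> s)" if s: "s \<in> S" for s
    proof -
      let ?\<epsilon> = "{g, g \<otimes>\<^bsub>G\<^esub> s}"
      let ?a = "\<Sum>h\<in>carrier H. lamp_fun V D (\<eta>(?\<epsilon> := h))"
      have E: "?\<epsilon> \<in> E"
        using c s by (intro edgeI)
      have s': "inv\<^bsub>G\<^esub> g \<otimes>\<^bsub>G\<^esub> (g \<otimes>\<^bsub>G\<^esub> s) = s"
        using c s by (simp add: G.m_assoc[symmetric])
      have "(\<Sum>h\<in>carrier H. lift V D f (\<eta>(?\<epsilon> := h), g \<otimes>\<^bsub>G\<^esub> s) * complex_of_real (pmf \<mu> s / q)) =
          complex_of_real (?a / q) * (complex_of_real (pmf \<mu> s) * f (g \<otimes>\<^bsub>G\<^esub> s))"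
        by (simp add: lift_def sum_distrib_left sum_divide_distrib mult_ac)
      also have "\<dots> = complex_of_real (lamp_fun V D \<eta>) * ?t (g \<otimes>\<^bsub>G\<^esub> s)"
      proof (cases "?\<epsilon> \<in> D")
        case True
        then show ?thesis
          unfolding lamp_fun_average(1)[OF A c(1) True] s' by simp
      next
        case False
        \<comment> \<open>An edge outside \<open>D\<close> either ends outside \<open>V\<close>,
          where \<open>f\<close> vanishes, or is a boundary edge, where the average
          vanishes.\<close>
        have "f (g \<otimes>\<^bsub>G\<^esub> s) = 0 \<or> ?a = 0"
          using False E f[of "g \<otimes>\<^bsub>G\<^esub> s"] lamp_fun_average(2)[OF A c(1), of ?\<epsilon>]
          by (auto simp: boundary_def)
        then have "complex_of_real (?a / q) * (complex_of_real (pmf \<mu> s) * f (g \<otimes>\<^bsub>G\<^esub> s)) = 0"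
          by (elim disjE) (simp_all only: div_0 of_real_0 mult_zero_left mult_zero_right)
        then show ?thesis
          using False by simp
      qed
      finally show ?thesis .
    qed
    have "R (lift V D f) x = (\<Sum>s\<in>S. complex_of_real (lamp_fun V D \<eta>) * ?t (g \<otimes>\<^bsub>G\<^esub> s))"
      unfolding x R_apply[OF True[unfolded x]] using inner by (intro sum.cong) auto
    also have "\<dots> = complex_of_real (lamp_fun V D \<eta>) * (\<Sum>s\<in>S. ?t (g \<otimes>\<^bsub>G\<^esub> s))"
      by (simp only: sum_distrib_left)
    also have "(\<Sum>s\<in>S. ?t (g \<otimes>\<^bsub>G\<^esub> s)) = (\<Sum>y\<in>(\<lambda>s. g \<otimes>\<^bsub>G\<^esub> s) ` S. ?t y)"
      using c by (subst sum.reindex) (auto intro!: inj_onI)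
    also have "\<dots> = (\<Sum>y\<in>V \<inter> (\<lambda>s. g \<otimes>\<^bsub>G\<^esub> s) ` S. ?t y)"
      using finite_S VD(5) by (intro sum.mono_neutral_right) auto
    \<comment> \<open>The vertices of \<open>V\<close> added here are not neighbours of
      \<open>g\<close>, so the edge to them is missing from \<open>D\<close> and their terms are
      0.\<close>
    also have "\<dots> = (\<Sum>y\<in>V. ?t y)"
    proof (intro sum.mono_neutral_left ballI)
      fix y assume y: "y \<in> V - V \<inter> (\<lambda>s. g \<otimes>\<^bsub>G\<^esub> s) ` S"
      have "{g, y} \<notin> D"
      proof
        assume "{g, y} \<in> D"
        then have "inv\<^bsub>G\<^esub> g \<otimes>\<^bsub>G\<^esub> y \<in> S"
          using edge_pair_iff[of g y] c y VD(2,4) by auto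
        moreover have "y = g \<otimes>\<^bsub>G\<^esub> (inv\<^bsub>G\<^esub> g \<otimes>\<^bsub>G\<^esub> y)"
          using c y VD(2) by (auto simp: G.m_assoc[symmetric])
        ultimately show False
          using y by blast
      qed
      then show "?t y = 0"
        by simp
    qed (use VD(1) in auto)
    also have "\<dots> = matrix_apply V (subgraph_matrix G \<mu> D) f g"
    proof (cases "g \<in> V")
      case True
      then show ?thesis
        unfolding matrix_apply_def if_P[OF True]
        by (intro sum.cong) (auto simp: subgraph_matrix_def)
    next
      case False
      then have "{g, y} \<notin> D" for y
        using VD(5)[of "{g, y}"] by auto
      then show ?thesis
        using False by (simp add: matrix_apply_def)
    qed
    finally show ?thesis
      by (simp add: x lift_def)
  qed
qed

lemma subgraph_matrix_sym:
  assumes "x \<in> carrier G" "y \<in> carrier G"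
  shows "subgraph_matrix G \<mu> D x y = subgraph_matrix G \<mu> D y x"
proof -
  have "pmf \<mu> (inv\<^bsub>G\<^esub> x \<otimes>\<^bsub>G\<^esub> y) = pmf \<mu> (inv\<^bsub>G\<^esub> y \<otimes>\<^bsub>G\<^esub> x)"
    using \<mu>_sym[of "inv\<^bsub>G\<^esub> x \<otimes>\<^bsub>G\<^esub> y"] assms by (simp add: G.inv_mult_group)
  then show ?thesis
    by (simp add: subgraph_matrix_def insert_commute)
qed

text \<open>A finite window when \<open>K\<close> is finite; sums over it replace inner products
  over all of \<open>L\<close>, since every function in play vanishes off such a window.\<close>

definition lamps_on :: "'g set set \<Rightarrow> ('g set \<Rightarrow> 'h) set" where
  "lamps_on K = {\<eta> \<in> L. \<forall>\<epsilon>\<in>E - K. \<eta> \<epsilon> = \<one>\<^bsub>H\<^esub>}"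

lemma lamps_on_bij:
  assumes "finite K" "K \<subseteq> E"
  shows "bij_betw (\<lambda>u. \<lambda>\<epsilon>\<in>E. if \<epsilon> \<in> K then u \<epsilon> else \<one>\<^bsub>H\<^esub>) (K \<rightarrow>\<^sub>E carrier H) (lamps_on K)"
proof (rule bij_betw_byWitness[where f' = "\<lambda>\<eta>. restrict \<eta> K"])
  show "\<forall>u\<in>K \<rightarrow>\<^sub>E carrier H. restrict (\<lambda>\<epsilon>\<in>E. if \<epsilon> \<in> K then u \<epsilon> else \<one>\<^bsub>H\<^esub>) K = u"
    using assms by (auto simp: fun_eq_iff restrict_def PiE_iff extensional_def)
  show "\<forall>\<eta>\<in>lamps_on K. (\<lambda>\<epsilon>\<in>E. if \<epsilon> \<in> K then restrict \<eta> K \<epsilon> else \<one>\<^bsub>H\<^esub>) = \<eta>"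
    unfolding lamps_on_def L_iff
    using assms by (auto simp: fun_eq_iff restrict_def PiE_iff extensional_def)
  show "(\<lambda>u. \<lambda>\<epsilon>\<in>E. if \<epsilon> \<in> K then u \<epsilon> else \<one>\<^bsub>H\<^esub>) ` (K \<rightarrow>\<^sub>E carrier H) \<subseteq> lamps_on K"
  proof (rule image_subsetI)
    fix u assume u: "u \<in> K \<rightarrow>\<^sub>E carrier H"
    let ?\<eta> = "\<lambda>\<epsilon>\<in>E. if \<epsilon> \<in> K then u \<epsilon> else \<one>\<^bsub>H\<^esub>"
    have "finite {\<epsilon> \<in> E. ?\<eta> \<epsilon> \<noteq> \<one>\<^bsub>H\<^esub>}"
      by (rule finite_subset[OF _ assms(1)]) (auto split: if_splits)
    then show "?\<eta> \<in> lamps_on K"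
      using u unfolding lamps_on_def L_iff by (auto simp: PiE_iff)
  qed
  show "(\<lambda>\<eta>. restrict \<eta> K) ` lamps_on K \<subseteq> K \<rightarrow>\<^sub>E carrier H"
    unfolding lamps_on_def L_iff using assms by (auto simp: PiE_iff)
qed

lemma finite_lamps_on: "finite K \<Longrightarrow> K \<subseteq> E \<Longrightarrow> finite (lamps_on K)"
  using bij_betw_finite[OF lamps_on_bij] finite_H by (auto intro: finite_PiE)

text \<open>Distributivity. It turns inner products of product functions into products of inner
  products on the single group \<open>H\<close>.\<close>

lemma sum_lamps_on:
  fixes f :: "'g set \<Rightarrow> 'h \<Rightarrow> real"
  assumes "finite K" "K \<subseteq> E"
  shows "(\<Sum>\<eta>\<in>lamps_on K. \<Prod>\<epsilon>\<in>K. f \<epsilon> (\<eta> \<epsilon>)) = (\<Prod>\<epsilon>\<in>K. \<Sum>h\<in>carrier H. f \<epsilon> h)"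
proof -
  have "(\<Sum>\<eta>\<in>lamps_on K. \<Prod>\<epsilon>\<in>K. f \<epsilon> (\<eta> \<epsilon>)) =
      (\<Sum>u\<in>K \<rightarrow>\<^sub>E carrier H. \<Prod>\<epsilon>\<in>K. f \<epsilon> ((\<lambda>\<epsilon>\<in>E. if \<epsilon> \<in> K then u \<epsilon> else \<one>\<^bsub>H\<^esub>) \<epsilon>))"
    by (rule sum.reindex_bij_betw[OF lamps_on_bij[OF assms], symmetric])
  also have "\<dots> = (\<Sum>u\<in>K \<rightarrow>\<^sub>E carrier H. \<Prod>\<epsilon>\<in>K. f \<epsilon> (u \<epsilon>))"
    using assms by (intro sum.cong prod.cong) auto
  also have "\<dots> = (\<Prod>\<epsilon>\<in>K. \<Sum>h\<in>carrier H. f \<epsilon> h)"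
    using assms finite_H by (subst prod_sum_PiE) auto
  finally show ?thesis .
qed

lemma lamp_fun_support_lamps_on:
  assumes "(V, D) \<in> bd_subgraphs G S" "touching V D \<subseteq> K" "\<eta> \<notin> lamps_on K"
  shows "lamp_fun V D \<eta> = 0"
proof (rule ccontr)
  assume ne: "lamp_fun V D \<eta> \<noteq> 0"
  then have "\<eta> \<in> L"
    by (auto simp: lamp_fun_def split: if_splits)
  moreover have "\<eta> \<epsilon> = \<one>\<^bsub>H\<^esub>" if "\<epsilon> \<in> E - K" for \<epsilon>
    using lamp_fun_support[OF assms(1) ne] that assms(2) by blast
  ultimately show False
    using assms(3) by (auto simp: lamps_on_def)
qed

lemma lift_outside:
  assumes "(V, D) \<in> bd_subgraphs G S" "\<And>x. x \<notin> V \<Longrightarrow> f x = 0"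
  shows "z \<notin> lamps_on (touching V D) \<times> V \<Longrightarrow> lift V D f z = 0"
  using assms lamp_fun_support_lamps_on[OF assms(1) subset_refl] by (cases z) (auto simp: lift_def)

lemma lift_support_subset_X:
  assumes "(V, D) \<in> bd_subgraphs G S"
  shows "lamps_on (touching V D) \<times> V \<subseteq> X" "finite (lamps_on (touching V D) \<times> V)"
  using bd_subgraphsD(1,2)[OF assms] finite_lamps_on[OF finite_touching[OF assms]]
  by (auto simp: X_eq lamps_on_def)

text \<open>In percolation with parameter \<open>1 / q\<close> this is the probability that all
  edges of \<open>D\<close> are open and all boundary edges closed, as
  \<open>percolation_cluster_event\<close> confirms.\<close>

lemma lamp_fun_iota:
  assumes A: "(V, D) \<in> bd_subgraphs G S"
  shows "lamp_fun V D \<iota> = (1 / q) ^ card D * (1 - 1 / q) ^ card (boundary V D)"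
proof -
  note T = finite_touching[OF A]
  have "lamp_fun V D \<iota> = (\<Prod>\<epsilon>\<in>touching V D. lamp_weight V D \<epsilon> (\<iota> \<epsilon>))"
    using T by (intro lamp_fun_eq_prod[OF A iota_L]) auto
  also have "\<dots> = (\<Prod>\<epsilon>\<in>D. lamp_weight V D \<epsilon> (\<iota> \<epsilon>)) * (\<Prod>\<epsilon>\<in>boundary V D. lamp_weight V D \<epsilon> (\<iota> \<epsilon>))"
    using T by (intro prod.union_disjoint) (auto simp: boundary_def)
  also have "(\<Prod>\<epsilon>\<in>D. lamp_weight V D \<epsilon> (\<iota> \<epsilon>)) = (\<Prod>\<epsilon>\<in>D. 1 / q)"
    by (intro prod.cong) (auto simp: lamp_weight_def)
  also have "(\<Prod>\<epsilon>\<in>boundary V D. lamp_weight V D \<epsilon> (\<iota> \<epsilon>)) = (\<Prod>\<epsilon>\<in>boundary V D. 1 - 1 / q)"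
    by (intro prod.cong) (auto simp: lamp_weight_def boundary_def)
  finally show ?thesis
    by (simp only: prod_constant)
qed

text \<open>Both \<open>1 / q\<close> and \<open>1 - 1 / q\<close> are positive because
  \<open>H\<close> has at least two elements. Hence the lift of a nonzero vector is nonzero.\<close>

lemma lamp_fun_iota_pos:
  assumes "(V, D) \<in> bd_subgraphs G S"
  shows "lamp_fun V D \<iota> > 0"
  unfolding lamp_fun_iota[OF assms] using card_H by (intro mult_pos_pos zero_less_power) auto

lemma lift_eigenfunction:
  assumes A: "(V, D) \<in> bd_subgraphs G S" and f: "\<And>x. x \<notin> V \<Longrightarrow> f x = 0" "f \<noteq> 0"
    and eig: "matrix_apply V (subgraph_matrix G \<mu> D) f = cscale c f"
  shows "eigenfunction X R c (lift V D f)" "finite_support (lift V D f)"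
proof -
  note sup = lift_support_subset_X[OF A] lift_outside[where f = f, OF A f(1)]
  show "finite_support (lift V D f)"
    unfolding finite_support_def by (rule finite_subset[OF _ sup(2)]) (use sup(3) in blast)
  have "lift V D f \<in> ell2 X"
    by (rule ell2_finite(1)[OF sup(2,1,3)])
  moreover obtain x where "f x \<noteq> 0"
    using f(2) by (auto simp: fun_eq_iff)
  then have "lift V D f (\<iota>, x) \<noteq> 0"
    using lamp_fun_iota_pos[OF A] by (simp add: lift_def)
  then have "lift V D f \<noteq> 0"
    by (metis zero_fun_apply)
  moreover have "R (lift V D f) = lift V D (cscale c f)"
    using R_lift[OF A, of f] f(1) unfolding eig by blast
  then have "R (lift V D f) = cscale c (lift V D f)"
    by (simp only:) (auto simp: lift_def cscale_def fun_eq_iff)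
  ultimately show "eigenfunction X R c (lift V D f)"
    by (simp only: eigenfunction_def simp_thms)
qed

lemma matrix_eigenvalue_Lambda:
  assumes A: "(V, D) \<in> bd_subgraphs G S" and f: "\<And>x. x \<notin> V \<Longrightarrow> f x = 0" "f \<noteq> 0"
    and eig: "matrix_apply V (subgraph_matrix G \<mu> D) f = cscale c f"
  shows "c \<in> Lambda_bd G \<mu>"
proof -
  obtain x where "f x \<noteq> 0"
    using f(2) by (auto simp: fun_eq_iff)
  then have "\<exists>x\<in>V. f x \<noteq> 0"
    using f(1) by auto
  moreover have "(\<Sum>y\<in>V. complex_of_real (subgraph_matrix G \<mu> D x y) * f y) = c * f x" if "x \<in> V" for x
    using fun_cong[OF eig, of x] that by (simp add: matrix_apply_def cscale_def)
  ultimately show ?thesis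
    using A unfolding Lambda_bd_def matrix_spectrum_def by blast
qed

lemma Lambda_eigenfunction:
  assumes "c \<in> Lambda_bd G \<mu>"
  obtains F where "eigenfunction X R c F" "finite_support F"
proof -
  obtain V D f where A: "(V, D) \<in> bd_subgraphs G S" and f: "\<exists>x\<in>V. f x \<noteq> 0"
    "\<forall>x\<in>V. (\<Sum>y\<in>V. complex_of_real (subgraph_matrix G \<mu> D x y) * f y) = c * f x"
    using assms unfolding Lambda_bd_def matrix_spectrum_def by blast
  \<comment> \<open>\<open>matrix_spectrum\<close> does not constrain \<open>f\<close> off
    \<open>V\<close>, whereas \<open>lift_eigenfunction\<close> asks for a function vanishing
    there.\<close>
  define g where "g x = (if x \<in> V then f x else 0)" for x
  have "g x = 0" if "x \<notin> V" for x
    using that by (simp add: g_def)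
  moreover have "g \<noteq> 0"
    using f(1) by (auto simp: g_def fun_eq_iff)
  moreover have "matrix_apply V (subgraph_matrix G \<mu> D) g = cscale c g"
    using f(2) by (auto simp: matrix_apply_def g_def cscale_def fun_eq_iff)
  ultimately show thesis
    using that lift_eigenfunction[OF A] by blast
qed

lemma Lambda_real:
  assumes "c \<in> Lambda_bd G \<mu>"
  shows "cnj c = c"
proof -
  obtain V D where A: "(V, D) \<in> bd_subgraphs G S" and c: "c \<in> matrix_spectrum V (subgraph_matrix G \<mu> D)"
    using assms unfolding Lambda_bd_def by blast
  show ?thesis
  proof (rule matrix_spectrum_real[OF bd_subgraphsD(1)[OF A] _ c])
    show "subgraph_matrix G \<mu> D x y = subgraph_matrix G \<mu> D y x" if "x \<in> V" "y \<in> V" for x y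
      using that bd_subgraphsD(2)[OF A] by (intro subgraph_matrix_sym) auto
  qed
qed

end

section \<open>Bond percolation\<close>

context bond_lamplighter
begin

lemma finite_touching_Union:
  assumes "finite \<A>" "\<A> \<subseteq> bd_subgraphs G S"
  shows "finite (\<Union>(V, D)\<in>\<A>. touching V D)" "(\<Union>(V, D)\<in>\<A>. touching V D) \<subseteq> E"
proof -
  show "finite (\<Union>(V, D)\<in>\<A>. touching V D)"
    using assms(1)
  proof (rule finite_UN_I)
    fix A assume "A \<in> \<A>"
    then show "finite (case A of (V, D) \<Rightarrow> touching V D)"
      using assms(2) finite_touching(1)[of "fst A" "snd A"] by (auto simp: split_beta)
  qed
  show "(\<Union>(V, D)\<in>\<A>. touching V D) \<subseteq> E"
    using assms(2) finite_touching(2) by blast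
qed

text \<open>For a finite connected subgraph, the configurations whose open cluster of the identity
  is that subgraph; \<open>extensional E\<close> is the sample space of the product measure.\<close>

definition cluster_event :: "'g set \<times> 'g set set \<Rightarrow> ('g set \<Rightarrow> bool) set" where
  "cluster_event = (\<lambda>(V, D). {\<omega> \<in> extensional E. (\<forall>\<epsilon>\<in>D. \<omega> \<epsilon>) \<and> (\<forall>\<epsilon>\<in>boundary V D. \<not> \<omega> \<epsilon>)})"

lemma edge_reachable_sym: "(x, y) \<in> edge_reachable D \<Longrightarrow> (y, x) \<in> edge_reachable D"
proof -
  have "sym {(x, y). {x, y} \<in> D}"
    by (auto simp: sym_def insert_commute)
  then show "(x, y) \<in> edge_reachable D \<Longrightarrow> (y, x) \<in> edge_reachable D"
    unfolding edge_reachable_def using sym_rtrancl by (metis symE)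
qed

text \<open>Open paths cannot cross the closed boundary, and the open edges of \<open>D\<close>
  connect all of \<open>V\<close>. Since \<open>V\<close> and \<open>D\<close> are both recovered
  from \<omega>, events of different subgraphs are disjoint.\<close>

lemma open_cluster_eq:
  assumes A: "(V, D) \<in> bd_subgraphs G S" and \<omega>: "\<omega> \<in> cluster_event (V, D)"
  shows "open_cluster G S \<omega> \<one>\<^bsub>G\<^esub> = V" "{\<epsilon> \<in> E. \<omega> \<epsilon> \<and> \<epsilon> \<inter> V \<noteq> {}} = D"
proof -
  note VD = bd_subgraphsD[OF A]
  let ?O = "{\<epsilon> \<in> E. \<omega> \<epsilon>}"
  have D: "\<omega> \<epsilon>" if "\<epsilon> \<in> D" for \<epsilon>
    using \<omega> that by (auto simp: cluster_event_def)
  have closed: "\<epsilon> \<in> D" if "\<epsilon> \<in> E" "\<omega> \<epsilon>" "\<epsilon> \<inter> V \<noteq> {}" for \<epsilon>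
    using \<omega> that by (auto simp: cluster_event_def boundary_def)
  have "\<epsilon> \<inter> V \<noteq> {}" if "\<epsilon> \<in> D" for \<epsilon>
    using that touching_eq[OF A] by blast
  then show "{\<epsilon> \<in> E. \<omega> \<epsilon> \<and> \<epsilon> \<inter> V \<noteq> {}} = D"
    using D closed VD(4) by blast
  show "open_cluster G S \<omega> \<one>\<^bsub>G\<^esub> = V"
  proof
    show "open_cluster G S \<omega> \<one>\<^bsub>G\<^esub> \<subseteq> V"
    proof
      fix y assume "y \<in> open_cluster G S \<omega> \<one>\<^bsub>G\<^esub>"
      then have "(\<one>\<^bsub>G\<^esub>, y) \<in> {(x, y). {x, y} \<in> ?O}\<^sup>*"
        by (simp add: open_cluster_def edge_reachable_def)
      then show "y \<in> V"
      proof (induction rule: rtrancl_induct)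
        case base
        show ?case
          by (rule VD(3))
      next
        case (step y z)
        then have "{y, z} \<in> D"
          by (intro closed) auto
        then show ?case
          using VD(5) by blast
      qed
    qed
    show "V \<subseteq> open_cluster G S \<omega> \<one>\<^bsub>G\<^esub>"
    proof
      fix y assume "y \<in> V"
      then have "(\<one>\<^bsub>G\<^esub>, y) \<in> {(x, y). {x, y} \<in> D}\<^sup>*"
        using VD(3,6) by (auto simp: edge_reachable_def)
      moreover have "{(x, y). {x, y} \<in> D} \<subseteq> {(x, y). {x, y} \<in> ?O}"
        using D VD(4) by auto
      ultimately have "(\<one>\<^bsub>G\<^esub>, y) \<in> {(x, y). {x, y} \<in> ?O}\<^sup>*"
        using rtrancl_mono by blast
      then show "y \<in> open_cluster G S \<omega> \<one>\<^bsub>G\<^esub>"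
        by (simp add: open_cluster_def edge_reachable_def)
    qed
  qed
qed

lemma cluster_event_disjoint:
  assumes "A \<in> bd_subgraphs G S" "B \<in> bd_subgraphs G S" "\<omega> \<in> cluster_event A" "\<omega> \<in> cluster_event B"
  shows "A = B"
proof -
  obtain V D V' D' where AB: "A = (V, D)" "B = (V', D')"
    by fastforce
  have "V = V'"
    using open_cluster_eq(1) assms unfolding AB by blast
  then show ?thesis
    using open_cluster_eq(2)[of V D \<omega>] open_cluster_eq(2)[of V' D' \<omega>] assms unfolding AB by blast
qed

text \<open>The cluster with its open edges is itself a finite connected subgraph. With
  \<open>open_cluster_eq\<close>, the events partition the configurations with finite
  cluster.\<close>

lemma finite_cluster_event:
  assumes \<omega>: "\<omega> \<in> extensional E" and fin: "finite (open_cluster G S \<omega> \<one>\<^bsub>G\<^esub>)"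
  shows "\<exists>A\<in>bd_subgraphs G S. \<omega> \<in> cluster_event A"
proof -
  let ?O = "{\<epsilon> \<in> E. \<omega> \<epsilon>}"
  define V where "V = open_cluster G S \<omega> \<one>\<^bsub>G\<^esub>"
  define D where "D = {\<epsilon> \<in> E. \<omega> \<epsilon> \<and> \<epsilon> \<subseteq> V}"
  have V_iff: "y \<in> V \<longleftrightarrow> (\<one>\<^bsub>G\<^esub>, y) \<in> {(x, y). {x, y} \<in> ?O}\<^sup>*" for y
    by (simp add: V_def open_cluster_def edge_reachable_def)
  have one: "\<one>\<^bsub>G\<^esub> \<in> V"
    by (simp add: V_iff)
  have step: "z \<in> V" if "y \<in> V" "{y, z} \<in> ?O" for y z
    using that rtrancl_into_rtrancl[of "\<one>\<^bsub>G\<^esub>" y "{(x, y). {x, y} \<in> ?O}" z] unfolding V_iff by blast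
  have edge_in: "\<epsilon> \<subseteq> V" if "\<epsilon> \<in> ?O" "\<epsilon> \<inter> V \<noteq> {}" for \<epsilon>
  proof -
    obtain x s where "\<epsilon> = {x, x \<otimes>\<^bsub>G\<^esub> s}"
      using \<open>\<epsilon> \<in> ?O\<close> by (auto simp: edge_iff)
    then show ?thesis
      using that step[of x "x \<otimes>\<^bsub>G\<^esub> s"] step[of "x \<otimes>\<^bsub>G\<^esub> s" x] by (auto simp: insert_commute)
  qed
  \<comment> \<open>Open paths from the identity never leave \<open>V\<close>, so they use edges of
    \<open>D\<close> only.\<close>
  have reach: "(\<one>\<^bsub>G\<^esub>, y) \<in> edge_reachable D \<and> y \<in> carrier G" if "y \<in> V" for y
  proof -
    have "(\<one>\<^bsub>G\<^esub>, y) \<in> {(x, y). {x, y} \<in> ?O}\<^sup>*"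
      using that V_iff by blast
    then show ?thesis
    proof (induction rule: rtrancl_induct)
      case base
      show ?case
        by (simp add: edge_reachable_def)
    next
      case (step y z)
      have "y \<in> V"
        using step.hyps(1) V_iff by blast
      then have "{y, z} \<in> D"
        using step.hyps(2) edge_in[of "{y, z}"] by (auto simp: D_def)
      moreover have "z \<in> carrier G"
        using step.hyps(2) edge_subset[of "{y, z}"] by auto
      ultimately show ?case
        using step.IH unfolding edge_reachable_def by (auto intro: rtrancl_into_rtrancl)
    qed
  qed
  have "(V, D) \<in> bd_subgraphs G S"
    unfolding bd_subgraphs_def
  proof (clarify, intro conjI ballI)
    show "finite V"
      using fin by (simp add: V_def)
    show "V \<subseteq> carrier G"
      using reach by blast
    show "(x, y) \<in> edge_reachable D" if "x \<in> V" "y \<in> V" for x y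
      using edge_reachable_sym[of "\<one>\<^bsub>G\<^esub>" x D] reach that unfolding edge_reachable_def by (meson rtrancl_trans)
  qed (use one in \<open>auto simp: D_def\<close>)
  moreover have "\<omega> \<in> cluster_event (V, D)"
    using \<omega> edge_in unfolding cluster_event_def by (auto simp: D_def boundary_def)
  ultimately show ?thesis
    by blast
qed

text \<open>
  At such an edge the factor of the inner product of the two lamp functions vanishes, being the
  integral of a constant against a mean-zero function.
\<close>

lemma touching_conflict:
  assumes A: "(V, D) \<in> bd_subgraphs G S" and B: "(V', D') \<in> bd_subgraphs G S" and ne: "(V, D) \<noteq> (V', D')"
  shows "\<exists>\<epsilon>. \<epsilon> \<in> D \<inter> boundary V' D' \<or> \<epsilon> \<in> D' \<inter> boundary V D"
proof (rule ccontr)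
  assume "\<not> ?thesis"
  \<comment> \<open>Without a conflicting edge, the configuration with exactly the edges of
    \<open>D \<union> D'\<close> open would belong to both events.\<close>
  then have "(\<lambda>\<epsilon>\<in>E. \<epsilon> \<in> D \<union> D') \<in> cluster_event (V, D)" "(\<lambda>\<epsilon>\<in>E. \<epsilon> \<in> D \<union> D') \<in> cluster_event (V', D')"
    using bd_subgraphsD(4)[OF A] bd_subgraphsD(4)[OF B]
    by (auto simp: cluster_event_def boundary_def)
  then show False
    using cluster_event_disjoint A B ne by blast
qed

text \<open>The sum factorises over \<open>K\<close>. For equal subgraphs each factor is the squared
  norm of an orthogonal projection of the point mass at the identity of \<open>H\<close>, hence the
  value of that projection at the identity; for different ones the factor at a conflicting edge is
  0.\<close>

lemma inner_lamp_fun: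
  assumes A: "(V, D) \<in> bd_subgraphs G S" and B: "(V', D') \<in> bd_subgraphs G S"
    and K: "finite K" "K \<subseteq> E" "touching V D \<subseteq> K" "touching V' D' \<subseteq> K"
  shows "(\<Sum>\<eta>\<in>lamps_on K. lamp_fun V D \<eta> * lamp_fun V' D' \<eta>) =
    (if (V, D) = (V', D') then lamp_fun V D \<iota> else 0)"
proof -
  have prods: "lamp_fun V D \<eta> = (\<Prod>\<epsilon>\<in>K. lamp_weight V D \<epsilon> (\<eta> \<epsilon>))"
      "lamp_fun V' D' \<eta> = (\<Prod>\<epsilon>\<in>K. lamp_weight V' D' \<epsilon> (\<eta> \<epsilon>))" if "\<eta> \<in> lamps_on K" for \<eta>
    using that K unfolding lamps_on_def
    by (auto intro!: lamp_fun_eq_prod[OF A] lamp_fun_eq_prod[OF B])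
  have "(\<Sum>\<eta>\<in>lamps_on K. lamp_fun V D \<eta> * lamp_fun V' D' \<eta>) =
      (\<Sum>\<eta>\<in>lamps_on K. \<Prod>\<epsilon>\<in>K. lamp_weight V D \<epsilon> (\<eta> \<epsilon>) * lamp_weight V' D' \<epsilon> (\<eta> \<epsilon>))"
    by (intro sum.cong refl) (simp only: prods prod.distrib)
  also have "\<dots> = (\<Prod>\<epsilon>\<in>K. \<Sum>h\<in>carrier H. lamp_weight V D \<epsilon> h * lamp_weight V' D' \<epsilon> h)"
    by (rule sum_lamps_on[OF K(1,2)])
  also have "\<dots> = (if (V, D) = (V', D') then lamp_fun V D \<iota> else 0)"
  proof (cases "(V, D) = (V', D')")
    case True
    have delta: "(\<Sum>h\<in>carrier H. (if h = \<one>\<^bsub>H\<^esub> then 1 else 0) * f h) = f \<one>\<^bsub>H\<^esub>" for f :: "'h \<Rightarrow> real"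
      using finite_H by (simp add: if_distrib[of "\<lambda>x. x * _"] sum.delta cong: if_cong)
    have "(\<Sum>h\<in>carrier H. lamp_weight V D \<epsilon> h * lamp_weight V D \<epsilon> h) = lamp_weight V D \<epsilon> (\<iota> \<epsilon>)"
      if "\<epsilon> \<in> K" for \<epsilon>
    proof -
      have \<iota>: "\<iota> \<epsilon> = \<one>\<^bsub>H\<^esub>"
        using that K(2) by auto
      consider "\<epsilon> \<in> D" | "\<epsilon> \<in> boundary V D" "\<epsilon> \<notin> D" | "\<epsilon> \<notin> touching V D"
        by blast
      then show ?thesis
      proof cases
        case 1
        then show ?thesis
          using q_pos by (simp add: lamp_weight_def)
      next
        case 2
        then have w: "lamp_weight V D \<epsilon> h = (if h = \<one>\<^bsub>H\<^esub> then 1 else 0) - 1 / q" for h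
          by (simp add: lamp_weight_def)
        \<comment> \<open>One of the two factors is split into the point mass and the constant
          \<open>1 / q\<close>: the first part evaluates at the identity, the second contributes
          nothing because the weight has mean zero.\<close>
        have square: "x * x = d * x - x * e" if "x = d - e" for x d e :: real
          unfolding that by (simp add: algebra_simps)
        have "(\<Sum>h\<in>carrier H. lamp_weight V D \<epsilon> h * lamp_weight V D \<epsilon> h) =
            (\<Sum>h\<in>carrier H. (if h = \<one>\<^bsub>H\<^esub> then 1 else 0) * lamp_weight V D \<epsilon> h - lamp_weight V D \<epsilon> h * (1 / q))"
          by (intro sum.cong refl square w)
        also have "\<dots> = lamp_weight V D \<epsilon> \<one>\<^bsub>H\<^esub>"
          unfolding sum_subtractf delta sum_distrib_right[symmetric] lamp_weight_sum(2)[OF A 2(1)] by simp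
        finally show ?thesis
          by (simp only: \<iota>)
      next
        case 3
        then show ?thesis
          unfolding \<iota> lamp_weight_off[OF 3] delta by simp
      qed
    qed
    then have "(\<Prod>\<epsilon>\<in>K. \<Sum>h\<in>carrier H. lamp_weight V D \<epsilon> h * lamp_weight V D \<epsilon> h) =
        (\<Prod>\<epsilon>\<in>K. lamp_weight V D \<epsilon> (\<iota> \<epsilon>))"
      by (intro prod.cong refl)
    also have "\<dots> = lamp_fun V D \<iota>"
      using K by (intro lamp_fun_eq_prod[OF A iota_L, symmetric]) auto
    finally show ?thesis
      using True by simp
  next
    case False
    then obtain \<epsilon> where \<epsilon>: "\<epsilon> \<in> D \<inter> boundary V' D' \<or> \<epsilon> \<in> D' \<inter> boundary V D"
      using touching_conflict[OF A B] by blast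
    have "(\<Sum>h\<in>carrier H. lamp_weight V D \<epsilon> h * lamp_weight V' D' \<epsilon> h) = 0"
      using \<epsilon>
    proof
      assume e: "\<epsilon> \<in> D \<inter> boundary V' D'"
      then have "(\<Sum>h\<in>carrier H. lamp_weight V D \<epsilon> h * lamp_weight V' D' \<epsilon> h) =
          (1 / q) * (\<Sum>h\<in>carrier H. lamp_weight V' D' \<epsilon> h)"
        unfolding sum_distrib_left by (intro sum.cong) (auto simp: lamp_weight_def[of V D])
      then show ?thesis
        using lamp_weight_sum(2)[OF B, of \<epsilon>] e by simp
    next
      assume e: "\<epsilon> \<in> D' \<inter> boundary V D"
      then have "(\<Sum>h\<in>carrier H. lamp_weight V D \<epsilon> h * lamp_weight V' D' \<epsilon> h) =
          (\<Sum>h\<in>carrier H. lamp_weight V D \<epsilon> h) * (1 / q)"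
        unfolding sum_distrib_right by (intro sum.cong) (auto simp: lamp_weight_def[of V' D'])
      then show ?thesis
        using lamp_weight_sum(2)[OF A, of \<epsilon>] e by simp
    qed
    moreover have "\<epsilon> \<in> K"
      using \<epsilon> K by auto
    ultimately have "(\<Prod>\<epsilon>\<in>K. \<Sum>h\<in>carrier H. lamp_weight V D \<epsilon> h * lamp_weight V' D' \<epsilon> h) = 0"
      using K(1) by (intro prod_zero) blast+
    then show ?thesis
      unfolding if_not_P[OF False] .
  qed
  finally show ?thesis .
qed

text \<open>Pythagoras: by orthogonality the Gram matrix is diagonal, and its trace is the same sum
  \<open>w\<close> that appears in the cross terms with the point mass, so expanding gives
  \<open>1 - 2 * w + w\<close>.\<close>

lemma lamp_fun_approx:
  assumes \<A>: "finite \<A>" "\<A> \<subseteq> bd_subgraphs G S" and K: "finite K" "K \<subseteq> E" "\<And>V D. (V, D) \<in> \<A> \<Longrightarrow> touching V D \<subseteq> K"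
  shows "(\<Sum>\<eta>\<in>lamps_on K. ((if \<eta> = \<iota> then 1 else 0) - (\<Sum>(V, D)\<in>\<A>. lamp_fun V D \<eta>))\<^sup>2) =
    1 - (\<Sum>(V, D)\<in>\<A>. lamp_fun V D \<iota>)"
proof -
  define \<phi> where "\<phi> A = lamp_fun (fst A) (snd A)" for A
  define w where "w = (\<Sum>A\<in>\<A>. \<phi> A \<iota>)"
  have \<iota>: "\<iota> \<in> lamps_on K"
    using iota_L by (simp add: lamps_on_def)
  have fin: "finite (lamps_on K)"
    by (rule finite_lamps_on[OF K(1,2)])
  have delta: "(\<Sum>\<eta>\<in>lamps_on K. (if \<eta> = \<iota> then 1 else 0) * f \<eta>) = f \<iota>" for f :: "('g set \<Rightarrow> 'h) \<Rightarrow> real"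
  proof -
    have "(\<Sum>\<eta>\<in>lamps_on K. (if \<eta> = \<iota> then 1 else 0) * f \<eta>) = (\<Sum>\<eta>\<in>lamps_on K. if \<eta> = \<iota> then f \<eta> else 0)"
      by (intro sum.cong) auto
    then show ?thesis
      unfolding sum.delta[OF fin] using \<iota> by simp
  qed
  have ortho: "(\<Sum>\<eta>\<in>lamps_on K. \<phi> A \<eta> * \<phi> B \<eta>) = (if A = B then \<phi> A \<iota> else 0)" if "A \<in> \<A>" "B \<in> \<A>" for A B
  proof -
    obtain V D V' D' where AB: "A = (V, D)" "B = (V', D')"
      by fastforce
    have "(V, D) \<in> bd_subgraphs G S" "(V', D') \<in> bd_subgraphs G S" "touching V D \<subseteq> K" "touching V' D' \<subseteq> K"
      using that \<A>(2) K(3) unfolding AB by blast+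
    from inner_lamp_fun[OF this(1,2) K(1,2) this(3,4)] show ?thesis
      by (simp only: \<phi>_def AB fst_conv snd_conv)
  qed
  have "(\<Sum>\<eta>\<in>lamps_on K. ((if \<eta> = \<iota> then 1 else 0) - (\<Sum>A\<in>\<A>. \<phi> A \<eta>))\<^sup>2) =
      (\<Sum>\<eta>\<in>lamps_on K. (if \<eta> = \<iota> then 1 else 0) * (1 - 2 * (\<Sum>A\<in>\<A>. \<phi> A \<eta>)) + (\<Sum>A\<in>\<A>. \<Sum>B\<in>\<A>. \<phi> A \<eta> * \<phi> B \<eta>))"
    by (intro sum.cong refl) (simp add: power2_eq_square algebra_simps sum_product[symmetric])
  also have "\<dots> = (1 - 2 * w) + (\<Sum>\<eta>\<in>lamps_on K. \<Sum>A\<in>\<A>. \<Sum>B\<in>\<A>. \<phi> A \<eta> * \<phi> B \<eta>)"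
    unfolding sum.distrib delta w_def ..
  also have "(\<Sum>\<eta>\<in>lamps_on K. \<Sum>A\<in>\<A>. \<Sum>B\<in>\<A>. \<phi> A \<eta> * \<phi> B \<eta>) =
      (\<Sum>A\<in>\<A>. \<Sum>\<eta>\<in>lamps_on K. \<Sum>B\<in>\<A>. \<phi> A \<eta> * \<phi> B \<eta>)"
    by (rule sum.swap)
  also have "\<dots> = (\<Sum>A\<in>\<A>. \<Sum>B\<in>\<A>. \<Sum>\<eta>\<in>lamps_on K. \<phi> A \<eta> * \<phi> B \<eta>)"
    by (rule sum.cong[OF refl sum.swap])
  also have "\<dots> = (\<Sum>A\<in>\<A>. \<Sum>B\<in>\<A>. if A = B then \<phi> A \<iota> else 0)"
    by (intro sum.cong refl ortho)
  also have "\<dots> = w"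
    unfolding w_def by (intro sum.cong refl) (simp add: \<A>(1))
  finally have "(\<Sum>\<eta>\<in>lamps_on K. ((if \<eta> = \<iota> then 1 else 0) - (\<Sum>A\<in>\<A>. \<phi> A \<eta>))\<^sup>2) = 1 - w"
    by (simp only: mult_2 diff_diff_eq[symmetric] diff_add_cancel)
  moreover have "(\<lambda>(V, D). lamp_fun V D \<eta>) = (\<lambda>A. \<phi> A \<eta>)" for \<eta>
    by (auto simp: \<phi>_def)
  ultimately show ?thesis
    by (simp only: w_def)
qed

text \<open>Every element is the product of a finite word in \<open>S\<close>, as inverses of
  generators are again in \<open>S\<close>. Countability lets subgraphs be enumerated and
  orthonormalisation run along the points of \<open>X\<close>.\<close>

lemma countable_G: "countable (carrier G)"
proof -
  define W where "W = (\<lambda>xs. foldr (\<otimes>\<^bsub>G\<^esub>) xs \<one>\<^bsub>G\<^esub>) ` lists S"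
  have closed: "foldr (\<otimes>\<^bsub>G\<^esub>) xs \<one>\<^bsub>G\<^esub> \<in> carrier G" if "xs \<in> lists S" for xs
    using that by induction auto
  have append: "foldr (\<otimes>\<^bsub>G\<^esub>) (xs @ ys) \<one>\<^bsub>G\<^esub> = foldr (\<otimes>\<^bsub>G\<^esub>) xs \<one>\<^bsub>G\<^esub> \<otimes>\<^bsub>G\<^esub> foldr (\<otimes>\<^bsub>G\<^esub>) ys \<one>\<^bsub>G\<^esub>"
    if "xs \<in> lists S" "ys \<in> lists S" for xs ys
    using that(1)
  proof induction
    case (Cons x xs)
    then show ?case
      using closed that(2) by (simp add: G.m_assoc del: foldr_append)
  qed (simp add: closed that(2) del: foldr_append)
  have mult: "x \<otimes>\<^bsub>G\<^esub> y \<in> W" if "x \<in> W" "y \<in> W" for x y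
  proof -
    obtain xs ys where "xs \<in> lists S" "x = foldr (\<otimes>\<^bsub>G\<^esub>) xs \<one>\<^bsub>G\<^esub>"
      "ys \<in> lists S" "y = foldr (\<otimes>\<^bsub>G\<^esub>) ys \<one>\<^bsub>G\<^esub>"
      using \<open>x \<in> W\<close> \<open>y \<in> W\<close> unfolding W_def by blast
    moreover from this have "xs @ ys \<in> lists S"
      by simp
    ultimately show ?thesis
      unfolding W_def using append by (intro image_eqI[of _ _ "xs @ ys"]) (simp_all only:)
  qed
  have single: "s \<in> W" if "s \<in> S" for s
    unfolding W_def using that by (intro image_eqI[of _ _ "[s]"]) auto
  have "x \<in> W" if "x \<in> generate G S" for x
    using that
  proof induction
    case one
    show ?case
      unfolding W_def by (intro image_eqI[of _ _ "[]"]) auto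
  next
    case (inv s)
    then show ?case
      using single by simp
  qed (use single mult in auto)
  then have "carrier G \<subseteq> W"
    using generate_S by auto
  moreover have "countable W"
    unfolding W_def using finite_S by (intro countable_image countable_lists countable_finite)
  ultimately show ?thesis
    by (rule countable_subset)
qed

lemma countable_E: "countable E"
proof -
  have "E \<subseteq> (\<lambda>(x, s). {x, x \<otimes>\<^bsub>G\<^esub> s}) ` (carrier G \<times> S)"
    by (auto simp: edge_iff)
  then show ?thesis
    by (rule countable_subset) (intro countable_image countable_SIGMA countable_G countable_finite finite_S)
qed

lemma countable_bd_subgraphs: "countable (bd_subgraphs G S)"
proof (rule countable_subset)
  show "bd_subgraphs G S \<subseteq> {V. finite V \<and> V \<subseteq> carrier G} \<times> {D. finite D \<and> D \<subseteq> E}"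
  proof
    fix A assume A: "A \<in> bd_subgraphs G S"
    obtain V D where VD: "A = (V, D)"
      by fastforce
    show "A \<in> {V. finite V \<and> V \<subseteq> carrier G} \<times> {D. finite D \<and> D \<subseteq> E}"
      using bd_subgraphsD(1,2,4)[OF A[unfolded VD]] finite_touching(1)[OF A[unfolded VD]] by (simp add: VD)
  qed
  show "countable ({V. finite V \<and> V \<subseteq> carrier G} \<times> {D. finite D \<and> D \<subseteq> E})"
    by (intro countable_SIGMA countable_Collect_finite_subset countable_G countable_E)
qed

lemma countable_X: "countable X"
proof -
  have "L \<subseteq> (\<Union>K\<in>{K. finite K \<and> K \<subseteq> E}. lamps_on K)"
  proof
    fix \<eta> assume "\<eta> \<in> L"
    then have "\<eta> \<in> lamps_on {\<epsilon> \<in> E. \<eta> \<epsilon> \<noteq> \<one>\<^bsub>H\<^esub>}"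
      by (auto simp: lamps_on_def)
    then show "\<eta> \<in> (\<Union>K\<in>{K. finite K \<and> K \<subseteq> E}. lamps_on K)"
      using finite_lamps[OF \<open>\<eta> \<in> L\<close>] by blast
  qed
  moreover have "countable (\<Union>K\<in>{K. finite K \<and> K \<subseteq> E}. lamps_on K)"
    using finite_lamps_on by (intro countable_UN countable_Collect_finite_subset countable_E) (auto intro: countable_finite)
  ultimately have "countable L"
    by (rule countable_subset)
  then show ?thesis
    unfolding X_eq using countable_G by (rule countable_SIGMA)
qed

text \<open>The event prescribes the states of the finitely many touching edges, hence is a
  cylinder; the one-edge probabilities \<open>1 / q\<close> and \<open>1 - 1 / q\<close> are the
  lamp weights at \<iota>.\<close>

lemma percolation_cluster_event:
  assumes A: "(V, D) \<in> bd_subgraphs G S"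
  shows "cluster_event (V, D) \<in> sets (bond_percolation G S (1 / q))"
    and "measure (bond_percolation G S (1 / q)) (cluster_event (V, D)) = lamp_fun V D \<iota>"
proof -
  define M where "M = (\<lambda>_ :: 'g set. measure_pmf (bernoulli_pmf (1 / q)))"
  interpret product_prob_space M E
    unfolding M_def by unfold_locales
  have space: "space (M i) = UNIV" "sets (M i) = UNIV" for i
    by (simp_all add: M_def)
  \<comment> \<open>The singleton of the prescribed state: \<open>{True}\<close> for edges of
    \<open>D\<close>, \<open>{False}\<close> for all others.\<close>
  define Y where "Y \<epsilon> = {\<epsilon> \<in> D}" for \<epsilon>
  note T = finite_touching[OF A]
  have ev: "cluster_event (V, D) = prod_emb E M (touching V D) (Pi\<^sub>E (touching V D) Y)"
  proof (rule Set.set_eqI)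
    fix \<omega>
    have "\<epsilon> \<notin> D" if "\<epsilon> \<in> boundary V D" for \<epsilon>
      using that by (simp add: boundary_def)
    then have "(\<forall>\<epsilon>\<in>D. \<omega> \<epsilon>) \<and> (\<forall>\<epsilon>\<in>boundary V D. \<not> \<omega> \<epsilon>) \<longleftrightarrow> (\<forall>\<epsilon>\<in>touching V D. \<omega> \<epsilon> = (\<epsilon> \<in> D))"
      by blast
    moreover have "restrict \<omega> (touching V D) \<in> Pi\<^sub>E (touching V D) Y \<longleftrightarrow> (\<forall>\<epsilon>\<in>touching V D. \<omega> \<epsilon> = (\<epsilon> \<in> D))"
      by (simp add: PiE_iff Y_def)
    ultimately show "\<omega> \<in> cluster_event (V, D) \<longleftrightarrow> \<omega> \<in> prod_emb E M (touching V D) (Pi\<^sub>E (touching V D) Y)"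
      unfolding prod_emb_iff space cluster_event_def by simp
  qed
  have bp: "bond_percolation G S (1 / q) = PiM E M"
    by (simp add: bond_percolation_def M_def)
  show "cluster_event (V, D) \<in> sets (bond_percolation G S (1 / q))"
    unfolding bp ev using T by (intro sets_PiM_I) (auto simp: space)
  have "measure (PiM E M) (cluster_event (V, D)) = (\<Prod>\<epsilon>\<in>touching V D. measure (M \<epsilon>) (Y \<epsilon>))"
    unfolding ev using T by (intro measure_PiM_emb) (auto simp: space)
  also have "\<dots> = (\<Prod>\<epsilon>\<in>touching V D. lamp_weight V D \<epsilon> (\<iota> \<epsilon>))"
  proof (rule prod.cong)
    fix \<epsilon> assume \<epsilon>: "\<epsilon> \<in> touching V D"
    have q: "0 \<le> 1 / real q" "1 / real q \<le> 1"
      using card_H by auto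
    have "\<iota> \<epsilon> = \<one>\<^bsub>H\<^esub>"
      using \<epsilon> T(2) by auto
    then show "measure (M \<epsilon>) (Y \<epsilon>) = lamp_weight V D \<epsilon> (\<iota> \<epsilon>)"
      using \<epsilon> q by (auto simp: M_def Y_def measure_pmf_single lamp_weight_def boundary_def)
  qed simp
  also have "\<dots> = lamp_fun V D \<iota>"
    using T by (intro lamp_fun_eq_prod[OF A iota_L, symmetric]) auto
  finally show "measure (bond_percolation G S (1 / q)) (cluster_event (V, D)) = lamp_fun V D \<iota>"
    unfolding bp .
qed

text \<open>The cluster events are countably many, disjoint, and exhaust the event of a finite
  cluster. Continuity from below gives finitely many of total probability close to 1, and these
  probabilities are the values of the lamp functions at \<iota>.\<close>

lemma percolation_finite_approx:
  assumes perc: "\<P>(\<omega> in bond_percolation G S (1 / q). finite (open_cluster G S \<omega> \<one>\<^bsub>G\<^esub>)) = 1" and \<epsilon>: "\<epsilon> > 0"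
  obtains \<A> where "finite \<A>" "\<A> \<subseteq> bd_subgraphs G S" "(\<Sum>(V, D)\<in>\<A>. lamp_fun V D \<iota>) > 1 - \<epsilon>"
proof -
  let ?M = "bond_percolation G S (1 / q)"
  let ?bd = "bd_subgraphs G S"
  interpret prob_space ?M
    unfolding bond_percolation_def by (intro prob_space_PiM) (rule measure_pmf.prob_space_axioms)
  define num where "num = to_nat_on ?bd"
  have inj: "inj_on num ?bd"
    unfolding num_def by (rule inj_on_to_nat_on[OF countable_bd_subgraphs])
  define \<A> where "\<A> n = {A \<in> ?bd. num A < n}" for n
  have fin: "finite (\<A> n)" for n
    by (rule inj_on_finite[of num _ "{..<n}"]) (auto simp: \<A>_def intro: inj_on_subset[OF inj])
  define U where "U n = (\<Union>A\<in>\<A> n. cluster_event A)" for n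
  have ev: "cluster_event A \<in> sets ?M" "measure ?M (cluster_event A) = lamp_fun (fst A) (snd A) \<iota>"
    if "A \<in> ?bd" for A
    using percolation_cluster_event[of "fst A" "snd A"] that by auto
  have U_sets: "range U \<subseteq> sets ?M"
    using ev fin by (auto simp: U_def \<A>_def)
  have "incseq U"
    unfolding incseq_def U_def \<A>_def by fastforce
  have space: "space ?M = extensional E"
    by (simp add: bond_percolation_def space_PiM PiE_def)
  have "(\<Union>n. U n) = {\<omega> \<in> space ?M. finite (open_cluster G S \<omega> \<one>\<^bsub>G\<^esub>)}"
  proof (intro equalityI subsetI)
    fix \<omega> assume "\<omega> \<in> (\<Union>n. U n)"
    then obtain V D where A: "(V, D) \<in> ?bd" "\<omega> \<in> cluster_event (V, D)"
      unfolding U_def \<A>_def by force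
    then show "\<omega> \<in> {\<omega> \<in> space ?M. finite (open_cluster G S \<omega> \<one>\<^bsub>G\<^esub>)}"
      using open_cluster_eq(1)[OF A] bd_subgraphsD(1)[OF A(1)] space by (simp add: cluster_event_def)
  next
    fix \<omega> assume "\<omega> \<in> {\<omega> \<in> space ?M. finite (open_cluster G S \<omega> \<one>\<^bsub>G\<^esub>)}"
    then obtain A where "A \<in> ?bd" "\<omega> \<in> cluster_event A"
      using finite_cluster_event[of \<omega>] space by auto
    then have "\<omega> \<in> U (Suc (num A))"
      unfolding U_def \<A>_def by blast
    then show "\<omega> \<in> (\<Union>n. U n)"
      by blast
  qed
  then have "(\<lambda>n. measure ?M (U n)) \<longlonglongrightarrow> 1"
    using finite_Lim_measure_incseq[OF U_sets \<open>incseq U\<close>] perc by simp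
  then have "\<forall>\<^sub>F n in sequentially. measure ?M (U n) > 1 - \<epsilon>"
    using \<epsilon> by (intro order_tendstoD(1)) auto
  then obtain n where n: "measure ?M (U n) > 1 - \<epsilon>"
    by (auto simp: eventually_sequentially)
  have "measure ?M (U n) = (\<Sum>A\<in>\<A> n. measure ?M (cluster_event A))"
    unfolding U_def
  proof (rule finite_measure_finite_Union[OF fin])
    show "cluster_event ` \<A> n \<subseteq> sets ?M"
      using ev(1) by (auto simp: \<A>_def)
    show "disjoint_family_on cluster_event (\<A> n)"
      using cluster_event_disjoint unfolding disjoint_family_on_def \<A>_def by blast
  qed
  also have "\<dots> = (\<Sum>(V, D)\<in>\<A> n. lamp_fun V D \<iota>)"
    using ev(2) by (intro sum.cong) (auto simp: \<A>_def)
  finally show thesis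
    using that[OF fin, of n] n by (simp add: \<A>_def)
qed

section \<open>Completeness of the finitely supported eigenfunctions\<close>

definition finite_eigenfunctions :: "(('g set \<Rightarrow> 'h) \<times> 'g \<Rightarrow> complex) set" where
  "finite_eigenfunctions = {F. finite_support F \<and> (\<exists>c\<in>Lambda_bd G \<mu>. eigenfunction X R c F)}"

lemma R_bounded: "ell2_bounded_operator X R"
  unfolding R_bd_def
proof (rule right_convolution_bounded_operator[OF group_\<Gamma>])
  have "{z \<in> X. mu_bd G H \<mu> z \<noteq> 0} \<subseteq> (\<Union>s\<in>S. lamps_on {{\<one>\<^bsub>G\<^esub>, s}} \<times> {s})"
  proof (rule subsetI)
    fix z assume z: "z \<in> {z \<in> X. mu_bd G H \<mu> z \<noteq> 0}"
    obtain \<eta> s where zs: "z = (\<eta>, s)"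
      by (metis surj_pair)
    then have "s \<in> S" "lamp_support G H S \<eta> \<subseteq> {{\<one>\<^bsub>G\<^esub>, s}}" "\<eta> \<in> L"
      using z by (auto simp: mu_bd_def X_eq split: if_splits)
    then show "z \<in> (\<Union>s\<in>S. lamps_on {{\<one>\<^bsub>G\<^esub>, s}} \<times> {s})"
      unfolding zs lamps_on_def lamp_support_def by auto
  qed
  moreover have "finite (\<Union>s\<in>S. lamps_on {{\<one>\<^bsub>G\<^esub>, s}} \<times> {s})"
  proof (intro finite_UN_I[OF finite_S] finite_cartesian_product finite_lamps_on)
    show "{{\<one>\<^bsub>G\<^esub>, s}} \<subseteq> E" if "s \<in> S" for s
      using edgeI[of "\<one>\<^bsub>G\<^esub>" s] that by simp
  qed auto
  ultimately show "finite {z \<in> X. mu_bd G H \<mu> z \<noteq> 0}"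
    by (rule finite_subset)
qed

lemma finite_eigenfunctions_ell2: "cfun.span finite_eigenfunctions \<subseteq> ell2 X"
  by (rule cfun.span_minimal[OF _ subspace_ell2]) (auto simp: finite_eigenfunctions_def eigenfunction_def)

lemma left_translate_span:
  assumes "\<gamma> \<in> X" "F \<in> cfun.span finite_eigenfunctions"
  shows "left_translate \<Gamma> \<gamma> F \<in> cfun.span finite_eigenfunctions"
  using assms(2)
proof (induction rule: cfun.span_induct_alt)
  case base
  have "left_translate \<Gamma> \<gamma> 0 = 0"
    by (auto simp: left_translate_def fun_eq_iff)
  then show ?case
    by (simp only: cfun.span_zero)
next
  case (step c x y)
  have "left_translate \<Gamma> \<gamma> x \<in> finite_eigenfunctions"
    using step(1) eigenfunction_left_translate[OF group_\<Gamma> assms(1)] left_translate_finite_support[OF group_\<Gamma> assms(1)]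
    unfolding finite_eigenfunctions_def R_bd_def by blast
  then show ?case
    unfolding left_translate_add left_translate_cscale
    using step(2) by (intro cfun.span_add cfun.span_scale) (auto intro: cfun.span_base)
qed

definition point_mass :: "('g set \<Rightarrow> 'h) \<times> 'g \<Rightarrow> ('g set \<Rightarrow> 'h) \<times> 'g \<Rightarrow> complex" where
  "point_mass x = (\<lambda>y. if y = x then 1 else 0)"

text \<open>\<open>lift\<close> is linear in its vector. Since the identity is a vertex of
  \<open>V\<close>, the unit vector there is a combination of eigenvectors of the symmetric matrix
  of the subgraph, each of which lifts to a finitely supported eigenfunction.\<close>

lemma lift_delta_span:
  assumes A: "(V, D) \<in> bd_subgraphs G S"
  shows "lift V D (\<lambda>g. if g = \<one>\<^bsub>G\<^esub> then 1 else 0) \<in> cfun.span finite_eigenfunctions"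
proof -
  let ?\<delta> = "\<lambda>g. if g = \<one>\<^bsub>G\<^esub> then 1 else (0 :: complex)"
  let ?M = "subgraph_matrix G \<mu> D"
  have sym: "?M x y = ?M y x" if "x \<in> V" "y \<in> V" for x y
    using that bd_subgraphsD(2)[OF A] by (intro subgraph_matrix_sym) auto
  have "?\<delta> \<in> cfun.span {f. (\<forall>x. x \<notin> V \<longrightarrow> f x = 0) \<and> f \<noteq> 0 \<and> (\<exists>c. matrix_apply V ?M f = cscale c f)}"
    (is "_ \<in> cfun.span ?Eig")
    by (rule symmetric_matrix_eigenvectors_span[OF bd_subgraphsD(1)[OF A] sym]) (use bd_subgraphsD(3)[OF A] in auto)
  then obtain t r where t: "finite t" "t \<subseteq> ?Eig" and \<delta>: "?\<delta> = (\<Sum>f\<in>t. cscale (r f) f)"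
    by (auto simp: cfun.span_explicit)
  have "lift V D ?\<delta> = (\<Sum>f\<in>t. cscale (r f) (lift V D f))"
    unfolding \<delta> by (auto simp: lift_def fun_eq_iff sum_cfun_apply cscale_def sum_distrib_left sum_distrib_right mult_ac)
  also have "\<dots> \<in> cfun.span finite_eigenfunctions"
  proof (intro cfun.span_sum cfun.span_scale cfun.span_base)
    fix f assume "f \<in> t"
    then obtain c where f: "\<And>x. x \<notin> V \<Longrightarrow> f x = 0" "f \<noteq> 0" "matrix_apply V ?M f = cscale c f"
      using t(2) by blast
    show "lift V D f \<in> finite_eigenfunctions"
      unfolding finite_eigenfunctions_def
      using lift_eigenfunction[OF A f] matrix_eigenvalue_Lambda[OF A f] by blast
  qed
  finally show ?thesis .
qed

text \<open>
  The spectral measure of the lamp configuration \<open>\<iota>\<close> under the commuting averaging operators is the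
  percolation measure; the components \<open>lamp_fun V D\<close> of \<open>\<iota>\<close> exhaust it iff the cluster is
  almost surely finite.
\<close>

lemma point_mass_one_approx:
  assumes perc: "\<P>(\<omega> in bond_percolation G S (1 / q). finite (open_cluster G S \<omega> \<one>\<^bsub>G\<^esub>)) = 1" and \<epsilon>: "\<epsilon> > 0"
  shows "\<exists>K\<in>cfun.span finite_eigenfunctions. ell2_norm X (point_mass \<one>\<^bsub>\<Gamma>\<^esub> - K) < \<epsilon>"
proof -
  let ?\<delta> = "\<lambda>g. if g = \<one>\<^bsub>G\<^esub> then 1 else (0 :: complex)"
  \<comment> \<open>The square appears because the missing probability is a squared
    distance.\<close>
  obtain \<A> where \<A>: "finite \<A>" "\<A> \<subseteq> bd_subgraphs G S" "(\<Sum>(V, D)\<in>\<A>. lamp_fun V D \<iota>) > 1 - \<epsilon>\<^sup>2"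
    using percolation_finite_approx[OF perc, of "\<epsilon>\<^sup>2"] \<epsilon> by auto
  define F where "F = (\<Sum>(V, D)\<in>\<A>. lift V D ?\<delta>)"
  define K where "K = (\<Union>(V, D)\<in>\<A>. touching V D)"
  have K: "finite K" "K \<subseteq> E" "\<And>V D. (V, D) \<in> \<A> \<Longrightarrow> touching V D \<subseteq> K"
    using finite_touching_Union[OF \<A>(1,2)] unfolding K_def by auto
  define f where "f \<eta> = (if \<eta> = \<iota> then 1 else 0) - (\<Sum>(V, D)\<in>\<A>. lamp_fun V D \<eta>)" for \<eta>
  have F_span: "F \<in> cfun.span finite_eigenfunctions"
    unfolding F_def using \<A>(2) lift_delta_span by (intro cfun.span_sum) auto
  have one: "\<one>\<^bsub>\<Gamma>\<^esub> = (\<iota>, \<one>\<^bsub>G\<^esub>)"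
    by (simp add: bd_lamplighter_def)
  have diff: "(point_mass \<one>\<^bsub>\<Gamma>\<^esub> - F) (\<eta>, g) = (if g = \<one>\<^bsub>G\<^esub> then complex_of_real (f \<eta>) else 0)" for \<eta> g
    by (auto simp: point_mass_def one F_def f_def lift_def sum_cfun_apply split_beta)
  have f_out: "f \<eta> = 0" if "\<eta> \<notin> lamps_on K" for \<eta>
  proof -
    have "\<iota> \<in> lamps_on K"
      using iota_L by (simp add: lamps_on_def)
    moreover have "lamp_fun V D \<eta> = 0" if "(V, D) \<in> \<A>" for V D
      using lamp_fun_support_lamps_on[OF _ K(3)[OF that] \<open>\<eta> \<notin> lamps_on K\<close>] that \<A>(2) by blast
    ultimately show ?thesis
      using that by (auto simp: f_def intro!: sum.neutral)
  qed
  let ?B = "lamps_on K \<times> {\<one>\<^bsub>G\<^esub>}"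
  have "ell2_norm X (point_mass \<one>\<^bsub>\<Gamma>\<^esub> - F) = L2_set (\<lambda>x. cmod ((point_mass \<one>\<^bsub>\<Gamma>\<^esub> - F) x)) ?B"
  proof (rule ell2_finite)
    show "finite ?B"
      using finite_lamps_on[OF K(1,2)] by simp
    show "?B \<subseteq> X"
      by (auto simp: X_eq lamps_on_def)
    show "(point_mass \<one>\<^bsub>\<Gamma>\<^esub> - F) x = 0" if "x \<notin> ?B" for x
      using that f_out diff[of "fst x" "snd x"] by (cases x) auto
  qed
  also have "\<dots> = sqrt (\<Sum>x\<in>?B. (f (fst x))\<^sup>2)"
    unfolding L2_set_def by (intro arg_cong[of _ _ sqrt] sum.cong refl) (auto simp: diff simp del: minus_apply)
  also have "(\<Sum>x\<in>?B. (f (fst x))\<^sup>2) = (\<Sum>\<eta>\<in>lamps_on K. (f \<eta>)\<^sup>2)"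
    by (rule sum.reindex_bij_witness[of _ "\<lambda>\<eta>. (\<eta>, \<one>\<^bsub>G\<^esub>)" fst]) auto
  also have "\<dots> = 1 - (\<Sum>(V, D)\<in>\<A>. lamp_fun V D \<iota>)"
    unfolding f_def by (rule lamp_fun_approx[OF \<A>(1,2) K])
  also have "sqrt \<dots> < \<epsilon>"
    using \<A>(3) \<epsilon> by (intro real_less_lsqrt) auto
  finally show ?thesis
    using F_span by blast
qed

text \<open>The functions that can be approximated form a subspace. It contains the point mass at
  the identity, by left invariance every point mass, and so all finitely supported functions, which
  are dense.\<close>

lemma finite_eigenfunctions_dense:
  assumes perc: "\<P>(\<omega> in bond_percolation G S (1 / q). finite (open_cluster G S \<omega> \<one>\<^bsub>G\<^esub>)) = 1"
    and F: "F \<in> ell2 X" and \<epsilon>: "\<epsilon> > 0"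
  shows "\<exists>K\<in>cfun.span finite_eigenfunctions. ell2_norm X (F - K) < \<epsilon>"
proof -
  let ?sp = "cfun.span finite_eigenfunctions"
  define C where "C = {F \<in> ell2 X. \<forall>\<epsilon>>0. \<exists>K\<in>?sp. ell2_norm X (F - K) < \<epsilon>}"
  have sp_ell2: "K \<in> ell2 X" if "K \<in> ?sp" for K
    using that finite_eigenfunctions_ell2 by blast
  have C_sub: "cfun.subspace C"
  proof (rule cfun.subspaceI)
    have "\<exists>K\<in>?sp. ell2_norm X (0 - K) < \<epsilon>" if "\<epsilon> > 0" for \<epsilon>
      using cfun.span_zero that by (intro bexI[of _ 0]) (simp_all only: diff_self ell2_zero)
    then show "0 \<in> C"
      unfolding C_def using ell2_zero(1) by blast
  next
    fix F K assume FK: "F \<in> C" "K \<in> C"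
    then have e: "F \<in> ell2 X" "K \<in> ell2 X"
      by (auto simp: C_def)
    have "\<exists>J\<in>?sp. ell2_norm X (F + K - J) < \<epsilon>" if "\<epsilon> > 0" for \<epsilon> :: real
    proof -
      obtain F' where F': "F' \<in> ?sp" "ell2_norm X (F - F') < \<epsilon> / 2"
        using FK(1) half_gt_zero[OF \<open>\<epsilon> > 0\<close>] unfolding C_def by blast
      obtain K' where K': "K' \<in> ?sp" "ell2_norm X (K - K') < \<epsilon> / 2"
        using FK(2) half_gt_zero[OF \<open>\<epsilon> > 0\<close>] unfolding C_def by blast
      have "ell2_norm X ((F - F') + (K - K')) \<le> ell2_norm X (F - F') + ell2_norm X (K - K')"
        using e F'(1) K'(1) sp_ell2 by (intro ell2_add ell2_diff)
      also have "(F - F') + (K - K') = F + K - (F' + K')"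
        by (rule add_diff_add[symmetric])
      finally have "ell2_norm X (F + K - (F' + K')) < \<epsilon>"
        using F'(2) K'(2) by linarith
      then show ?thesis
        using cfun.span_add[OF F'(1) K'(1)] by blast
    qed
    then show "F + K \<in> C"
      unfolding C_def using ell2_add(1)[OF e] by blast
  next
    fix c F assume FC: "F \<in> C"
    then have e: "F \<in> ell2 X"
      by (auto simp: C_def)
    have "\<exists>J\<in>?sp. ell2_norm X (cscale c F - J) < \<epsilon>" if "\<epsilon> > 0" for \<epsilon>
    proof -
      \<comment> \<open>The summand 1 avoids division by zero for \<open>c = 0\<close> and makes the
        final inequality strict.\<close>
      have "\<epsilon> / (cmod c + 1) > 0"
        using that by (simp add: add_nonneg_pos)
      then obtain F' where F': "F' \<in> ?sp" "ell2_norm X (F - F') < \<epsilon> / (cmod c + 1)"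
        using FC unfolding C_def by blast
      have "ell2_norm X (cscale c F - cscale c F') = cmod c * ell2_norm X (F - F')"
        unfolding cfun.scale_right_diff_distrib[symmetric]
        by (rule ell2_cscale(2)[OF ell2_diff(1)[OF e sp_ell2[OF F'(1)]]])
      also have "\<dots> \<le> cmod c * (\<epsilon> / (cmod c + 1))"
        using F'(2) by (intro mult_left_mono) auto
      also have "\<dots> < \<epsilon>"
      proof -
        have "cmod c + 1 > 0"
          by (simp add: add_nonneg_pos)
        moreover from this have "cmod c * \<epsilon> < \<epsilon> * (cmod c + 1)"
          using that by (simp add: distrib_left)
        ultimately show ?thesis
          by (simp add: pos_divide_less_eq)
      qed
      finally show ?thesis
        using cfun.span_scale[OF F'(1), of c] by blast
    qed
    then show "cscale c F \<in> C"
      unfolding C_def using ell2_cscale(1)[OF e] by blast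
  qed
  have pm_ell2: "point_mass x \<in> ell2 X" if "x \<in> X" for x
    by (rule ell2_finite(1)[of "{x}"]) (use that in \<open>auto simp: point_mass_def\<close>)
  have pm: "point_mass x \<in> C" if x: "x \<in> X" for x
  proof -
    have "inv\<^bsub>\<Gamma>\<^esub> x \<otimes>\<^bsub>\<Gamma>\<^esub> y = \<one>\<^bsub>\<Gamma>\<^esub> \<longleftrightarrow> y = x" if "y \<in> X" for y
      using x that \<Gamma>.inv_equality[of "inv\<^bsub>\<Gamma>\<^esub> x" y] by (metis \<Gamma>.inv_closed \<Gamma>.inv_inv \<Gamma>.l_inv \<Gamma>.inv_comm)
    then have shift: "point_mass x = left_translate \<Gamma> x (point_mass \<one>\<^bsub>\<Gamma>\<^esub>)"
      using x by (auto simp: point_mass_def left_translate_def fun_eq_iff)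
    have "\<exists>K\<in>?sp. ell2_norm X (point_mass x - K) < \<epsilon>" if "\<epsilon> > 0" for \<epsilon>
    proof -
      obtain K where K: "K \<in> ?sp" "ell2_norm X (point_mass \<one>\<^bsub>\<Gamma>\<^esub> - K) < \<epsilon>"
        using point_mass_one_approx[OF perc \<open>\<epsilon> > 0\<close>] by blast
      have "ell2_norm X (point_mass x - left_translate \<Gamma> x K) = ell2_norm X (left_translate \<Gamma> x (point_mass \<one>\<^bsub>\<Gamma>\<^esub> - K))"
        by (simp only: shift left_translate_diff)
      also have "\<dots> = ell2_norm X (point_mass \<one>\<^bsub>\<Gamma>\<^esub> - K)"
        using K(1) by (intro left_translate_ell2(2)[OF group_\<Gamma> x] ell2_diff pm_ell2 sp_ell2) auto
      finally show ?thesis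
        using K(2) left_translate_span[OF x K(1)] by (intro bexI[of _ "left_translate \<Gamma> x K"]) (simp_all only:)
    qed
    then show ?thesis
      unfolding C_def using pm_ell2[OF x] by blast
  qed
  obtain A where A: "finite A" "A \<subseteq> X" "ell2_norm X (F - (\<lambda>x. if x \<in> A then F x else 0)) < \<epsilon> / 2"
    using ell2_finite_approx[OF F half_gt_zero[OF \<epsilon>]] by blast
  let ?FA = "\<lambda>x. if x \<in> A then F x else 0"
  have "?FA = (\<Sum>x\<in>A. cscale (F x) (point_mass x))"
    using A(1) by (auto simp: fun_eq_iff sum_cfun_apply cscale_def point_mass_def if_distrib cong: if_cong)
  also have "\<dots> \<in> C"
    using A(2) pm by (intro cfun.subspace_sum[OF C_sub] cfun.subspace_scale[OF C_sub]) auto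
  finally have FA: "?FA \<in> C" .
  then have FA2: "?FA \<in> ell2 X"
    by (simp add: C_def)
  obtain K where K: "K \<in> ?sp" "ell2_norm X (?FA - K) < \<epsilon> / 2"
    using FA half_gt_zero[OF \<epsilon>] unfolding C_def by blast
  have "ell2_norm X ((F - ?FA) + (?FA - K)) \<le> ell2_norm X (F - ?FA) + ell2_norm X (?FA - K)"
    using F FA2 K(1) sp_ell2 by (intro ell2_add ell2_diff)
  also have "(F - ?FA) + (?FA - K) = F - K"
    by (rule diff_add_cancel[THEN arg_cong, of "\<lambda>x. x - K", unfolded add_diff_eq[symmetric]])
  finally show ?thesis
    using A(3) K by (intro bexI[of _ K]) linarith+
qed

text \<open>Self-adjointness makes \<open>c\<close> and \<open>cnj d\<close> multipliers with the
  same effect on the inner product, and \<open>d\<close> is real as an eigenvalue of a symmetric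
  matrix.\<close>

lemma eigenfunctions_orthogonal:
  assumes c: "c \<in> Lambda_bd G \<mu>" "d \<in> Lambda_bd G \<mu>" "c \<noteq> d"
    and F: "finite_support F" "F \<in> ell2 X" "R F = cscale c F"
    and K: "finite_support K" "K \<in> ell2 X" "R K = cscale d K"
  shows "fin_inner F K = 0"
proof -
  let ?A = "{x. F x \<noteq> 0} \<union> {x. K x \<noteq> 0}"
  have A: "finite ?A" "?A \<subseteq> X"
    using F(1,2) K(1,2) by (auto simp: finite_support_def ell2_outside) (metis ell2_outside)+
  have inner: "fin_inner F K = (\<Sum>x\<in>?A. F x * cnj (K x))"
    using A(1) by (intro fin_inner_eq) auto
  have "(\<Sum>x\<in>?A. R F x * cnj (K x)) = (\<Sum>x\<in>?A. F x * cnj (R K x))"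
    unfolding R_bd_def
    by (rule right_convolution_self_adjoint[OF A]) (auto simp: mu_bd_transition_sym)
  then have "c * fin_inner F K = cnj d * fin_inner F K"
    unfolding F(3) K(3) inner by (simp add: cscale_def sum_distrib_left mult_ac)
  then show ?thesis
    using Lambda_real[OF c(2)] c(3) by simp
qed

text \<open>If finitely many functions spanned the finitely supported eigenfunctions for
  \<open>c\<close>, all supports would lie in one finite set; but left translations carry a support
  point through all of \<open>X\<close>, which is infinite because \<open>G\<close> is.\<close>

lemma infinite_independent_eigenfunctions:
  assumes inf: "infinite (carrier G)" and c: "c \<in> Lambda_bd G \<mu>"
  shows "\<exists>B. infinite B \<and> cfun.independent B \<and> (\<forall>F\<in>B. eigenfunction X R c F \<and> finite_support F)"
proof -
  let ?W = "{F. eigenfunction X R c F \<and> finite_support F}"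
  obtain B where B: "B \<subseteq> ?W" "cfun.independent B" "?W \<subseteq> cfun.span B"
    by (rule cfun.maximal_independent_subset)
  have "infinite B"
  proof
    assume "finite B"
    define Q where "Q = (\<Union>F\<in>B. {x. F x \<noteq> 0})"
    have Q: "finite Q"
      unfolding Q_def using \<open>finite B\<close> B(1) by (auto simp: finite_support_def)
    have out: "F x = 0" if "F \<in> cfun.span B" "x \<notin> Q" for F x
      using that(1)
    proof (induction rule: cfun.span_induct_alt)
      case (step r y z)
      then show ?case
        using that(2) by (auto simp: Q_def cscale_def)
    qed simp
    obtain F where F: "eigenfunction X R c F" "finite_support F"
      using Lambda_eigenfunction[OF c] .
    then obtain x where x: "F x \<noteq> 0" "x \<in> X"
      by (auto simp: eigenfunction_def fun_eq_iff) (metis ell2_outside)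
    have "\<gamma> \<otimes>\<^bsub>\<Gamma>\<^esub> x \<in> Q" if "\<gamma> \<in> X" for \<gamma>
    proof (rule ccontr)
      assume "\<gamma> \<otimes>\<^bsub>\<Gamma>\<^esub> x \<notin> Q"
      moreover have "left_translate \<Gamma> \<gamma> F \<in> cfun.span B"
        using B(3) F eigenfunction_left_translate[OF group_\<Gamma> that] left_translate_finite_support[OF group_\<Gamma> that]
        unfolding R_bd_def by blast
      ultimately have "left_translate \<Gamma> \<gamma> F (\<gamma> \<otimes>\<^bsub>\<Gamma>\<^esub> x) = 0"
        using out by blast
      then show False
        using x by (simp add: left_translate_mult[OF group_\<Gamma> that])
    qed
    then have "(\<lambda>\<gamma>. \<gamma> \<otimes>\<^bsub>\<Gamma>\<^esub> x) ` X \<subseteq> Q"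
      by blast
    moreover have "inj_on (\<lambda>\<gamma>. \<gamma> \<otimes>\<^bsub>\<Gamma>\<^esub> x) X"
      using x(2) by (auto intro!: inj_onI)
    ultimately have "finite X"
      using Q by (metis finite_subset finite_imageD)
    then have "finite (snd ` X)"
      by simp
    moreover have "carrier G \<subseteq> snd ` X"
      unfolding X_eq using iota_L by force
    ultimately show False
      using inf finite_subset by blast
  qed
  then show ?thesis
    using B by blast
qed

text \<open>Orthonormalisation is carried out in the finitely supported part of each eigenspace
  separately, so that basis vectors remain eigenfunctions; different eigenspaces are orthogonal, so
  the union is orthonormal.\<close>

lemma eigenfunction_orthonormal_basis:
  obtains B where "B \<subseteq> finite_eigenfunctions" "finite_eigenfunctions \<subseteq> cfun.span B"
    "\<And>F K. F \<in> B \<Longrightarrow> K \<in> B \<Longrightarrow> fin_inner F K = (if F = K then 1 else 0)"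
proof -
  define W where "W c = {F. finite_support F \<and> F \<in> ell2 X \<and> R F = cscale c F}" for c
  have R_add: "R (F + K) = R F + R K" if "F \<in> ell2 X" "K \<in> ell2 X" for F K
    using R_bounded that unfolding ell2_bounded_operator_def by blast
  have R_scale: "R (cscale c F) = cscale c (R F)" if "F \<in> ell2 X" for F c
    using R_bounded that unfolding ell2_bounded_operator_def by blast
  have W_sub: "cfun.subspace (W c)" for c
  proof (rule cfun.subspaceI)
    have "R 0 = 0"
      using R_scale[OF ell2_zero(1), of 0] by (simp only: cfun.scale_zero_left)
    moreover have "finite_support (0 :: ('g set \<Rightarrow> 'h) \<times> 'g \<Rightarrow> complex)"
      by (simp add: finite_support_def)
    ultimately show "0 \<in> W c"
      unfolding W_def mem_Collect_eq by (simp only: ell2_zero(1) cfun.scale_zero_right simp_thms)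
    show "F + K \<in> W c" if "F \<in> W c" "K \<in> W c" for F K
      using that unfolding W_def mem_Collect_eq
      by (simp only: finite_support_add ell2_add R_add cfun.scale_right_distrib simp_thms)
    show "cscale r F \<in> W c" if "F \<in> W c" for F r
      using that unfolding W_def mem_Collect_eq
      by (simp only: finite_support_cscale ell2_cscale R_scale cfun.scale_left_commute simp_thms)
  qed
  have "\<exists>B. B \<subseteq> W c \<and> W c \<subseteq> cfun.span B \<and>
      (\<forall>F\<in>B. \<forall>K\<in>B. fin_inner F K = (if F = K then 1 else 0))" for c
  proof -
    have "finite_support F" "F x = 0" if "F \<in> W c" "x \<notin> X" for F x
      using that ell2_outside[of F X x] by (simp_all add: W_def)
    moreover have "finite_support F" if "F \<in> W c" for F
      using that by (simp add: W_def)
    ultimately obtain B where "B \<subseteq> W c" "W c \<subseteq> cfun.span B"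
      "\<And>F K. F \<in> B \<Longrightarrow> K \<in> B \<Longrightarrow> fin_inner F K = (if F = K then 1 else 0)"
      using finitely_supported_orthonormal_basis[OF W_sub[of c], of X thesis] countable_X by blast
    then show ?thesis
      by blast
  qed
  then obtain B where B: "B c \<subseteq> W c" "W c \<subseteq> cfun.span (B c)"
    "\<forall>F\<in>B c. \<forall>K\<in>B c. fin_inner F K = (if F = K then 1 else 0)" for c
    by metis
  define BB where "BB = (\<Union>c\<in>Lambda_bd G \<mu>. B c)"
  have "F \<noteq> 0" if "F \<in> B c" for F c
  proof
    assume "F = 0"
    then have "fin_inner F F = 0"
      by (simp only: fin_inner_zero_right)
    moreover have "fin_inner F F = 1"
      using bspec[OF bspec[OF B(3) that] that] by (simp only: simp_thms if_True)
    ultimately show False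
      by simp
  qed
  then have sub: "BB \<subseteq> finite_eigenfunctions"
    using B(1) unfolding BB_def finite_eigenfunctions_def eigenfunction_def W_def by blast
  have span: "finite_eigenfunctions \<subseteq> cfun.span BB"
  proof
    fix F assume "F \<in> finite_eigenfunctions"
    then obtain c where "c \<in> Lambda_bd G \<mu>" "F \<in> W c"
      unfolding finite_eigenfunctions_def eigenfunction_def W_def by blast
    moreover from this have "cfun.span (B c) \<subseteq> cfun.span BB"
      unfolding BB_def by (intro cfun.span_mono) blast
    ultimately show "F \<in> cfun.span BB"
      using B(2) by blast
  qed
  have "fin_inner F K = (if F = K then 1 else 0)" if FK: "F \<in> BB" "K \<in> BB" for F K
  proof -
    obtain c d where cd: "c \<in> Lambda_bd G \<mu>" "F \<in> B c" "d \<in> Lambda_bd G \<mu>" "K \<in> B d"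
      using FK unfolding BB_def by blast
    show ?thesis
    proof (cases "c = d")
      case True
      then show ?thesis
        using B(3) cd by blast
    next
      case False
      have W: "F \<in> W c" "K \<in> W d"
        using B(1) cd by blast+
      have "fin_inner F K = 0"
        by (rule eigenfunctions_orthogonal[OF cd(1,3) False]) (use W in \<open>simp_all add: W_def\<close>)
      moreover have "F \<noteq> K"
        using \<open>fin_inner F K = 0\<close> B(3) cd(2) by (metis zero_neq_one)
      ultimately show ?thesis
        by simp
    qed
  qed
  with sub span show thesis
    by (rule that)
qed

text \<open>Density passes from all finitely supported eigenfunctions to the orthonormal system
  spanning them. For the spectrum, one inclusion comes from diagonality in this system, the other
  from the eigenfunctions that exist for each element of \<Lambda>.\<close>

lemma pure_point_spectrum:
  assumes perc: "\<P>(\<omega> in bond_percolation G S (1 / q). finite (open_cluster G S \<omega> \<one>\<^bsub>G\<^esub>)) = 1"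
  shows "ell2_spectrum X R = closure (Lambda_bd G \<mu>)"
    and "\<exists>B. complete_orthonormal_system X B \<and>
      (\<forall>F\<in>B. finite_support F \<and> (\<exists>c\<in>Lambda_bd G \<mu>. eigenfunction X R c F))"
proof -
  obtain B where B: "B \<subseteq> finite_eigenfunctions" "finite_eigenfunctions \<subseteq> cfun.span B"
    and orth: "\<And>F K. F \<in> B \<Longrightarrow> K \<in> B \<Longrightarrow> fin_inner F K = (if F = K then 1 else 0)"
    using eigenfunction_orthonormal_basis by blast
  have fs: "finite_support F" and ell2: "F \<in> ell2 X" and eig: "\<exists>c\<in>Lambda_bd G \<mu>. eigenfunction X R c F"
    if "F \<in> B" for F
    using B(1) that unfolding finite_eigenfunctions_def eigenfunction_def by blast+
  have "cfun.span finite_eigenfunctions \<subseteq> cfun.span B"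
    by (rule cfun.span_minimal[OF B(2) cfun.subspace_span])
  then have dense: "\<exists>K\<in>cfun.span B. ell2_norm X (F - K) < \<epsilon>" if "F \<in> ell2 X" "\<epsilon> > 0" for F \<epsilon>
    using finite_eigenfunctions_dense[OF perc that] by blast
  show "ell2_spectrum X R = closure (Lambda_bd G \<mu>)"
  proof
    show "ell2_spectrum X R \<subseteq> closure (Lambda_bd G \<mu>)"
      by (rule ell2_spectrum_subset_closure[OF R_bounded fs _ orth dense])
        (use ell2 eig in \<open>auto simp: eigenfunction_def\<close>)
    show "closure (Lambda_bd G \<mu>) \<subseteq> ell2_spectrum X R"
      by (rule ell2_spectrum_supset_closure) (use Lambda_eigenfunction in blast)
  qed
  have "ell2_inner X F K = (if F = K then 1 else 0)" if "F \<in> B" "K \<in> B" for F K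
    using ell2_inner_eq_fin_inner[OF fs[OF that(1)]] ell2_outside[OF ell2[OF that(1)]] orth[OF that] by metis
  then have "complete_orthonormal_system X B"
    unfolding complete_orthonormal_system_def using ell2 dense by blast
  then show "\<exists>B. complete_orthonormal_system X B \<and>
      (\<forall>F\<in>B. finite_support F \<and> (\<exists>c\<in>Lambda_bd G \<mu>. eigenfunction X R c F))"
    using fs eig by blast
qed

end

text \<open>Infinitely many independent eigenfunctions presuppose an infinite \<open>G\<close>: for
  finite \<open>G\<close> the lamplighter group is finite, and so is the dimension of its function
  space. Finite generation of \<open>G\<close> is contained in the finiteness of the generating
  support.\<close>

theorem mainTheorem11:
  fixes G :: "('g, 'm) monoid_scheme"
    and H :: "('h, 'k) monoid_scheme"
    and \<mu> :: "'g pmf"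
  assumes "Group.group G"
    and "Group.group H" and "finite (carrier H)" and "card (carrier H) \<ge> 2"
    and "set_pmf \<mu> \<subseteq> carrier G" and "finite (set_pmf \<mu>)"
    and "\<forall>g\<in>carrier G. pmf \<mu> (inv\<^bsub>G\<^esub> g) = pmf \<mu> g"
    and "generate G (set_pmf \<mu>) = carrier G"
  shows
    "Lambda_bd G \<mu> \<subseteq> point_spectrum (carrier (bd_lamplighter G H (set_pmf \<mu>))) (R_bd G H \<mu>) \<and>
     (infinite (carrier G) \<longrightarrow>
       (\<forall>c\<in>Lambda_bd G \<mu>. \<exists>B. infinite B \<and> cfun.independent B \<and>
         (\<forall>F\<in>B. eigenfunction (carrier (bd_lamplighter G H (set_pmf \<mu>))) (R_bd G H \<mu>) c F \<and>
                finite_support F))) \<and>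
     (\<P>(\<omega> in bond_percolation G (set_pmf \<mu>) (1 / real (card (carrier H))).
         finite (open_cluster G (set_pmf \<mu>) \<omega> \<one>\<^bsub>G\<^esub>)) = 1 \<longrightarrow>
       pure_point (carrier (bd_lamplighter G H (set_pmf \<mu>))) (R_bd G H \<mu>) \<and>
       ell2_spectrum (carrier (bd_lamplighter G H (set_pmf \<mu>))) (R_bd G H \<mu>)
         = closure (Lambda_bd G \<mu>) \<and>
       (\<exists>B. complete_orthonormal_system (carrier (bd_lamplighter G H (set_pmf \<mu>))) B \<and>
         (\<forall>F\<in>B. finite_support F \<and>
           (\<exists>c\<in>Lambda_bd G \<mu>.
             eigenfunction (carrier (bd_lamplighter G H (set_pmf \<mu>))) (R_bd G H \<mu>) c F))))"
proof -
  interpret bond_lamplighter G H \<mu>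
    by (rule bond_lamplighter.intro) (use assms in auto)
  have "Lambda_bd G \<mu> \<subseteq> point_spectrum X R"
    unfolding point_spectrum_def using Lambda_eigenfunction by blast
  moreover have "pure_point X R"
    if "\<P>(\<omega> in bond_percolation G S (1 / q). finite (open_cluster G S \<omega> \<one>\<^bsub>G\<^esub>)) = 1"
    unfolding pure_point_def using pure_point_spectrum(2)[OF that] by blast
  ultimately show ?thesis
    using infinite_independent_eigenfunctions pure_point_spectrum by blast
qed

end
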